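(* For any odd positive integer $k$ and any nonnegative integer $\ell\le k$, we have $$T_{ш}^{\mathcal S}(\{1\}^\ell,2,\{1\}^{k-\ell})=\frac{(-1)^{\ell}}{\ell+1}\binom{k+1}{\ell}\,T_{ш}^{\mathcal S}(2,\{1\}^k)=(-1)^{\ell}\binom{k+2}{\ell+1}\frac{2^{k+2}-1}{2(2^{k+1}-1)}\,T_{ш}^{\mathcal S}(k+2)$$ in $\mathbb R$, and $$T_{\mathcal A}(\{1\}^\ell,2,\{1\}^{k-\ell})=\frac{(-1)^{\ell}}{\ell+1}\binom{k+1}{\ell}\,T_{\mathcal A}(2,\{1\}^k)=(-1)^{\ell}\binom{k+2}{\ell+1}\frac{2^{k+2}-1}{2(2^{k+1}-1)}\,T_{\mathcal A}(k+2)$$ in $\mathcal A$.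
   Context: Notation: $\{1\}^m$ denotes the string $1,\dots,1$ of length $m$ (empty if $m=0$). Finite values: let $\mathcal P$ be the set of primes and $\mathcal A=\prod_{p\in\mathcal P}(\mathbb Z/p\mathbb Z)\big/\bigoplus_{p\in\mathcal P}(\mathbb Z/p\mathbb Z)$, a $\mathbb Q$-algebra; two elements are equal iff their components agree for all but finitely many $p$. For positive integers $s_1,\dots,s_d$, $T_{\mathcal A}(s_1,\dots,s_d)\in\mathcal A$ is the class of $$\Big(\sum_{\substack{p>n_1>\dots>n_d>0\\ n_j\equiv d-j+1 \ (\mathrm{mod}\ 2)}}\frac{2^d}{n_1^{s_1}\cdots n_d^{s_d}} \bmod p\Big)_{p\in\mathcal P}.$$ Shuffle-regularized values: put $\omega_0=\frac{dt}{t}$, $\omega_1=\frac{2t\,dt}{1-t^2}$, $\omega_{-1}=\frac{2\,dt}{1-t^2}$. For a word $\eta_1\cdots\eta_m$ in these forms, $\eta_i=f_i(t)\,dt$, and $0<x\le1$, set $\int_0^x\eta_1\cdots\eta_m=\int_{x>t_1>\cdots>t_m>0}f_1(t_1)\cdots f_m(t_m)\,dt_1\cdots dt_m$. To $\mathbf s=(s_1,\dots,s_d)$ associate the words $W_T(\mathbf s)=\omega_0^{s_1-1}\omega_{-1}\cdots\omega_0^{s_d-1}\omega_{-1}$ and $W_S(\mathbf s)=\omega_0^{s_1-1}\omega_{-1}\cdots\omega_0^{s_{d-1}-1}\omega_{-1}\,\omega_0^{s_d-1}\omega_1$. For $F\in\{S,T\}$, as $\epsilon\to0^+$ one has $\int_0^{1-\epsilon}W_F(\mathbf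 s)=P_{F,\mathbf s}(-\log\epsilon)+o(1)$ for a unique real polynomial $P_{F,\mathbf s}$; set $F_{ш}(\mathbf s)=P_{F,\mathbf s}(X)$, with $X$ a formal variable. If $s_1\ge2$ this is the constant $\int_0^1W_F(\mathbf s)$. For the empty index ($d=0$) set $F_{ш}=1$. Symmetric multiple $T$-values: $$T_{ш}^{\mathcal S}(s_1,\dots,s_d)=\begin{cases}\sum_{i=0}^d\big(\prod_{\ell=1}^i(-1)^{s_\ell}\big)T_{ш}(s_i,\dots,s_1)\,T_{ш}(s_{i+1},\dots,s_d), & d\text{ even},\\ \sum_{i=0}^d\big(\prod_{\ell=1}^i(-1)^{s_\ell}\big)S_{ш}(s_i,\dots,s_1)\,T_{ш}(s_{i+1},\dots,s_d), & d\text{ odd}.\end{cases}$$ This is a real number (it does not depend on $X$). *)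

theory Defs
  imports "HOL-Analysis.Analysis" "HOL-Number_Theory.Number_Theory"
begin

section \<open>The ring of finite values\<close>

text \<open>
  A family of residues modulo the primes is represented by integer representatives
  \<open>f p\<close>; the values of \<open>f\<close> at non-primes are irrelevant. The relation
  below combines reduction modulo \<open>p\<close> in each component with the quotient by the
  direct sum.
\<close>

definition A_eq :: "(nat \<Rightarrow> int) \<Rightarrow> (nat \<Rightarrow> int) \<Rightarrow> bool" where
  "A_eq f g \<longleftrightarrow> finite {p. prime p \<and> \<not> [f p = g p] (mod int p)}"

lemma A_eq_mono2:
  assumes "A_eq f f'" "A_eq g g'"
    and "\<And>p. prime p \<Longrightarrow> [f p = f' p] (mod int p) \<Longrightarrow> [g p = g' p] (mod int p)
              \<Longrightarrow> [h p = h' p] (mod int p)"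
  shows "A_eq h h'"
proof -
  have "{p. prime p \<and> \<not> [h p = h' p] (mod int p)} \<subseteq>
        {p. prime p \<and> \<not> [f p = f' p] (mod int p)} \<union> {p. prime p \<and> \<not> [g p = g' p] (mod int p)}"
    using assms(3) by blast
  thus ?thesis
    using assms(1,2) unfolding A_eq_def by (rule finite_subset[OF _ finite_UnI])
qed

lemma A_eq_refl: "A_eq f f"
  by (simp add: A_eq_def)

quotient_type ring_A = "nat \<Rightarrow> int" / A_eq
  morphisms rep_A class_A
proof (rule equivpI)
  show "reflp A_eq" by (simp add: reflp_def A_eq_refl)
  show "symp A_eq" by (rule sympI) (erule A_eq_mono2[OF _ A_eq_refl[of id]], erule cong_sym)
  show "transp A_eq" by (rule transpI) (erule (1) A_eq_mono2, erule (1) cong_trans)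
qed

instantiation ring_A :: comm_ring_1
begin

lift_definition zero_ring_A :: ring_A is "\<lambda>_. 0" .

lift_definition one_ring_A :: ring_A is "\<lambda>_. 1" .

lift_definition plus_ring_A :: "ring_A \<Rightarrow> ring_A \<Rightarrow> ring_A" is "\<lambda>f g p. f p + g p"
  by (erule (1) A_eq_mono2) (rule cong_add)

lift_definition minus_ring_A :: "ring_A \<Rightarrow> ring_A \<Rightarrow> ring_A" is "\<lambda>f g p. f p - g p"
  by (erule (1) A_eq_mono2) (rule cong_diff)

lift_definition uminus_ring_A :: "ring_A \<Rightarrow> ring_A" is "\<lambda>f p. - f p"
  by (erule A_eq_mono2[OF _ A_eq_refl[of id]]) (simp only: cong_minus_minus_iff)

lift_definition times_ring_A :: "ring_A \<Rightarrow> ring_A \<Rightarrow> ring_A" is "\<lambda>f g p. f p * g p"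
  by (erule (1) A_eq_mono2) (rule cong_mult)

instance
proof
  show "(0 :: ring_A) \<noteq> 1"
  proof (transfer, unfold A_eq_def)
    have "{p. prime p \<and> \<not> [(0::int) = 1] (mod int p)} = {p::nat. prime p}"
      by (auto simp: cong_iff_dvd_diff)
    thus "\<not> finite {p. prime p \<and> \<not> [(0::int) = 1] (mod int p)}"
      using primes_infinite by simp
  qed
next
  fix a b c :: ring_A
  show "a * b * c = a * (b * c)" by transfer (simp add: A_eq_refl mult.assoc)
  show "a * b = b * a" by transfer (simp add: A_eq_refl mult.commute)
  show "1 * a = a" by transfer (simp add: A_eq_refl)
  show "a + b + c = a + (b + c)" by transfer (simp add: A_eq_refl add.assoc)
  show "a + b = b + a" by transfer (simp add: A_eq_refl add.commute)
  show "0 + a = a" by transfer (simp add: A_eq_refl)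
  show "- a + a = 0" by transfer (simp add: A_eq_refl)
  show "a - b = a + - b" by transfer (simp add: A_eq_refl)
  show "(a + b) * c = a * c + b * c" by transfer (simp add: A_eq_refl distrib_right)
qed

end

text \<open>
  Reduction modulo \<open>p\<close> of a rational number in lowest terms \<open>a / b\<close>, meaningful
  if \<open>p\<close> does not divide \<open>b\<close>. For a fixed rational number this fails for only
  finitely many primes, so it embeds the rationals into \<open>ring_A\<close>.
\<close>

definition rat_mod :: "nat \<Rightarrow> rat \<Rightarrow> int" where
  "rat_mod p q = (case quotient_of q of (a, b) \<Rightarrow> (a * modular_inverse (int p) b) mod int p)"

definition rat_A :: "rat \<Rightarrow> ring_A" where
  "rat_A q = class_A (\<lambda>p. rat_mod p q)"

lemma coprime_int_prime: "prime p \<Longrightarrow> \<not> int p dvd b \<Longrightarrow> coprime b (int p)"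
  using prime_imp_coprime[of "int p" b] by (simp add: coprime_commute)

lemma rat_mod_cong:
  assumes p: "prime p" and ab: "quotient_of q = (a, b)" and nd: "\<not> int p dvd b"
    and cd: "q = of_int c / of_int d" "\<not> int p dvd d"
  shows "[rat_mod p q * d = c] (mod int p)"
proof -
  have b: "b > 0" and q: "q = of_int a / of_int b"
    using quotient_of_denom_pos[OF ab] quotient_of_div[OF ab] by auto
  have "d \<noteq> 0" using cd by auto
  have "of_int a * of_int d = (of_int c * of_int b :: rat)"
    using q cd b \<open>d \<noteq> 0\<close> by (simp add: field_simps)
  hence eq: "a * d = c * b" by (metis of_int_eq_iff of_int_mult)
  have cop: "coprime b (int p)"
    using p nd by (auto intro: coprime_int_prime)
  have inv: "[b * modular_inverse (int p) b = 1] (mod int p)"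
    using cop p by (metis cong_modular_inverse1)
  have "[rat_mod p q * d = a * modular_inverse (int p) b * d] (mod int p)"
    by (simp add: rat_mod_def ab cong_def mod_mult_left_eq)
  also have "a * modular_inverse (int p) b * d = c * (b * modular_inverse (int p) b)"
    using eq by (metis (no_types, lifting) mult.assoc mult.commute)
  also have "[c * (b * modular_inverse (int p) b) = c * 1] (mod int p)"
    by (rule cong_mult[OF cong_refl inv])
  finally show ?thesis by simp
qed

lemma finite_prime_dvd: "b \<noteq> 0 \<Longrightarrow> finite {p. prime p \<and> int p dvd (b::int)}"
proof -
  assume "b \<noteq> 0"
  have "{p. prime p \<and> int p dvd b} \<subseteq> {..nat \<bar>b\<bar>}"
    using \<open>b \<noteq> 0\<close> by (auto dest: dvd_imp_le_int)
  thus ?thesis using finite_subset by blast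
qed

lemma class_A_eq_rat_A:
  assumes "q = of_int c / of_int d" "d \<noteq> 0"
    and "\<And>p. prime p \<Longrightarrow> \<not> int p dvd m \<Longrightarrow> [f p * d = c] (mod int p)" and "m \<noteq> 0"
  shows "class_A f = rat_A q"
proof -
  obtain a b where ab: "quotient_of q = (a, b)" by fastforce
  have b: "b \<noteq> 0" using quotient_of_denom_pos[OF ab] by simp
  have "A_eq f (\<lambda>p. rat_mod p q)"
    unfolding A_eq_def
  proof (rule finite_subset[OF _ finite_prime_dvd[of "b * d * m"]])
    show "{p. prime p \<and> \<not> [f p = rat_mod p q] (mod int p)} \<subseteq> {p. prime p \<and> int p dvd b * d * m}"
    proof (safe, rule ccontr)
      fix p assume p: "prime p" "\<not> int p dvd b * d * m" "\<not> [f p = rat_mod p q] (mod int p)"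
      hence nd: "\<not> int p dvd b" "\<not> int p dvd d" "\<not> int p dvd m" by auto
      have "[f p * d = rat_mod p q * d] (mod int p)"
        using assms(3)[OF p(1) nd(3)] rat_mod_cong[OF p(1) ab nd(1) assms(1) nd(2)]
        by (metis cong_sym cong_trans)
      moreover have "coprime d (int p)"
        using p nd by (auto intro: coprime_int_prime)
      ultimately show False using p(3) by (simp add: cong_mult_rcancel)
    qed
  qed (use b assms in auto)
  thus ?thesis unfolding rat_A_def by (simp add: ring_A.abs_eq_iff)
qed

lemma rat_A_hom:
  shows "rat_A 1 = 1"
    and "rat_A (q + r) = rat_A q + rat_A r"
    and "rat_A (q * r) = rat_A q * rat_A r"
proof -
  show "rat_A 1 = 1"
    using class_A_eq_rat_A[of 1 1 1 1 "\<lambda>_. 1"] by (simp add: one_ring_A.abs_eq)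
  obtain a b where ab: "quotient_of q = (a, b)" by fastforce
  obtain c d where cd: "quotient_of r = (c, d)" by fastforce
  have bd: "b \<noteq> 0" "d \<noteq> 0" using quotient_of_denom_pos[OF ab] quotient_of_denom_pos[OF cd] by auto
  have q: "q = of_int a / of_int b" and r: "r = of_int c / of_int d"
    using quotient_of_div[OF ab] quotient_of_div[OF cd] by auto
  have *: "[rat_mod p q * b = a] (mod int p)" "[rat_mod p r * d = c] (mod int p)"
    if "prime p" "\<not> int p dvd b * d" for p
  proof -
    have nd: "\<not> int p dvd b" "\<not> int p dvd d" using that(2) by auto
    show "[rat_mod p q * b = a] (mod int p)" "[rat_mod p r * d = c] (mod int p)"
      using rat_mod_cong[OF that(1) ab nd(1) q nd(1)] rat_mod_cong[OF that(1) cd nd(2) r nd(2)]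
      by simp_all
  qed
  have "class_A (\<lambda>p. rat_mod p q + rat_mod p r) = rat_A (q + r)"
  proof (rule class_A_eq_rat_A[where m = "b * d"])
    show "q + r = of_int (a * d + c * b) / of_int (b * d)"
      using bd by (simp add: q r field_simps)
    fix p :: nat assume p: "prime p" "\<not> int p dvd b * d"
    have "[(rat_mod p q * b) * d + (rat_mod p r * d) * b = a * d + c * b] (mod int p)"
      by (intro cong_add cong_mult *[OF p] cong_refl)
    thus "[(rat_mod p q + rat_mod p r) * (b * d) = a * d + c * b] (mod int p)"
      by (simp add: algebra_simps)
  qed (use bd in auto)
  thus "rat_A (q + r) = rat_A q + rat_A r"
    by (simp add: rat_A_def plus_ring_A.abs_eq)
  have "class_A (\<lambda>p. rat_mod p q * rat_mod p r) = rat_A (q * r)"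
  proof (rule class_A_eq_rat_A[where m = "b * d"])
    show "q * r = of_int (a * c) / of_int (b * d)"
      by (simp add: q r)
    fix p :: nat assume p: "prime p" "\<not> int p dvd b * d"
    have "[(rat_mod p q * b) * (rat_mod p r * d) = a * c] (mod int p)"
      by (intro cong_mult *[OF p])
    thus "[(rat_mod p q * rat_mod p r) * (b * d) = a * c] (mod int p)"
      by (simp add: algebra_simps)
  qed (use bd in auto)
  thus "rat_A (q * r) = rat_A q * rat_A r"
    by (simp add: rat_A_def times_ring_A.abs_eq)
qed


section \<open>Finite multiple T-values\<close>

text \<open>
  List positions start at 0, so the congruence condition on the entry at position \<open>j\<close>
  involves \<open>d - (j + 1) + 1 = d - j\<close>.
\<close>

definition T_tuples :: "nat \<Rightarrow> nat \<Rightarrow> nat list set" where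
  "T_tuples d p = {ns. length ns = d \<and> sorted_wrt (>) ns \<and> set ns \<subseteq> {0<..<p} \<and>
                       (\<forall>j<d. [ns ! j = d - j] (mod 2))}"

definition T_sum :: "nat list \<Rightarrow> nat \<Rightarrow> rat" where
  "T_sum s p = (\<Sum>ns\<in>T_tuples (length s) p.
                  2 ^ length s / (\<Prod>j<length s. of_nat (ns ! j) ^ (s ! j)))"

definition T_A :: "nat list \<Rightarrow> ring_A" where
  "T_A s = class_A (\<lambda>p. rat_mod p (T_sum s p))"


section \<open>Shuffle-regularized values\<close>

datatype diff_form = Omega_0 | Omega_1 | Omega_m1

fun form_density :: "diff_form \<Rightarrow> real \<Rightarrow> real" where
  "form_density Omega_0 t = 1 / t"
| "form_density Omega_1 t = 2 * t / (1 - t\<^sup>2)"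
| "form_density Omega_m1 t = 2 / (1 - t\<^sup>2)"

text \<open>
  The Lebesgue integral over the simplex \<open>x > t 0 > \<dots> > t (m - 1) > 0\<close>. For the empty
  word the measure is a point mass, and the integral is 1.
\<close>

definition ord_simplex :: "nat \<Rightarrow> real \<Rightarrow> (nat \<Rightarrow> real) set" where
  "ord_simplex m x = {t. (\<forall>i<m. 0 < t i \<and> t i < x) \<and> (\<forall>i j. i < j \<and> j < m \<longrightarrow> t j < t i)}"

definition iter_int :: "real \<Rightarrow> diff_form list \<Rightarrow> real" where
  "iter_int x w =
     (LINT t:ord_simplex (length w) x|PiM {..<length w} (\<lambda>_. lborel). \<Prod>i<length w. form_density (w ! i) (t i))"

definition word_T :: "nat list \<Rightarrow> diff_form list" where
  "word_T s = concat (map (\<lambda>n. replicate (n - 1) Omega_0 @ [Omega_m1]) s)"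

definition word_S :: "nat list \<Rightarrow> diff_form list" where
  "word_S s = (if s = [] then []
     else word_T (butlast s) @ replicate (last s - 1) Omega_0 @ [Omega_1])"

definition reg_poly :: "diff_form list \<Rightarrow> real poly" where
  "reg_poly w = (THE P. ((\<lambda>\<epsilon>. iter_int (1 - \<epsilon>) w - poly P (- ln \<epsilon>)) \<longlongrightarrow> 0) (at_right 0))"

definition T_sh :: "nat list \<Rightarrow> real poly" where
  "T_sh s = (if s = [] then 1 else reg_poly (word_T s))"

definition S_sh :: "nat list \<Rightarrow> real poly" where
  "S_sh s = (if s = [] then 1 else reg_poly (word_S s))"


section \<open>Symmetric multiple T-values\<close>

definition T_sym_poly :: "nat list \<Rightarrow> real poly" where
  "T_sym_poly s =
     (\<Sum>i\<le>length s. (\<Prod>l<i. (- 1) ^ (s ! l)) *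
        (if even (length s) then T_sh (rev (take i s)) else S_sh (rev (take i s))) *
        T_sh (drop i s))"

text \<open>The polynomial above is constant; its value is the real number meant.\<close>

definition T_sym :: "nat list \<Rightarrow> real" where
  "T_sym s = (THE c. T_sym_poly s = [:c:])"

end

theory Submission
  imports Defs
begin

text \<open>
  Write \<open>u(x) = ln ((1 + x) / (1 - x))\<close>, so that \<open>\<omega>\<^sub>-\<^sub>1 = du\<close>. The word of the index
  \<open>({1}^a, 2, {1}^(b-1))\<close> is \<open>a\<close> letters \<open>\<omega>\<^sub>-\<^sub>1\<close>, one letter \<open>\<omega>\<^sub>0\<close>, and \<open>b\<close> letters
  \<open>\<omega>\<^sub>-\<^sub>1\<close>; its iterated integral is
  \<open>\<integral>\<^sub>0\<^sup>x (u(x) - u(t))^a / a! * u(t)^b / b! * dt/t\<close>, which expands to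
  \<open>\<Sum>j\<le>a. (-1)^j / ((a-j)! j! b!) * u(x)^(a-j) * \<integral>\<^sub>0\<^sup>x u(t)^(b+j) dt/t\<close>. Both halves of the theorem
  rest on this expansion, once for real functions (\<open>iterated_primitive_depth_primitive\<close>) and once
  for formal power series (\<open>top_series_depth\<close>).

  Real values. As \<open>x\<close> tends to 1, \<open>u(x)\<close> may be replaced by \<open>X + ln 2\<close>, and
  \<open>\<integral>\<^sub>0\<^sup>x u(t)^m dt/t\<close> tends to \<open>z\<^sub>m = m! \<chi>\<^sub>m\<^sub>+\<^sub>1(1)\<close>, where \<open>\<chi>\<^sub>n(1)\<close> is \<open>\<Sum> 2/i^n\<close> over the odd \<open>i\<close>,
  that is, \<open>T(n)\<close>. In the sum that defines the symmetric value the powers of \<open>X + ln 2\<close> are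
  multiplied by alternating binomial sums and cancel (\<open>sum_shuffle_replicate_reg_T\<close>). What
  remains for \<open>({1}^l, 2, {1}^(k-l))\<close> is \<open>(-1)^l * ((k+2) choose (l+1)) * \<chi>\<^sub>k\<^sub>+\<^sub>2(1)\<close>. In
  depth 1 the symmetric value is \<open>\<chi>\<^sub>k\<^sub>+\<^sub>2(1) - \<lambda>\<^sub>k\<^sub>+\<^sub>2(1)\<close> with the even sum
  \<open>\<lambda>\<close>, and \<open>\<chi>\<^sub>n(1) = (2^n - 1) \<lambda>\<^sub>n(1)\<close> gives the stated ratio.

  Finite values. The sum truncated at \<open>p\<close> is \<open>p/2\<close> times the coefficient of \<open>x^p\<close> in the series
  with one more \<open>\<omega>\<^sub>-\<^sub>1\<close> in front. In its expansion every coefficient of a power of \<open>u\<close> below \<open>x^p\<close>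
  is integral at \<open>p\<close>, so the factor \<open>p\<close> kills every term except the last one, in which the
  integration \<open>dx/x\<close> divides by \<open>p\<close>. Hence twice the sum is congruent to
  \<open>(-1)^(l+1) * ((k+2) choose (l+1)) * c\<^sub>k\<^sub>+\<^sub>2\<close>, where \<open>c\<^sub>m\<close> is the coefficient of \<open>x^p\<close> in
  \<open>u^m / m!\<close> (\<open>T_sum_depth_p_cong\<close>).

  The \<open>c\<^sub>m\<close> are the coefficients of the polynomial \<open>M(w) = [x^p] ((1 + x) / (1 - x))^w\<close>, whose values
  at the integers \<open>0 \<le> r \<le> p\<close> are congruent to \<open>1 - (-1)^r\<close>. The polynomial
  \<open>M(w) - c\<^sub>p (w^p - w)\<close> has degree less than \<open>p\<close> and integral values at \<open>0, ..., p-1\<close>, so its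
  coefficients are integral at \<open>p\<close> and can be read off from power sums of its values. Besides
  \<open>\<Sum> 2 r^(-m)\<close> over the odd \<open>r\<close> these contain a sum of Fermat quotients \<open>(r^p - r) / p\<close>, and
  replacing \<open>r\<close> by \<open>2r\<close> modulo \<open>p\<close> expresses that sum by the same odd sum
  (\<open>fermat_quotient_sum_doubling\<close>). The result is
  \<open>(2^(m-1) - 1) c\<^sub>m \<equiv> - (2^m - 1) T(m)\<close> modulo \<open>p\<close> (\<open>artanh2_coeff_p_cong\<close>).
\<close>

section \<open>An alternating sum\<close>

lemma alternating_sum_inverse_fact:
  assumes "0 < n"
  shows "(\<Sum>j\<le>n. (- 1) ^ j / (fact (n - j) * fact j) :: 'a :: field_char_0) = 0"
proof -
  have "(\<Sum>j\<le>n. (- 1) ^ j / (fact (n - j) * fact j) :: 'a) = (\<Sum>j\<le>n. (- 1) ^ j * of_nat (n choose j) / fact n)"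
    by (intro sum.cong) (auto simp: binomial_fact mult_ac)
  also have "\<dots> = (\<Sum>j\<le>n. (- 1) ^ j * of_nat (n choose j)) / fact n"
    by (simp add: sum_divide_distrib)
  finally show ?thesis using choose_alternating_sum[OF assms, where ?'a = 'a] by simp
qed

section \<open>Iterated integrals as iterated primitives\<close>

text \<open>
  The iterated integral with an extra weight \<open>g\<close> in the innermost variable, which for the empty
  word is the upper limit \<open>x\<close>. The weight makes an induction possible that integrates out the
  innermost variable: the inner integral becomes the new weight. The values are extended
  nonnegative reals, so that Tonelli's theorem needs no integrability.
\<close>

definition weighted_iter :: "real \<Rightarrow> diff_form list \<Rightarrow> (real \<Rightarrow> ennreal) \<Rightarrow> ennreal" where
  "weighted_iter x w g =
     (\<integral>\<^sup>+t. indicator (ord_simplex (length w) x) t * (\<Prod>i<length w. ennreal (form_density (w ! i) (t i)))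
        * g (if w = [] then x else t (length w - 1)) \<partial>PiM {..<length w} (\<lambda>_. lborel))"

lemma borel_measurable_form_density [measurable]: "form_density f \<in> borel_measurable borel"
proof (cases f)
  case Omega_0
  then have "form_density f = (\<lambda>t. 1 / t)" by auto
  then show ?thesis by simp
next
  case Omega_1
  then have "form_density f = (\<lambda>t. 2 * t / (1 - t\<^sup>2))" by auto
  then show ?thesis by simp
next
  case Omega_m1
  then have "form_density f = (\<lambda>t. 2 / (1 - t\<^sup>2))" by auto
  then show ?thesis by simp
qed

lemma isCont_form_density: "0 < x \<Longrightarrow> x < 1 \<Longrightarrow> isCont (form_density f) x"
proof -
  assume x: "0 < x" "x < 1"
  then have "x\<^sup>2 < 1" by (simp add: power_less_one_iff)
  then have ne: "1 - x\<^sup>2 \<noteq> 0" by simp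
  show ?thesis
  proof (cases f)
    case Omega_0
    then have "form_density f = (\<lambda>t. 1 / t)" by auto
    then show ?thesis using x by (auto intro!: continuous_intros)
  next
    case Omega_1
    then have "form_density f = (\<lambda>t. 2 * t / (1 - t\<^sup>2))" by auto
    then show ?thesis using ne by (auto intro!: continuous_intros)
  next
    case Omega_m1
    then have "form_density f = (\<lambda>t. 2 / (1 - t\<^sup>2))" by auto
    then show ?thesis using ne by (auto intro!: continuous_intros)
  qed
qed

lemma form_density_nonneg: "0 < x \<Longrightarrow> x < 1 \<Longrightarrow> 0 \<le> form_density f x"
  by (cases f) (auto simp: power_le_one)

lemma borel_measurable_ord_simplex [measurable]:
  "(indicator (ord_simplex n x) :: _ \<Rightarrow> real) \<in> borel_measurable (PiM {..<n} (\<lambda>_. lborel))"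
  (is ?A)
  and borel_measurable_ord_simplex_ennreal [measurable]:
  "(indicator (ord_simplex n x) :: _ \<Rightarrow> ennreal) \<in> borel_measurable (PiM {..<n} (\<lambda>_. lborel))" (is ?B)
proof -
  let ?M = "PiM {..<n} (\<lambda>_. lborel) :: (nat \<Rightarrow> real) measure"
  have [measurable]: "(\<lambda>t. t i) \<in> borel_measurable ?M" if "i < n" for i
    using measurable_component_singleton[of i "{..<n}" "\<lambda>_. lborel :: real measure"] that by simp
  have "{t \<in> space ?M. (\<forall>i\<in>{..<n}. 0 < t i \<and> t i < x) \<and> (\<forall>i\<in>{..<n}. \<forall>j\<in>{..<n}. i < j \<longrightarrow> t j < t i)} \<in> sets ?M"
    by (intro sets.sets_Collect_conj sets.sets_Collect_finite_All sets.sets_Collect_imp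
        borel_measurable_less borel_measurable_const sets.sets_Collect_const) auto
  also have "{t \<in> space ?M. (\<forall>i\<in>{..<n}. 0 < t i \<and> t i < x) \<and> (\<forall>i\<in>{..<n}. \<forall>j\<in>{..<n}. i < j \<longrightarrow> t j < t i)}
     = ord_simplex n x \<inter> space ?M"
    by (auto simp: ord_simplex_def)
  finally have "ord_simplex n x \<inter> space ?M \<in> sets ?M" .
  then show ?A ?B
    by (simp_all add: borel_measurable_indicator_iff)
qed

lemma fun_upd_in_ord_simplex_iff:
  "t(n := y) \<in> ord_simplex (Suc n) x
     \<longleftrightarrow> t \<in> ord_simplex n x \<and> 0 < y \<and> y < (if n = 0 then x else t (n - 1))"
proof (cases n)
  case 0
  then show ?thesis by (auto simp: ord_simplex_def)
next
  case (Suc m)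
  show ?thesis
  proof
    assume *: "t(n := y) \<in> ord_simplex (Suc n) x"
    have "0 < t i" "t i < x" if "i < n" for i
      using * that by (auto simp: ord_simplex_def dest: spec[of _ i])
    moreover have "t j < t i" if "i < j" "j < n" for i j
    proof -
      have "(t(n := y)) j < (t(n := y)) i"
        using * that unfolding ord_simplex_def mem_Collect_eq by (blast intro: less_SucI)
      then show ?thesis using that by simp
    qed
    moreover have "(t(n := y)) n < (t(n := y)) m" "0 < (t(n := y)) n"
      using * Suc unfolding ord_simplex_def mem_Collect_eq by blast+
    ultimately show "t \<in> ord_simplex n x \<and> 0 < y \<and> y < (if n = 0 then x else t (n - 1))"
      using Suc unfolding ord_simplex_def by auto
  next
    assume *: "t \<in> ord_simplex n x \<and> 0 < y \<and> y < (if n = 0 then x else t (n - 1))"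
    then have le: "t m \<le> t i" if "i < n" for i
      using that Suc by (cases "i = m") (auto simp: ord_simplex_def intro!: less_imp_le)
    have "y < t i" if "i < n" for i using le[OF that] * Suc by auto
    moreover have "y < x" using * Suc by (auto simp: ord_simplex_def dest: spec[of _ m])
    ultimately show "t(n := y) \<in> ord_simplex (Suc n) x"
      using * unfolding ord_simplex_def by (auto simp: less_Suc_eq)
  qed
qed

text \<open>
  Tonelli's theorem for the innermost variable, whose range depends on the preceding one only.
\<close>

lemma weighted_iter_snoc:
  assumes [measurable]: "g \<in> borel_measurable borel"
  shows "weighted_iter x (w @ [f]) g =
    weighted_iter x w (\<lambda>s. \<integral>\<^sup>+y. indicator {0<..<s} y * (ennreal (form_density f y) * g y) \<partial>lborel)"
proof -
  define n where "n = length w"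
  interpret product_sigma_finite "\<lambda>_::nat. lborel :: real measure"
    by standard
  let ?last = "\<lambda>t::nat\<Rightarrow>real. if n = 0 then x else t (n - 1)"
  let ?F = "\<lambda>t. indicator (ord_simplex (Suc n) x) t
       * (\<Prod>i<Suc n. ennreal (form_density ((w @ [f]) ! i) (t i))) * g (t n)"
  have "weighted_iter x (w @ [f]) g = (\<integral>\<^sup>+t. ?F t \<partial>PiM {..<Suc n} (\<lambda>_. lborel))"
    by (simp add: weighted_iter_def n_def)
  also have "\<dots> = (\<integral>\<^sup>+t. ?F t \<partial>PiM (insert n {..<n}) (\<lambda>_. lborel))"
    by (simp only: lessThan_Suc)
  also have "\<dots> = (\<integral>\<^sup>+t. \<integral>\<^sup>+y. ?F (t(n := y)) \<partial>lborel \<partial>PiM {..<n} (\<lambda>_. lborel))"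
  proof (rule product_nn_integral_insert)
    have [measurable]: "(\<lambda>t. t i) \<in> borel_measurable (PiM {..<Suc n} (\<lambda>_. lborel :: real measure))" if "i < Suc n" for i
      using measurable_component_singleton[of i "{..<Suc n}" "\<lambda>_. lborel :: real measure"] that by simp
    have "?F \<in> borel_measurable (PiM {..<Suc n} (\<lambda>_. lborel))"
    proof (intro borel_measurable_times_ennreal borel_measurable_ord_simplex_ennreal borel_measurable_prod_ennreal)
      fix i assume "i \<in> {..<Suc n}"
      then show "(\<lambda>t. ennreal (form_density ((w @ [f]) ! i) (t i))) \<in> borel_measurable (PiM {..<Suc n} (\<lambda>_. lborel))"
        by simp
    qed simp
    then show "?F \<in> borel_measurable (PiM (insert n {..<n}) (\<lambda>_. lborel))"
      by (simp only: lessThan_Suc)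
  qed auto
  also have "\<dots> = (\<integral>\<^sup>+t. indicator (ord_simplex n x) t * (\<Prod>i<n. ennreal (form_density (w ! i) (t i)))
       * (\<integral>\<^sup>+y. indicator {0<..<?last t} y * (ennreal (form_density f y) * g y) \<partial>lborel) \<partial>PiM {..<n} (\<lambda>_. lborel))"
  proof (rule nn_integral_cong)
    fix t :: "nat \<Rightarrow> real"
    have "?F (t(n := y)) = indicator (ord_simplex n x) t * (\<Prod>i<n. ennreal (form_density (w ! i) (t i)))
       * (indicator {0<..<?last t} y * (ennreal (form_density f y) * g y))" for y
    proof -
      have "(indicator (ord_simplex (Suc n) x) (t(n := y)) :: ennreal)
           = indicator (ord_simplex n x) t * indicator {0<..<?last t} y"
        by (simp only: indicator_def fun_upd_in_ord_simplex_iff) auto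
      moreover have "(\<Prod>i<Suc n. ennreal (form_density ((w @ [f]) ! i) ((t(n := y)) i)))
          = (\<Prod>i<n. ennreal (form_density (w ! i) (t i))) * ennreal (form_density f y)"
        by (simp add: n_def nth_append)
      ultimately show ?thesis by (simp add: mult_ac)
    qed
    then show "(\<integral>\<^sup>+y. ?F (t(n := y)) \<partial>lborel) = indicator (ord_simplex n x) t * (\<Prod>i<n. ennreal (form_density (w ! i) (t i)))
       * (\<integral>\<^sup>+y. indicator {0<..<?last t} y * (ennreal (form_density f y) * g y) \<partial>lborel)"
      by (simp add: nn_integral_cmult)
  qed
  finally show ?thesis unfolding weighted_iter_def n_def length_0_conv .
qed

lemma weighted_iter_cong:
  assumes "0 < x" "\<And>s. 0 < s \<Longrightarrow> s \<le> x \<Longrightarrow> g s = h s"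
  shows "weighted_iter x w g = weighted_iter x w h"
proof -
  have "indicator (ord_simplex (length w) x) t * c * g (if w = [] then x else t (length w - 1))
      = indicator (ord_simplex (length w) x) t * c * h (if w = [] then x else t (length w - 1))" for t c
    using assms by (auto simp: ord_simplex_def indicator_def less_imp_le)
  then show ?thesis by (simp add: weighted_iter_def)
qed

lemma iter_int_eq_weighted_iter:
  assumes "x \<le> 1"
  shows "iter_int x w = enn2real (weighted_iter x w (\<lambda>_. 1))"
proof -
  let ?n = "length w"
  let ?M = "PiM {..<?n} (\<lambda>_. lborel :: real measure)"
  let ?f = "\<lambda>t. indicator (ord_simplex ?n x) t *\<^sub>R (\<Prod>i<?n. form_density (w ! i) (t i))"
  have [measurable]: "(\<lambda>t. t i) \<in> borel_measurable ?M" if "i < ?n" for i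
    using measurable_component_singleton[of i "{..<?n}" "\<lambda>_. lborel :: real measure"] that by simp
  have nonneg: "0 \<le> form_density (w ! i) (t i)" if "t \<in> ord_simplex ?n x" "i < ?n" for t i
    using that assms by (intro form_density_nonneg) (auto simp: ord_simplex_def intro: less_le_trans)
  have "iter_int x w = integral\<^sup>L ?M ?f"
    by (simp add: iter_int_def set_lebesgue_integral_def)
  also have "\<dots> = enn2real (\<integral>\<^sup>+t. ennreal (?f t) \<partial>?M)"
  proof (rule integral_eq_nn_integral)
    show "?f \<in> borel_measurable ?M"
      by (intro borel_measurable_scaleR borel_measurable_ord_simplex borel_measurable_prod) auto
    show "AE t in ?M. 0 \<le> ?f t"
      by (intro AE_I2) (auto intro!: prod_nonneg nonneg simp: indicator_def)
  qed
  also have "(\<integral>\<^sup>+t. ennreal (?f t) \<partial>?M) = weighted_iter x w (\<lambda>_. 1)"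
    unfolding weighted_iter_def
  proof (rule nn_integral_cong)
    fix t :: "nat \<Rightarrow> real"
    show "ennreal (?f t) = indicator (ord_simplex ?n x) t * (\<Prod>i<?n. ennreal (form_density (w ! i) (t i))) * 1"
    proof (cases "t \<in> ord_simplex ?n x")
      case True
      then show ?thesis using nonneg[OF True] by (subst prod_ennreal) auto
    qed auto
  qed
  finally show ?thesis .
qed

text \<open>
  \<open>G\<close> is obtained from the constant 1 by repeatedly multiplying with a density and taking the
  primitive that vanishes at \<open>0+\<close>, all on the open unit interval.
\<close>

fun iterated_primitive :: "diff_form list \<Rightarrow> (real \<Rightarrow> real) \<Rightarrow> bool" where
  "iterated_primitive [] G \<longleftrightarrow> (\<forall>x\<in>{0<..<1}. G x = 1)"
| "iterated_primitive (f # w) G \<longleftrightarrow> (\<exists>H. iterated_primitive w H \<and>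
     (\<forall>x\<in>{0<..<1}. (G has_real_derivative form_density f x * H x) (at x)) \<and> (G \<longlongrightarrow> 0) (at_right 0))"

lemma nonneg_of_deriv_nonneg_at_right:
  fixes G :: "real \<Rightarrow> real"
  assumes deriv: "\<And>y. 0 < y \<Longrightarrow> y < 1 \<Longrightarrow> \<exists>D. (G has_real_derivative D) (at y) \<and> 0 \<le> D"
    and lim: "(G \<longlongrightarrow> 0) (at_right 0)" and x: "0 < x" "x < 1"
  shows "0 \<le> G x"
proof (rule tendsto_upperbound[OF lim])
  have "G y \<le> G x" if "0 < y" "y < x" for y
    by (rule DERIV_nonneg_imp_nondecreasing[of y x G]) (use that x deriv in auto)
  then show "eventually (\<lambda>y. G y \<le> G x) (at_right 0)"
    using x by (auto simp: eventually_at_right_field)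
qed auto

lemma iterated_primitive_nonneg_isCont:
  assumes "iterated_primitive w G" "0 < x" "x < 1"
  shows "0 \<le> G x" "isCont G x"
proof -
  have "0 \<le> G x \<and> isCont G x"
    using assms
  proof (induction w G arbitrary: x rule: iterated_primitive.induct)
    case (1 G)
    have "eventually (\<lambda>y. y \<in> {0<..<1}) (nhds x)"
      using 1 by (intro eventually_nhds_in_open) auto
    then have "eventually (\<lambda>y. G y = 1) (nhds x)"
      by eventually_elim (use 1 in auto)
    then show ?case using isCont_cong[of G "\<lambda>_. 1" x] 1 by auto
  next
    case (2 f w G)
    then obtain H where H: "iterated_primitive w H" "(G \<longlongrightarrow> 0) (at_right 0)"
      and d: "\<And>x. 0 < x \<Longrightarrow> x < 1 \<Longrightarrow> (G has_real_derivative form_density f x * H x) (at x)"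
      by auto
    have "0 \<le> G x"
    proof (rule nonneg_of_deriv_nonneg_at_right[OF _ H(2)])
      fix y :: real assume y: "0 < y" "y < 1"
      have "0 \<le> H y" using 2(1)[OF H(1) y] ..
      then show "\<exists>D. (G has_real_derivative D) (at y) \<and> 0 \<le> D"
        using d[OF y] form_density_nonneg[OF y, of f] by auto
    qed (use 2 in auto)
    then show ?case using d[of x] 2 DERIV_isCont by auto
  qed
  then show "0 \<le> G x" "isCont G x" by auto
qed

text \<open>
  The fundamental theorem of calculus on an open interval: the integrand may be unbounded at 0, but
  it is nonnegative, so the limit of the primitive at \<open>0+\<close> suffices.
\<close>

lemma nn_integral_primitive:
  assumes H: "iterated_primitive w H" and lim: "(G \<longlongrightarrow> 0) (at_right 0)"
    and d: "\<And>x. 0 < x \<Longrightarrow> x < 1 \<Longrightarrow> (G has_real_derivative form_density f x * H x) (at x)"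
    and s: "0 < s" "s < 1"
  shows "(\<integral>\<^sup>+y. indicator {0<..<s} y * (ennreal (form_density f y) * ennreal (H y)) \<partial>lborel) = ennreal (G s)"
proof -
  let ?h = "\<lambda>y. form_density f y * H y"
  have nn: "0 \<le> ?h y" if "0 < y" "y < 1" for y
    using form_density_nonneg that iterated_primitive_nonneg_isCont[OF H that] by simp
  have G: "isCont G s" using d[OF s] DERIV_isCont by blast
  have "((G \<circ> real_of_ereal) \<longlongrightarrow> 0) (at_right (ereal 0))" "((G \<circ> real_of_ereal) \<longlongrightarrow> G s) (at_left (ereal s))"
    using lim G by (simp_all add: ereal_tendsto_simps filterlim_at_split isCont_def)
  note FTC = interval_integral_FTC_nonneg[of "ereal 0" "ereal s" G ?h, OF _ _ _ _ this]
  have *: "isCont ?h y" "(G has_real_derivative ?h y) (at y)" "0 \<le> ?h y" if "ereal 0 < ereal y" "ereal y < ereal s" for y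
    using that s d[of y] nn[of y] isCont_form_density iterated_primitive_nonneg_isCont(2)[OF H]
    by (auto intro!: continuous_intros)
  have int: "set_integrable lborel {0<..<s} ?h" and val: "(LINT y:{0<..<s}|lborel. ?h y) = G s"
    using FTC * s by (auto simp: interval_lebesgue_integral_def)
  have "(\<integral>\<^sup>+y. indicator {0<..<s} y * (ennreal (form_density f y) * ennreal (H y)) \<partial>lborel)
      = (\<integral>\<^sup>+y. ennreal (indicator {0<..<s} y *\<^sub>R ?h y) \<partial>lborel)"
    using s iterated_primitive_nonneg_isCont(1)[OF H]
    by (intro nn_integral_cong) (auto simp: indicator_def ennreal_mult form_density_nonneg)
  also have "\<dots> = ennreal (\<integral>y. indicator {0<..<s} y *\<^sub>R ?h y \<partial>lborel)"
    using int s nn unfolding set_integrable_def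
    by (intro nn_integral_eq_integral) (auto simp: indicator_def)
  finally show ?thesis using val by (simp add: set_lebesgue_integral_def)
qed

lemma weighted_iter_append_primitive:
  assumes "iterated_primitive w G" "0 < x" "x < 1"
  shows "weighted_iter x (v @ w) (\<lambda>_. 1) = weighted_iter x v (\<lambda>s. ennreal (G s))"
  using assms(1)
proof (induction w G arbitrary: v rule: iterated_primitive.induct)
  case (1 G)
  then show ?case using assms by (auto intro!: weighted_iter_cong)
next
  case (2 f w G)
  then obtain H where H: "iterated_primitive w H" "(G \<longlongrightarrow> 0) (at_right 0)"
    and d: "\<And>x. 0 < x \<Longrightarrow> x < 1 \<Longrightarrow> (G has_real_derivative form_density f x * H x) (at x)"
    by auto
  let ?H = "\<lambda>y. ennreal (indicator {0<..<1} y *\<^sub>R H y)"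
  have "continuous_on {0<..<1} H"
    using iterated_primitive_nonneg_isCont(2)[OF H(1)] by (auto intro!: continuous_at_imp_continuous_on)
  then have meas: "?H \<in> borel_measurable borel"
    by (intro measurable_compose[OF _ measurable_ennreal] borel_measurable_continuous_on_indicator) auto
  have "weighted_iter x (v @ f # w) (\<lambda>_. 1) = weighted_iter x (v @ [f]) (\<lambda>s. ennreal (H s))"
    using 2(1)[of H "v @ [f]"] H by simp
  also have "\<dots> = weighted_iter x (v @ [f]) ?H"
    using assms by (intro weighted_iter_cong) auto
  also have "\<dots> = weighted_iter x v
      (\<lambda>s. \<integral>\<^sup>+y. indicator {0<..<s} y * (ennreal (form_density f y) * ?H y) \<partial>lborel)"
    by (rule weighted_iter_snoc[OF meas])
  also have "\<dots> = weighted_iter x v (\<lambda>s. ennreal (G s))"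
  proof (rule weighted_iter_cong)
    fix s assume s: "0 < s" "s \<le> x"
    have "(\<integral>\<^sup>+y. indicator {0<..<s} y * (ennreal (form_density f y) * ?H y) \<partial>lborel)
       = (\<integral>\<^sup>+y. indicator {0<..<s} y * (ennreal (form_density f y) * ennreal (H y)) \<partial>lborel)"
      using s assms by (intro nn_integral_cong) (auto simp: indicator_def)
    also have "\<dots> = ennreal (G s)"
      using s assms by (intro nn_integral_primitive[OF H d]) auto
    finally show "(\<integral>\<^sup>+y. indicator {0<..<s} y * (ennreal (form_density f y) * ?H y) \<partial>lborel) = ennreal (G s)" .
  qed (use assms in auto)
  finally show ?case .
qed

text \<open>
  This reduces every iterated integral below to exhibiting a chain of functions and checking
  their derivatives.
\<close>

theorem iter_int_eq_iterated_primitive: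
  assumes "iterated_primitive w G" "0 < x" "x < 1"
  shows "iter_int x w = G x"
proof -
  have "weighted_iter x ([] @ w) (\<lambda>_. 1) = weighted_iter x [] (\<lambda>s. ennreal (G s))"
    by (rule weighted_iter_append_primitive[OF assms])
  also have "\<dots> = ennreal (G x)"
    by (simp add: weighted_iter_def ord_simplex_def PiM_empty nn_integral_count_space_finite)
  finally show ?thesis
    using iterated_primitive_nonneg_isCont(1)[OF assms] assms by (simp add: iter_int_eq_weighted_iter)
qed

section \<open>Odd and even polylogarithms\<close>

text \<open>
  The coefficient at \<open>i = 0\<close> is meant to be 0; then the division by \<open>0 ^ n\<close> does no harm. All
  coefficient sequences below are bounded by 2.
\<close>

definition polylog :: "(nat \<Rightarrow> real) \<Rightarrow> nat \<Rightarrow> real \<Rightarrow> real" where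
  "polylog a n x = (\<Sum>i. a i / real i ^ n * x ^ i)"

definition odd_coeff :: "nat \<Rightarrow> real" where
  "odd_coeff i = (if odd i then 2 else 0)"

definition even_coeff :: "nat \<Rightarrow> real" where
  "even_coeff i = (if even i \<and> 0 < i then 2 else 0)"

lemma coeff_bounds:
  "\<bar>odd_coeff i\<bar> \<le> 2" "\<bar>even_coeff i\<bar> \<le> 2" "odd_coeff 0 = 0" "even_coeff 0 = 0"
  by (auto simp: odd_coeff_def even_coeff_def)

context
  fixes a :: "nat \<Rightarrow> real"
  assumes a: "\<And>i. \<bar>a i\<bar> \<le> 2" and a0: "a 0 = 0"
begin

lemma polylog_term_bound: "\<bar>a i / real i ^ n\<bar> \<le> 2"
proof (cases "i = 0")
  case False
  then have "1 \<le> real i ^ n" by (intro one_le_power) simp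
  then have "\<bar>a i\<bar> / real i ^ n \<le> \<bar>a i\<bar> / 1"
    using False by (intro divide_left_mono) auto
  then show ?thesis using a[of i] by simp
qed (simp add: a0)

lemma summable_polylog: "\<bar>x\<bar> < 1 \<Longrightarrow> summable (\<lambda>i. a i / real i ^ n * x ^ i)"
proof (rule summable_comparison_test'[of "\<lambda>i. 2 * \<bar>x\<bar> ^ i" 0])
  show "\<bar>x\<bar> < 1 \<Longrightarrow> summable (\<lambda>i. 2 * \<bar>x\<bar> ^ i)" by (intro summable_mult summable_geometric) simp
  show "norm (a i / real i ^ n * x ^ i) \<le> 2 * \<bar>x\<bar> ^ i" for i
    using mult_right_mono[OF polylog_term_bound[of i n], of "\<bar>x\<bar> ^ i"] by (simp add: abs_mult power_abs)
qed

lemma polylog_deriv: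
  assumes x: "0 < x" "x < 1"
  shows "(polylog a (Suc n) has_real_derivative polylog a n x / x) (at x)"
proof -
  let ?c = "\<lambda>i. a i / real i ^ Suc n"
  \<comment> \<open>Any point strictly between \<open>x\<close> and 1 works.\<close>
  define K where "K = (1 + x) / 2"
  have K: "\<bar>K\<bar> < 1" "norm x < norm K" using x by (auto simp: K_def)
  have "(polylog a (Suc n) has_real_derivative (\<Sum>i. diffs ?c i * x ^ i)) (at x)"
    unfolding polylog_def by (rule termdiffs_strong[OF summable_polylog[OF K(1)] K(2)])
  moreover have "(\<Sum>i. diffs ?c i * x ^ i) = polylog a n x / x"
  proof -
    have "x * (\<Sum>i. diffs ?c i * x ^ i) = (\<Sum>i. x * (diffs ?c i * x ^ i))"
      using K by (intro suminf_mult[symmetric] termdiff_converges[of x 1] summable_polylog) auto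
    also have "\<dots> = (\<Sum>i. a (Suc i) / real (Suc i) ^ n * x ^ Suc i)"
      by (simp add: diffs_def mult_ac)
    also have "\<dots> = polylog a n x"
      using suminf_split_head[OF summable_polylog[of x n]] x a0 by (simp add: polylog_def)
    finally show ?thesis using x by (simp add: field_simps)
  qed
  ultimately show ?thesis by simp
qed

lemma polylog_le_at_0:
  assumes "0 \<le> x" "x \<le> 1 / 2"
  shows "\<bar>polylog a n x\<bar> \<le> 4 * x"
proof -
  have bound: "norm (a (Suc i) / real (Suc i) ^ n * x ^ Suc i) \<le> 2 * x * x ^ i" for i
    using mult_right_mono[OF polylog_term_bound[of "Suc i" n], of "x ^ Suc i"] assms by (simp add: abs_mult mult_ac)
  have sums: "(\<lambda>i. 2 * x * x ^ i) sums (2 * x * (1 / (1 - x)))"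
    using assms by (intro sums_mult geometric_sums) auto
  have "\<bar>polylog a n x\<bar> = norm (\<Sum>i. a (Suc i) / real (Suc i) ^ n * x ^ Suc i)"
    using suminf_split_head[OF summable_polylog[of x n]] assms a0 by (simp add: polylog_def)
  also have "\<dots> \<le> (\<Sum>i. 2 * x * x ^ i)"
    using bound sums_summable[OF sums] by (rule norm_suminf_le)
  also have "\<dots> = 2 * x * (1 / (1 - x))" using sums sums_unique by metis
  also have "\<dots> \<le> 2 * x * 2"
    using assms by (intro mult_left_mono) (auto simp: field_simps)
  finally show ?thesis by simp
qed

lemma polylog_tendsto_at_0: "(polylog a n \<longlongrightarrow> 0) (at_right 0)"
proof (rule Lim_null_comparison)
  show "eventually (\<lambda>x. norm (polylog a n x) \<le> 4 * x) (at_right 0)"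
    unfolding eventually_at_right_field
    by (intro exI[of _ "1/2"]) (auto intro: polylog_le_at_0)
  show "((\<lambda>x::real. 4 * x) \<longlongrightarrow> 0) (at_right 0)"
    by real_asymp
qed

lemma polylog_tendsto_at_1:
  assumes "2 \<le> n"
  shows "(polylog a n \<longlongrightarrow> polylog a n 1) (at_left 1)"
proof -
  have "uniform_limit {0..1} (\<lambda>N x. \<Sum>i<N. a i / real i ^ n * x ^ i)
      (\<lambda>x. \<Sum>i. a i / real i ^ n * x ^ i) sequentially"
  proof (rule Weierstrass_m_test)
    show "summable (\<lambda>i. 2 * inverse (real i ^ n))"
      using inverse_power_summable[OF assms, where ?'a = real] by (intro summable_mult) auto
    fix i and x :: real assume x: "x \<in> {0..1}"
    have "\<bar>a i\<bar> * \<bar>x ^ i\<bar> \<le> 2 * 1"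
      using x a by (intro mult_mono) (auto simp: power_le_one)
    then have "\<bar>a i\<bar> * \<bar>x ^ i\<bar> * inverse (real i ^ n) \<le> 2 * inverse (real i ^ n)"
      by (intro mult_right_mono) auto
    then show "norm (a i / real i ^ n * x ^ i) \<le> 2 * inverse (real i ^ n)"
      by (simp add: abs_mult field_simps power_abs)
  qed
  then have "uniform_limit {0..1} (\<lambda>N x. \<Sum>i<N. a i / real i ^ n * x ^ i) (polylog a n) sequentially"
    unfolding polylog_def .
  then have "continuous_on {0..1} (polylog a n)"
    by (rule uniform_limit_theorem[rotated])
      (simp, intro always_eventually allI continuous_on_sum continuous_on_mult continuous_on_power
        continuous_on_id continuous_on_const)
  then have "(polylog a n \<longlongrightarrow> polylog a n 1) (at 1 within {0..1})"
    by (auto simp: continuous_on_def)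
  then show ?thesis by (simp add: at_within_Icc_at_left)
qed

end

abbreviation chi :: "nat \<Rightarrow> real \<Rightarrow> real" where "chi \<equiv> polylog odd_coeff"

abbreviation lam :: "nat \<Rightarrow> real \<Rightarrow> real" where "lam \<equiv> polylog even_coeff"

lemma chi_0_and_lam_0:
  assumes "0 < x" "x < 1"
  shows "chi 0 x = x * form_density Omega_m1 x" "lam 0 x = x * form_density Omega_1 x"
proof -
  have geo: "(\<lambda>i. x ^ i) sums (1 / (1 - x))" "(\<lambda>i. (- x) ^ i) sums (1 / (1 - (- x)))"
    using assms by (intro geometric_sums; simp)+
  have x: "1 - x \<noteq> 0" "1 + x \<noteq> 0" using assms by auto
  have "1 - x\<^sup>2 = (1 - x) * (1 + x)" by (simp add: power2_eq_square algebra_simps)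
  then have sq: "1 / (1 - x) = (1 + x) / (1 - x\<^sup>2)" "1 / (1 - (- x)) = (1 - x) / (1 - x\<^sup>2)" "1 - x\<^sup>2 \<noteq> 0"
    using x by simp_all
  have "(\<lambda>i. x ^ i - (- x) ^ i) sums (1 / (1 - x) - 1 / (1 - (- x)))"
    by (intro sums_diff geo)
  moreover have "(\<lambda>i. x ^ i - (- x) ^ i) = (\<lambda>i. odd_coeff i / real i ^ 0 * x ^ i)"
    by (auto simp: odd_coeff_def power_minus_odd)
  ultimately have "chi 0 x = 1 / (1 - x) - 1 / (1 - (- x))"
    unfolding polylog_def by (metis sums_unique)
  also have "\<dots> = x * form_density Omega_m1 x"
    unfolding sq(1,2) by (simp flip: diff_divide_distrib)
  finally show "chi 0 x = x * form_density Omega_m1 x" .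
  have "(\<lambda>i. x ^ i + (- x) ^ i - (if i = 0 then 2 else 0)) sums (1 / (1 - x) + 1 / (1 - (- x)) - 2)"
    by (intro sums_diff sums_add geo sums_single[of 0 "\<lambda>_. 2"])
  moreover have "(\<lambda>i. x ^ i + (- x) ^ i - (if i = 0 then 2 else 0)) = (\<lambda>i. even_coeff i / real i ^ 0 * x ^ i)"
    by (auto simp: even_coeff_def power_minus_odd)
  ultimately have "lam 0 x = 1 / (1 - x) + 1 / (1 - (- x)) - 2"
    unfolding polylog_def by (metis sums_unique)
  also have "\<dots> = x * form_density Omega_1 x"
    unfolding sq(1,2) using sq(3) by (simp add: field_simps power2_eq_square)
  finally show "lam 0 x = x * form_density Omega_1 x" .
qed

text \<open>
  Both values are multiples of \<open>Z = \<Sum> 1 / i^n\<close>: the even part of \<open>Z\<close> is \<open>Z / 2^n\<close>, by the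
  substitution of \<open>2 i\<close> for \<open>i\<close>.
\<close>

lemma chi_eq_lam:
  assumes n: "2 \<le> n"
  shows "chi n 1 = (2 ^ n - 1) * lam n 1"
proof -
  define Z where "Z = (\<Sum>i. 1 / real i ^ n)"
  have Z: "(\<lambda>i. 1 / real i ^ n) sums Z"
    using inverse_power_summable[OF n, where ?'a = real] unfolding Z_def
    by (intro summable_sums) (simp add: inverse_eq_divide)
  have n0: "0 < n" using n by simp
  have "(\<lambda>i. 2 / 2 ^ n * (1 / real i ^ n)) sums (2 / 2 ^ n * Z)"
    by (intro sums_mult Z)
  also have "(\<lambda>i. 2 / 2 ^ n * (1 / real i ^ n)) = (\<lambda>i. even_coeff (2 * i) / real (2 * i) ^ n)"
    using n0 by (auto simp: even_coeff_def power_mult_distrib)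
  also have "\<dots> sums (2 / 2 ^ n * Z) \<longleftrightarrow> (\<lambda>i. even_coeff i / real i ^ n) sums (2 / 2 ^ n * Z)"
    by (rule sums_mono_reindex[of "\<lambda>i. 2 * i"])
      (auto simp: strict_mono_def even_coeff_def elim!: evenE)
  finally have lam: "(\<lambda>i. even_coeff i / real i ^ n) sums (2 / 2 ^ n * Z)" .
  have "(\<lambda>i. 2 * (1 / real i ^ n) - even_coeff i / real i ^ n) sums (2 * Z - 2 / 2 ^ n * Z)"
    by (intro sums_diff sums_mult Z lam)
  also have "(\<lambda>i. 2 * (1 / real i ^ n) - even_coeff i / real i ^ n) = (\<lambda>i. odd_coeff i / real i ^ n)"
    using n0 by (auto simp: even_coeff_def odd_coeff_def)
  finally have "chi n 1 = 2 * Z - 2 / 2 ^ n * Z" by (simp add: polylog_def sums_unique[symmetric])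
  moreover have "lam n 1 = 2 / 2 ^ n * Z" using lam by (simp add: polylog_def sums_unique[symmetric])
  ultimately show ?thesis by (simp only:) (simp add: field_simps)
qed

lemma iterated_primitive_polylog:
  "iterated_primitive (replicate n Omega_0 @ [Omega_m1]) (chi (Suc n))"
  "iterated_primitive (replicate n Omega_0 @ [Omega_1]) (lam (Suc n))"
proof -
  have step: "iterated_primitive (replicate n Omega_0 @ [f]) (polylog a (Suc n))"
    if a: "\<And>i. \<bar>a i\<bar> \<le> 2" "a 0 = 0"
      and f: "\<And>x. 0 < x \<Longrightarrow> x < 1 \<Longrightarrow> polylog a 0 x = x * form_density f x" for a f
  proof (induction n)
    case 0
    have "(polylog a (Suc 0) has_real_derivative form_density f x) (at x)" if "0 < x" "x < 1" for x
      using polylog_deriv[of a x 0] a f[of x] that by simp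
    then show ?case using polylog_tendsto_at_0[of a "Suc 0"] a by (auto intro!: exI[of _ "\<lambda>_. 1"])
  next
    case (Suc n)
    have "(polylog a (Suc (Suc n)) has_real_derivative form_density Omega_0 x * polylog a (Suc n) x) (at x)"
      if "0 < x" "x < 1" for x
      using polylog_deriv[of a x "Suc n"] a that by simp
    then show ?case using polylog_tendsto_at_0[of a "Suc (Suc n)"] a Suc by auto
  qed
  show "iterated_primitive (replicate n Omega_0 @ [Omega_m1]) (chi (Suc n))"
    using coeff_bounds chi_0_and_lam_0(1) by (intro step) auto
  show "iterated_primitive (replicate n Omega_0 @ [Omega_1]) (lam (Suc n))"
    using coeff_bounds chi_0_and_lam_0(2) by (intro step) auto
qed

section \<open>Primitives of powers of the logarithm\<close>

definition artanh2 :: "real \<Rightarrow> real" where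
  "artanh2 x = ln ((1 + x) / (1 - x))"

text \<open>
  The value of \<open>\<integral> u^m / sinh u du\<close> over the positive half-line, which is what
  \<open>\<integral>\<^sub>0\<^sup>1 u(x)^m dx/x\<close> becomes in the variable \<open>u = artanh2 x\<close>.
\<close>

definition mellin_const :: "nat \<Rightarrow> real" where
  "mellin_const m = fact m * chi (Suc m) 1"

text \<open>
  The integral \<open>\<integral>\<^sub>0\<^sup>x u^m dt/t\<close> in closed form. With \<open>y = (1 - x) / (1 + x) = exp (-u)\<close> repeated
  integration by parts against \<open>du / sinh u = chi 0 y du\<close> produces the sum, because
  \<open>chi (Suc j) y\<close> has the derivative \<open>- chi j y\<close> with respect to \<open>u\<close>. The closed form makes the
  behaviour at both ends of the unit interval visible.
\<close>

definition mellin_primitive :: "nat \<Rightarrow> real \<Rightarrow> real" where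
  "mellin_primitive m x = mellin_const m
     - (\<Sum>j\<le>m. fact m / fact (m - j) * artanh2 x ^ (m - j) * chi (Suc j) ((1 - x) / (1 + x)))"

lemma artanh2_deriv:
  assumes "0 < x" "x < 1"
  shows "(artanh2 has_real_derivative form_density Omega_m1 x) (at x)"
proof -
  have nz: "1 + x \<noteq> 0" "1 - x \<noteq> 0" using assms by auto
  have "(artanh2 has_real_derivative
      ((1 * (1 - x) - (1 + x) * (- 1)) / ((1 - x) * (1 - x))) / ((1 + x) / (1 - x))) (at x)"
    using assms unfolding artanh2_def by (auto intro!: derivative_eq_intros simp: mult_ac)
  also have "((1 * (1 - x) - (1 + x) * (- 1)) / ((1 - x) * (1 - x))) / ((1 + x) / (1 - x))
      = 2 / ((1 - x) * (1 + x))"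
    using nz by (simp add: divide_simps)
  also have "(1 - x) * (1 + x) = 1 - x\<^sup>2" by (simp add: power2_eq_square algebra_simps)
  finally show ?thesis by simp
qed

lemma artanh2_nonneg: "0 < x \<Longrightarrow> x < 1 \<Longrightarrow> 0 < artanh2 x"
  by (simp add: artanh2_def)

lemma artanh2_tendsto_at_0: "(artanh2 \<longlongrightarrow> 0) (at_right 0)"
  unfolding artanh2_def by real_asymp

lemma iterated_primitive_artanh2_power:
  "iterated_primitive (replicate b Omega_m1) (\<lambda>x. artanh2 x ^ b / fact b)"
proof (induction b)
  case 0
  then show ?case by simp
next
  case (Suc b)
  have "((\<lambda>x. artanh2 x ^ Suc b / fact (Suc b)) has_real_derivative
     form_density Omega_m1 x * (artanh2 x ^ b / fact b)) (at x)" if "0 < x" "x < 1" for x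
  proof -
    have "((\<lambda>x. artanh2 x ^ Suc b / fact (Suc b)) has_real_derivative
       (real (Suc b) * artanh2 x ^ b * form_density Omega_m1 x) / fact (Suc b)) (at x)"
      using DERIV_power[OF artanh2_deriv[OF that], of "Suc b"]
      by (intro DERIV_cdivide) (simp add: mult_ac)
    also have "(real (Suc b) * artanh2 x ^ b * form_density Omega_m1 x) / fact (Suc b)
        = form_density Omega_m1 x * (artanh2 x ^ b / fact b)"
      unfolding fact_Suc of_nat_mult by (simp del: form_density.simps of_nat_Suc)
    finally show ?thesis .
  qed
  moreover have "((\<lambda>x. artanh2 x ^ Suc b / fact (Suc b)) \<longlongrightarrow> 0 ^ Suc b / fact (Suc b)) (at_right 0)"
    by (intro tendsto_intros artanh2_tendsto_at_0) simp
  ultimately show ?case using Suc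
    by (auto simp del: form_density.simps power_Suc fact_Suc
        intro!: exI[of _ "\<lambda>x. artanh2 x ^ b / fact b"])
qed

text \<open>
  Both sides are primitives of \<open>\<omega>\<^sub>-\<^sub>1\<close>, hence equal to the same iterated integral.
\<close>

lemma chi_1_eq: 
  assumes "0 < x" "x < 1"
  shows "chi 1 x = artanh2 x"
proof -
  have "iterated_primitive [Omega_m1] (chi 1)" "iterated_primitive [Omega_m1] (\<lambda>x. artanh2 x)"
    using iterated_primitive_polylog(1)[of 0] iterated_primitive_artanh2_power[of 1]
    by (simp_all only: One_nat_def replicate.simps append_Nil fact_Suc_0 power_Suc power_0 mult_1_right div_by_1)
  then show ?thesis
    using assms iter_int_eq_iterated_primitive by metis
qed

lemma reflection_facts:
  assumes "0 < x" "x < 1"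
  shows "0 < (1 - x) / (1 + x)" "(1 - x) / (1 + x) < (1 :: real)"
    "artanh2 ((1 - x) / (1 + x)) = - ln x"
proof -
  show "0 < (1 - x) / (1 + x)" "(1 - x) / (1 + x) < (1 :: real)" using assms by (auto simp: field_simps)
  have "(1 + (1 - x) / (1 + x)) / (1 - (1 - x) / (1 + x)) = 1 / x"
    using assms by (simp add: divide_simps) (simp add: algebra_simps)?
  then show "artanh2 ((1 - x) / (1 + x)) = - ln x"
    using assms by (simp add: artanh2_def ln_div)
qed

lemma chi_reflection_deriv:
  assumes "0 < x" "x < 1"
  shows "((\<lambda>x. chi (Suc j) ((1 - x) / (1 + x))) has_real_derivative
     - form_density Omega_m1 x * chi j ((1 - x) / (1 + x))) (at x)"
proof -
  let ?y = "(1 - x) / (1 + x)"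
  have nz: "1 + x \<noteq> 0" "1 - x \<noteq> 0" "1 - x\<^sup>2 \<noteq> 0" using assms by (auto simp add: power2_eq_1_iff)
  have "((\<lambda>x. (1 - x) / (1 + x)) has_real_derivative - 2 / (1 + x)\<^sup>2) (at x)"
    using nz by (auto intro!: derivative_eq_intros simp: field_simps power2_eq_square)
  then have "((\<lambda>x. chi (Suc j) ((1 - x) / (1 + x))) has_real_derivative
      chi j ?y / ?y * (- 2 / (1 + x)\<^sup>2)) (at x)"
    using polylog_deriv[of odd_coeff ?y j] reflection_facts[OF assms] coeff_bounds
    by (intro DERIV_chain2[of "chi (Suc j)"]) auto
  moreover have "chi j ?y / ?y * (- 2 / (1 + x)\<^sup>2) = - form_density Omega_m1 x * chi j ?y"
  proof -
    have "1 / ?y * (2 / (1 + x)\<^sup>2) = 2 / (1 - x\<^sup>2)"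
      using nz by (simp add: divide_simps power2_eq_square) (simp add: algebra_simps)?
    moreover have "c / q * (- 2 / r) = - (c * (1 / q * (2 / r)))" for c q r :: real by simp
    ultimately show ?thesis by (simp only: form_density.simps) simp
  qed
  ultimately show ?thesis by simp
qed

lemma mellin_primitive_deriv:
  assumes "0 < x" "x < 1"
  shows "(mellin_primitive m has_real_derivative artanh2 x ^ m / x) (at x)"
proof -
  let ?y = "(1 - x) / (1 + x)"
  let ?U = "artanh2 x" and ?V = "form_density Omega_m1 x"
  let ?t = "\<lambda>j. fact m / fact (m - j) * ?U ^ (m - j) * chi j ?y"
  \<comment> \<open>The derivative of the summand \<open>j\<close> is a difference of consecutive terms, so the sum telescopes.\<close>
  let ?s = "\<lambda>j. if j < m then ?t (Suc j) else 0"
  have "((\<lambda>x. fact m / fact (m - j) * artanh2 x ^ (m - j) * chi (Suc j) ((1 - x) / (1 + x)))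
       has_real_derivative ?V * (?s j - ?t j)) (at x)" if "j \<le> m" for j
  proof -
    have *: "((\<lambda>x. fact m / fact (m - j) * artanh2 x ^ (m - j) * chi (Suc j) ((1 - x) / (1 + x)))
       has_real_derivative fact m / fact (m - j) * (real (m - j) * ?U ^ (m - j - 1) * ?V) * chi (Suc j) ?y
         + fact m / fact (m - j) * ?U ^ (m - j) * (- ?V * chi j ?y)) (at x)"
      by (rule DERIV_cong[OF DERIV_mult[OF DERIV_cmult[OF DERIV_power[OF artanh2_deriv[OF assms]]]
            chi_reflection_deriv[OF assms]]])
        (simp del: form_density.simps add: mult_ac)
    have "fact m / fact (m - j) * (real (m - j) * ?U ^ (m - j - 1) * ?V) * chi (Suc j) ?y = ?V * ?s j"
    proof (cases "j < m")
      case True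
      then have eq: "m - j = Suc (m - Suc j)" by simp
      have "(fact (m - j) :: real) = real (m - j) * fact (m - Suc j)"
        by (simp only: eq fact_Suc)
      then have "fact m / fact (m - j) * real (m - j) = (fact m / fact (m - Suc j) :: real)"
        using True by simp
      then show ?thesis using True eq by (simp del: form_density.simps add: mult_ac) 
    qed (use that in simp)
    with * show ?thesis by (simp only:) (simp del: form_density.simps add: algebra_simps)
  qed
  then have "(mellin_primitive m has_real_derivative 0 - (\<Sum>j\<le>m. ?V * (?s j - ?t j))) (at x)"
    unfolding mellin_primitive_def by (intro DERIV_diff DERIV_const DERIV_sum) auto
  also have "(\<Sum>j\<le>m. ?V * (?s j - ?t j)) = ?V * ((\<Sum>j\<le>m. ?s j) - (\<Sum>j\<le>m. ?t j))"
    by (simp only: sum_distrib_left[symmetric] sum_subtractf)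
  also have "(\<Sum>j\<le>m. ?s j) = (\<Sum>j<m. ?t (Suc j))"
    by (simp add: lessThan_Suc_atMost[symmetric])
  also have "(\<Sum>j\<le>m. ?t j) = ?t 0 + (\<Sum>j<m. ?t (Suc j))"
    by (simp only: lessThan_Suc_atMost[symmetric] sum.lessThan_Suc_shift)
  also have "0 - ?V * ((\<Sum>j<m. ?t (Suc j)) - (?t 0 + (\<Sum>j<m. ?t (Suc j)))) = ?U ^ m * (?V * chi 0 ?y)"
    by (simp add: algebra_simps)
  also have "?V * chi 0 ?y = 1 / x"
  proof -
    have nz: "1 + x \<noteq> 0" "1 - x \<noteq> 0" "x \<noteq> 0" "1 - x\<^sup>2 \<noteq> 0" using assms by (auto simp: power2_eq_1_iff)
    have sq: "1 - ?y\<^sup>2 = 4 * x / (1 + x)\<^sup>2"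
      using nz(1) by (simp add: power_divide divide_simps) (simp add: algebra_simps power2_eq_square)
    have sq': "1 - x\<^sup>2 = (1 - x) * (1 + x)" by (simp add: power2_eq_square algebra_simps)
    have "?V * chi 0 ?y = 2 / (1 - x\<^sup>2) * (?y * (2 / (1 - ?y\<^sup>2)))"
      using chi_0_and_lam_0(1)[of ?y] reflection_facts[OF assms] by simp
    also have "\<dots> = 1 / x"
      unfolding sq sq' using nz(1-3) by (simp add: divide_simps power2_eq_square)
    finally show ?thesis .
  qed
  finally show ?thesis by simp
qed

text \<open>
  Only the summand \<open>j = m\<close> survives at \<open>0+\<close>, where \<open>y\<close> tends to 1, and it cancels the constant. The
  summand \<open>j = 0\<close> needs care, since \<open>chi 1 y = - ln x\<close> is unbounded; a factor \<open>artanh2 x\<close>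
  compensates this, and here \<open>m > 0\<close> is essential.
\<close>

lemma mellin_primitive_tendsto_at_0:
  assumes "0 < m"
  shows "(mellin_primitive m \<longlongrightarrow> 0) (at_right 0)"
proof -
  have y_lim: "filterlim (\<lambda>x::real. (1 - x) / (1 + x)) (at_left 1) (at_right 0)"
    by real_asymp
  have t: "((\<lambda>x. fact m / fact (m - j) * artanh2 x ^ (m - j) * chi (Suc j) ((1 - x) / (1 + x))) \<longlongrightarrow>
       (if j = m then mellin_const m else 0)) (at_right 0)" if "j \<le> m" for j
  proof (cases "j = 0")
    case False
    then have "((\<lambda>x. chi (Suc j) ((1 - x) / (1 + x))) \<longlongrightarrow> chi (Suc j) 1) (at_right 0)"
      using coeff_bounds by (intro filterlim_compose[OF polylog_tendsto_at_1 y_lim]) auto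
    then have "((\<lambda>x. fact m / fact (m - j) * artanh2 x ^ (m - j) * chi (Suc j) ((1 - x) / (1 + x))) \<longlongrightarrow>
        fact m / fact (m - j) * 0 ^ (m - j) * chi (Suc j) 1) (at_right 0)"
      by (intro tendsto_intros artanh2_tendsto_at_0)
    then show ?thesis using that by (auto simp: mellin_const_def power_0_left)
  next
    case True
    have "((\<lambda>x. ln ((1 + x) / (1 - x)) * - ln x) \<longlongrightarrow> 0) (at_right (0::real))"
      by real_asymp
    then have "((\<lambda>x. artanh2 x ^ (m - 1) * (artanh2 x * - ln x)) \<longlongrightarrow> 0 ^ (m - 1) * 0) (at_right 0)"
      by (intro tendsto_intros artanh2_tendsto_at_0) (simp add: artanh2_def)
    moreover have "eventually (\<lambda>x::real. artanh2 x ^ (m - 1) * (artanh2 x * - ln x) =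
        fact m / fact (m - j) * artanh2 x ^ (m - j) * chi (Suc j) ((1 - x) / (1 + x))) (at_right 0)"
      unfolding eventually_at_right_field
    proof (intro exI[of _ "1::real"] conjI allI impI)
      fix x :: real assume "0 < x" "x < 1"
      then show "artanh2 x ^ (m - 1) * (artanh2 x * - ln x) =
        fact m / fact (m - j) * artanh2 x ^ (m - j) * chi (Suc j) ((1 - x) / (1 + x))"
        using chi_1_eq reflection_facts True power_minus_mult[of m "artanh2 x"] assms
        by (simp flip: mult.assoc)
    qed simp
    ultimately have "((\<lambda>x. fact m / fact (m - j) * artanh2 x ^ (m - j) * chi (Suc j) ((1 - x) / (1 + x)))
         \<longlongrightarrow> 0 ^ (m - 1) * 0) (at_right 0)"
      by (rule Lim_transform_eventually)
    then show ?thesis using True assms by simp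
  qed
  have "(mellin_primitive m \<longlongrightarrow> mellin_const m - (\<Sum>j\<le>m. if j = m then mellin_const m else 0)) (at_right 0)"
    unfolding mellin_primitive_def by (intro tendsto_diff tendsto_const tendsto_sum t) auto
  then show ?thesis by simp
qed

text \<open>
  \<open>chi n y\<close> is \<open>O(y)\<close>, and \<open>y = exp (- artanh2 x)\<close> beats every power of \<open>artanh2 x\<close>.
\<close>

lemma artanh2_power_chi_tendsto_at_1:
  "((\<lambda>x. artanh2 x ^ i * chi n ((1 - x) / (1 + x))) \<longlongrightarrow> 0) (at_left 1)"
proof (rule Lim_null_comparison)
  show "eventually (\<lambda>x::real. norm (artanh2 x ^ i * chi n ((1 - x) / (1 + x)))
       \<le> 4 * (artanh2 x ^ i * ((1 - x) / (1 + x)))) (at_left 1)"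
    unfolding eventually_at_left_field
  proof (intro exI[of _ "1/2::real"] conjI allI impI)
    fix x :: real assume x: "1 / 2 < x" "x < 1"
    have "\<bar>chi n ((1 - x) / (1 + x))\<bar> \<le> 4 * ((1 - x) / (1 + x))"
      using x coeff_bounds by (intro polylog_le_at_0) (auto simp: field_simps)
    then have "artanh2 x ^ i * \<bar>chi n ((1 - x) / (1 + x))\<bar> \<le> artanh2 x ^ i * (4 * ((1 - x) / (1 + x)))"
      using x artanh2_nonneg[of x] by (intro mult_left_mono) auto
    then show "norm (artanh2 x ^ i * chi n ((1 - x) / (1 + x)))
       \<le> 4 * (artanh2 x ^ i * ((1 - x) / (1 + x)))"
      using x artanh2_nonneg[of x]
      by (simp only: real_norm_def abs_mult power_abs abs_of_pos mult.left_commute)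
  qed simp
  have "filterlim artanh2 at_top (at_left 1)" unfolding artanh2_def by real_asymp
  then have "((\<lambda>x. artanh2 x ^ i / exp (artanh2 x)) \<longlongrightarrow> 0) (at_left 1)"
    by (rule filterlim_compose[OF tendsto_power_div_exp_0])
  then have "((\<lambda>x. 4 * (artanh2 x ^ i / exp (artanh2 x))) \<longlongrightarrow> 4 * 0) (at_left 1)"
    by (intro tendsto_intros)
  moreover have "eventually (\<lambda>x. 4 * (artanh2 x ^ i / exp (artanh2 x))
      = 4 * (artanh2 x ^ i * ((1 - x) / (1 + x)))) (at_left 1)"
    unfolding eventually_at_left_field
    by (intro exI[of _ "0::real"]) (auto simp: artanh2_def)
  ultimately have "((\<lambda>x. 4 * (artanh2 x ^ i * ((1 - x) / (1 + x)))) \<longlongrightarrow> 4 * 0) (at_left 1)"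
    by (rule Lim_transform_eventually)
  then show "((\<lambda>x. 4 * (artanh2 x ^ i * ((1 - x) / (1 + x)))) \<longlongrightarrow> 0) (at_left 1)"
    by simp
qed

lemma artanh2_power_mellin_tendsto_at_1:
  "((\<lambda>x. artanh2 x ^ i * (mellin_primitive m x - mellin_const m)) \<longlongrightarrow> 0) (at_left 1)"
proof -
  have "((\<lambda>x. - (\<Sum>j\<le>m. fact m / fact (m - j) * (artanh2 x ^ (i + (m - j)) * chi (Suc j) ((1 - x) / (1 + x)))))
      \<longlongrightarrow> - (\<Sum>j\<le>m. fact m / fact (m - j) * 0)) (at_left 1)"
    by (intro tendsto_minus tendsto_sum tendsto_mult tendsto_const artanh2_power_chi_tendsto_at_1)
  then show ?thesis unfolding power_add
    by (simp add: mellin_primitive_def sum_distrib_left mult_ac)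
qed

section \<open>Shuffle regularization\<close>

text \<open>
  A polynomial that tends to 0 at infinity is zero, so one polynomial with the right
  asymptotics determines the regularization.
\<close>

lemma reg_poly_eqI:
  assumes lim: "((\<lambda>\<epsilon>. iter_int (1 - \<epsilon>) w - poly P (- ln \<epsilon>)) \<longlongrightarrow> 0) (at_right 0)"
  shows "reg_poly w = P"
  unfolding reg_poly_def
proof (rule the_equality)
  show "((\<lambda>\<epsilon>. iter_int (1 - \<epsilon>) w - poly P (- ln \<epsilon>)) \<longlongrightarrow> 0) (at_right 0)" by (fact lim)
next
  fix Q assume "((\<lambda>\<epsilon>. iter_int (1 - \<epsilon>) w - poly Q (- ln \<epsilon>)) \<longlongrightarrow> 0) (at_right 0)"
  from tendsto_diff[OF lim this] have "((\<lambda>\<epsilon>. poly (Q - P) (- ln \<epsilon>)) \<longlongrightarrow> 0) (at_right 0)"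
    by simp
  moreover have "filterlim (\<lambda>y::real. exp (- y)) (at_right 0) at_top"
    by (auto simp: filterlim_at intro!: filterlim_compose[OF exp_at_bot] filterlim_uminus_at_bot_at_top)
  ultimately have lim0: "((\<lambda>y. poly (Q - P) y) \<longlongrightarrow> 0) at_top"
    using filterlim_compose[of "\<lambda>\<epsilon>. poly (Q - P) (- ln \<epsilon>)" "nhds 0" "at_right 0" "\<lambda>y. exp (- y)" at_top]
    by simp
  have "degree (Q - P) = 0"
  proof (rule ccontr)
    assume "degree (Q - P) \<noteq> 0"
    then have "filterlim (poly (Q - P)) at_infinity at_top"
      by (intro filterlim_compose[OF filterlim_poly_at_infinity] filterlim_at_top_imp_at_infinity) (auto simp: filterlim_ident)
    then show False
      using lim0 not_tendsto_and_filterlim_at_infinity trivial_limit_at_top_linorder by blast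
  qed
  then obtain c where c: "Q - P = [:c:]" by (rule degree_eq_zeroE)
  with lim0 have "((\<lambda>_. c) \<longlongrightarrow> 0) (at_top :: real filter)" by simp
  then have "c = 0" by (simp add: tendsto_const_iff)
  with c show "Q = P" by simp
qed

text \<open>
  The expansion of \<open>\<integral>\<^sub>0\<^sup>x (u(x) - u(t))^a / a! * u(t)^b / b! * dt/t\<close> by the binomial theorem.
\<close>

definition depth_primitive :: "nat \<Rightarrow> nat \<Rightarrow> real \<Rightarrow> real" where
  "depth_primitive a b x =
     (\<Sum>j\<le>a. (- 1) ^ j / (fact (a - j) * fact j * fact b) * (artanh2 x ^ (a - j) * mellin_primitive (b + j) x))"

text \<open>
  When the sum is differentiated, the derivatives of the powers of \<open>artanh2\<close> give the sum for
  \<open>a - 1\<close>, while the derivatives of the integrals all have the factor \<open>u^(a+b) / x\<close> and cancel by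
  the vanishing alternating sum.
\<close>

lemma iterated_primitive_depth_primitive:
  assumes b: "0 < b"
  shows "iterated_primitive (replicate a Omega_m1 @ Omega_0 # replicate b Omega_m1) (depth_primitive a b)"
proof (induction a)
  case 0
  have "(depth_primitive 0 b has_real_derivative form_density Omega_0 x * (artanh2 x ^ b / fact b)) (at x)"
    if "0 < x" "x < 1" for x
    using DERIV_cmult[OF mellin_primitive_deriv[OF that, of b], of "1 / fact b"]
    by (simp add: depth_primitive_def[abs_def] mult_ac)
  moreover have "(depth_primitive 0 b \<longlongrightarrow> 1 / fact b * 0) (at_right 0)"
    unfolding depth_primitive_def using mellin_primitive_tendsto_at_0[OF b]
    by (auto intro!: tendsto_intros tendsto_eq_intros)
  ultimately show ?case using iterated_primitive_artanh2_power[of b]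
    by (auto simp del: form_density.simps)
next
  case (Suc a)
  let ?k = "\<lambda>a j. (- 1) ^ j / (fact (a - j) * fact j * fact b) :: real"
  have "(depth_primitive (Suc a) b has_real_derivative form_density Omega_m1 x * depth_primitive a b x) (at x)"
    if x: "0 < x" "x < 1" for x
  proof -
    let ?U = "artanh2 x" and ?V = "form_density Omega_m1 x"
    let ?t = "\<lambda>j. ?k (Suc a) j * (real (Suc a - j) * ?U ^ (Suc a - j - 1) * ?V * mellin_primitive (b + j) x)"
    have "((\<lambda>x. ?k (Suc a) j * (artanh2 x ^ (Suc a - j) * mellin_primitive (b + j) x)) has_real_derivative
         ?t j + ?k (Suc a) j * (?U ^ (Suc a - j) * (?U ^ (b + j) / x))) (at x)" for j
      by (rule DERIV_cong[OF DERIV_cmult[OF DERIV_mult[OF DERIV_power[OF artanh2_deriv[OF x]]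
              mellin_primitive_deriv[OF x]]]])
        (simp del: form_density.simps add: algebra_simps)
    then have "(depth_primitive (Suc a) b has_real_derivative
         (\<Sum>j\<le>Suc a. ?t j + ?k (Suc a) j * (?U ^ (Suc a - j) * (?U ^ (b + j) / x)))) (at x)"
      unfolding depth_primitive_def by (rule DERIV_sum)
    also have "(\<Sum>j\<le>Suc a. ?t j + ?k (Suc a) j * (?U ^ (Suc a - j) * (?U ^ (b + j) / x)))
        = (\<Sum>j\<le>Suc a. ?t j) + (\<Sum>j\<le>Suc a. ?k (Suc a) j * (?U ^ (Suc a - j) * (?U ^ (b + j) / x)))"
      by (rule sum.distrib)
    also have "(\<Sum>j\<le>Suc a. ?k (Suc a) j * (?U ^ (Suc a - j) * (?U ^ (b + j) / x)))
        = (\<Sum>j\<le>Suc a. ?U ^ (Suc a + b) / (x * fact b) * ((- 1) ^ j / (fact (Suc a - j) * fact j)))"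
    proof (intro sum.cong refl)
      fix j assume "j \<in> {..Suc a}"
      then have "?U ^ (Suc a + b) = ?U ^ (Suc a - j) * ?U ^ (b + j)"
        by (simp only: power_add[symmetric]) (simp add: add.commute)
      then show "?k (Suc a) j * (?U ^ (Suc a - j) * (?U ^ (b + j) / x))
          = ?U ^ (Suc a + b) / (x * fact b) * ((- 1) ^ j / (fact (Suc a - j) * fact j))"
        by (simp only: times_divide_eq_left times_divide_eq_right divide_divide_eq_left mult_ac)
    qed
    also have "\<dots> = 0"
      using alternating_sum_inverse_fact[of "Suc a", where ?'a = real]
      by (simp only: sum_distrib_left[symmetric] mult_zero_right)
    also have "(\<Sum>j\<le>Suc a. ?t j) + 0 = (\<Sum>j\<le>a. ?t j)" by simp
    also have "\<dots> = ?V * depth_primitive a b x"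
      unfolding depth_primitive_def sum_distrib_left
    proof (intro sum.cong refl)
      fix j assume "j \<in> {..a}"
      then have eq: "Suc a - j = Suc (a - j)" by auto
      have f: "(fact (Suc a - j) :: real) = real (Suc a - j) * fact (a - j)"
        by (simp only: eq fact_Suc)
      show "?t j = ?V * (?k a j * (?U ^ (a - j) * mellin_primitive (b + j) x))"
        unfolding f by (simp del: form_density.simps add: eq mult_ac)
    qed
    finally show ?thesis .
  qed
  moreover have "(depth_primitive (Suc a) b \<longlongrightarrow>
      (\<Sum>j\<le>Suc a. ?k (Suc a) j * (0 ^ (Suc a - j) * 0))) (at_right 0)"
    unfolding depth_primitive_def using b
    by (intro tendsto_sum tendsto_mult tendsto_power tendsto_const artanh2_tendsto_at_0 mellin_primitive_tendsto_at_0) auto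
  ultimately show ?case using Suc
    by (auto simp del: form_density.simps)
qed

text \<open>
  The two arguments differ by \<open>ln (2 - \<epsilon>) - ln 2 = O(\<epsilon>)\<close>, which beats every power of \<open>ln \<epsilon>\<close>.
\<close>

lemma poly_artanh2_asymptotic:
  "((\<lambda>\<epsilon>. poly Q (artanh2 (1 - \<epsilon>)) - poly Q (ln 2 - ln \<epsilon>)) \<longlongrightarrow> 0) (at_right 0)"
proof -
  let ?U = "\<lambda>\<epsilon>. artanh2 (1 - \<epsilon>)" and ?V = "\<lambda>\<epsilon>::real. ln 2 - ln \<epsilon>"
  \<comment> \<open>The weights \<open>?V \<epsilon> ^ n\<close> are carried along because the induction on the polynomial below
    multiplies by \<open>?V \<epsilon>\<close>.\<close>
  have decay: "((\<lambda>\<epsilon>. ?V \<epsilon> ^ n * (?U \<epsilon> - ?V \<epsilon>)) \<longlongrightarrow> 0) (at_right 0)" for n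
  proof -
    have "filterlim ?V at_top (at_right 0)" by real_asymp
    then have "((\<lambda>\<epsilon>. ?V \<epsilon> ^ n / exp (?V \<epsilon>)) \<longlongrightarrow> 0) (at_right 0)"
      by (rule filterlim_compose[OF tendsto_power_div_exp_0])
    moreover have "((\<lambda>\<epsilon>. exp (?V \<epsilon>) * (?U \<epsilon> - ?V \<epsilon>)) \<longlongrightarrow> - 1) (at_right 0)"
      unfolding artanh2_def by real_asymp
    ultimately have "((\<lambda>\<epsilon>. ?V \<epsilon> ^ n / exp (?V \<epsilon>) * (exp (?V \<epsilon>) * (?U \<epsilon> - ?V \<epsilon>))) \<longlongrightarrow> 0 * - 1) (at_right 0)"
      by (rule tendsto_mult)
    then show ?thesis by simp
  qed
  have decay_poly: "((\<lambda>\<epsilon>. ?V \<epsilon> ^ n * (?U \<epsilon> - ?V \<epsilon>) * poly R (?V \<epsilon>)) \<longlongrightarrow> 0) (at_right 0)" for n R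
  proof -
    have "((\<lambda>\<epsilon>. \<Sum>i\<le>degree R. Polynomial.coeff R i * (?V \<epsilon> ^ (n + i) * (?U \<epsilon> - ?V \<epsilon>)))
        \<longlongrightarrow> (\<Sum>i\<le>degree R. Polynomial.coeff R i * 0)) (at_right 0)"
      by (intro tendsto_sum tendsto_mult tendsto_const decay)
    then show ?thesis by (simp add: poly_altdef sum_distrib_left power_add mult_ac)
  qed
  have "((\<lambda>\<epsilon>. ?V \<epsilon> ^ n * (poly Q (?U \<epsilon>) - poly Q (?V \<epsilon>))) \<longlongrightarrow> 0) (at_right 0)" for n
  proof (induction Q arbitrary: n)
    case 0
    then show ?case by simp
  next
    case (pCons c Q)
    have "((\<lambda>\<epsilon>. ?V \<epsilon> ^ n * (?U \<epsilon> - ?V \<epsilon>) * (?V \<epsilon> ^ 0 * (poly Q (?U \<epsilon>) - poly Q (?V \<epsilon>)))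
          + ?V \<epsilon> ^ n * (?U \<epsilon> - ?V \<epsilon>) * poly Q (?V \<epsilon>)
          + ?V \<epsilon> ^ Suc n * (poly Q (?U \<epsilon>) - poly Q (?V \<epsilon>))) \<longlongrightarrow> 0 * 0 + 0 + 0) (at_right 0)"
      by (intro tendsto_add tendsto_mult decay decay_poly pCons.IH)
    then show ?case by (simp add: algebra_simps)
  qed
  from this[of 0] show ?thesis by simp
qed

definition reg_T :: "nat \<Rightarrow> nat \<Rightarrow> real poly" where
  "reg_T a b = (\<Sum>j\<le>a. Polynomial.smult ((- 1) ^ j / (fact (a - j) * fact j * fact b) * mellin_const (b + j)) ([:ln 2, 1:] ^ (a - j)))"

lemma reg_poly_depth:
  assumes "0 < b"
  shows "reg_poly (replicate a Omega_m1 @ Omega_0 # replicate b Omega_m1) = reg_T a b"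
proof (rule reg_poly_eqI)
  let ?w = "replicate a Omega_m1 @ Omega_0 # replicate b Omega_m1"
  let ?k = "\<lambda>j. (- 1) ^ j / (fact (a - j) * fact j * fact b) :: real"
  define Q where "Q = (\<Sum>j\<le>a. Polynomial.smult (?k j * mellin_const (b + j)) ([:0, 1:] ^ (a - j)))"
  have "filterlim (\<lambda>\<epsilon>::real. 1 - \<epsilon>) (at_left 1) (at_right 0)" by real_asymp
  from filterlim_compose[OF artanh2_power_mellin_tendsto_at_1 this]
  have "((\<lambda>\<epsilon>. \<Sum>j\<le>a. ?k j * (artanh2 (1 - \<epsilon>) ^ (a - j) * (mellin_primitive (b + j) (1 - \<epsilon>) - mellin_const (b + j))))
      \<longlongrightarrow> (\<Sum>j\<le>a. ?k j * 0)) (at_right 0)"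
    by (intro tendsto_sum tendsto_mult tendsto_const)
  moreover have "(\<lambda>\<epsilon>. \<Sum>j\<le>a. ?k j * (artanh2 (1 - \<epsilon>) ^ (a - j) * (mellin_primitive (b + j) (1 - \<epsilon>) - mellin_const (b + j))))
      = (\<lambda>\<epsilon>. depth_primitive a b (1 - \<epsilon>) - poly Q (artanh2 (1 - \<epsilon>)))"
    by (simp add: depth_primitive_def Q_def poly_sum sum_subtractf[symmetric] algebra_simps)
  ultimately have "((\<lambda>\<epsilon>. (depth_primitive a b (1 - \<epsilon>) - poly Q (artanh2 (1 - \<epsilon>)))
      + (poly Q (artanh2 (1 - \<epsilon>)) - poly Q (ln 2 - ln \<epsilon>))) \<longlongrightarrow> (\<Sum>j\<le>a. ?k j * 0) + 0) (at_right 0)"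
    by (intro tendsto_add poly_artanh2_asymptotic) simp
  then have lim: "((\<lambda>\<epsilon>. depth_primitive a b (1 - \<epsilon>) - poly Q (ln 2 - ln \<epsilon>)) \<longlongrightarrow> 0) (at_right 0)"
    by simp
  have Q: "poly Q (ln 2 - ln \<epsilon>) = poly (reg_T a b) (- ln \<epsilon>)" for \<epsilon>
    by (simp add: Q_def reg_T_def poly_sum)
  show "((\<lambda>\<epsilon>. iter_int (1 - \<epsilon>) ?w - poly (reg_T a b) (- ln \<epsilon>)) \<longlongrightarrow> 0) (at_right 0)"
  proof (rule Lim_transform_eventually[OF lim])
    show "eventually (\<lambda>\<epsilon>. depth_primitive a b (1 - \<epsilon>) - poly Q (ln 2 - ln \<epsilon>)
        = iter_int (1 - \<epsilon>) ?w - poly (reg_T a b) (- ln \<epsilon>)) (at_right 0)"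
      unfolding eventually_at_right_field
      by (intro exI[of _ 1])
        (auto simp: Q iter_int_eq_iterated_primitive[OF iterated_primitive_depth_primitive[OF assms]])
  qed
qed

lemma reg_poly_replicate: "reg_poly (replicate b Omega_m1) = Polynomial.smult (1 / fact b) ([:ln 2, 1:] ^ b)"
proof (rule reg_poly_eqI)
  have lim: "((\<lambda>\<epsilon>. poly (Polynomial.smult (1 / fact b) ([:0, 1:] ^ b)) (artanh2 (1 - \<epsilon>))
      - poly (Polynomial.smult (1 / fact b) ([:0, 1:] ^ b)) (ln 2 - ln \<epsilon>)) \<longlongrightarrow> 0) (at_right 0)"
    by (rule poly_artanh2_asymptotic)
  show "((\<lambda>\<epsilon>. iter_int (1 - \<epsilon>) (replicate b Omega_m1)
      - poly (Polynomial.smult (1 / fact b) ([:ln 2, 1:] ^ b)) (- ln \<epsilon>)) \<longlongrightarrow> 0) (at_right 0)"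
  proof (rule Lim_transform_eventually[OF lim])
    show "eventually (\<lambda>\<epsilon>. poly (Polynomial.smult (1 / fact b) ([:0, 1:] ^ b)) (artanh2 (1 - \<epsilon>))
      - poly (Polynomial.smult (1 / fact b) ([:0, 1:] ^ b)) (ln 2 - ln \<epsilon>)
        = iter_int (1 - \<epsilon>) (replicate b Omega_m1)
      - poly (Polynomial.smult (1 / fact b) ([:ln 2, 1:] ^ b)) (- ln \<epsilon>)) (at_right 0)"
      unfolding eventually_at_right_field
      by (intro exI[of _ 1])
        (auto simp: iter_int_eq_iterated_primitive[OF iterated_primitive_artanh2_power])
  qed
qed

lemma reg_poly_convergent:
  assumes "iterated_primitive w G" "(G \<longlongrightarrow> c) (at_left 1)"
  shows "reg_poly w = [:c:]"
proof (rule reg_poly_eqI)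
  have "filterlim (\<lambda>\<epsilon>::real. 1 - \<epsilon>) (at_left 1) (at_right 0)" by real_asymp
  from filterlim_compose[OF assms(2) this]
  have lim: "((\<lambda>\<epsilon>. G (1 - \<epsilon>) - c) \<longlongrightarrow> 0) (at_right 0)" by (simp add: LIM_zero)
  show "((\<lambda>\<epsilon>. iter_int (1 - \<epsilon>) w - poly [:c:] (- ln \<epsilon>)) \<longlongrightarrow> 0) (at_right 0)"
  proof (rule Lim_transform_eventually[OF lim])
    show "eventually (\<lambda>\<epsilon>. G (1 - \<epsilon>) - c = iter_int (1 - \<epsilon>) w - poly [:c:] (- ln \<epsilon>)) (at_right 0)"
      unfolding eventually_at_right_field
      by (intro exI[of _ 1]) (auto simp: iter_int_eq_iterated_primitive[OF assms(1)])
  qed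
qed

lemma word_T_replicate: "word_T (replicate b 1) = replicate b Omega_m1"
  by (induction b) (auto simp: word_T_def)

lemma T_sh_replicate: "T_sh (replicate b 1) = Polynomial.smult (1 / fact b) ([:ln 2, 1:] ^ b)"
  using word_T_replicate[of b] by (auto simp: T_sh_def reg_poly_replicate)

lemma T_sh_depth: "T_sh (replicate a 1 @ [2] @ replicate b 1) = reg_T a (Suc b)"
proof -
  have "word_T (replicate a 1 @ [2] @ replicate b 1) = replicate a Omega_m1 @ Omega_0 # replicate (Suc b) Omega_m1"
    using word_T_replicate[of a] word_T_replicate[of b] by (simp add: word_T_def)
  then show ?thesis by (simp only: T_sh_def reg_poly_depth zero_less_Suc) simp
qed

text \<open>
  Collecting the powers of \<open>X + ln 2\<close>, the coefficient of the power \<open>n - j\<close> contains the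
  alternating sum for \<open>n - j\<close> and vanishes unless \<open>j = n\<close>.
\<close>

lemma sum_shuffle_replicate_reg_T:
  "(\<Sum>i\<le>n. Polynomial.smult ((- 1) ^ i / fact i) ([:ln 2, 1:] ^ i) * reg_T (n - i) b)
     = [:(- 1) ^ n * mellin_const (b + n) / (fact n * fact b):]"
proof -
  let ?V = "[:ln 2, 1:] :: real poly"
  let ?f = "\<lambda>i j. (- 1) ^ i / fact i * ((- 1) ^ j / (fact (n - i - j) * fact j * fact b) * mellin_const (b + j))"
  have "(\<Sum>i\<le>n. Polynomial.smult ((- 1) ^ i / fact i) (?V ^ i) * reg_T (n - i) b)
      = (\<Sum>i\<le>n. \<Sum>j\<le>n - i. Polynomial.smult (?f i j) (?V ^ (n - j)))"
    unfolding reg_T_def sum_distrib_left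
  proof (intro sum.cong refl)
    fix i j assume "i \<in> {..n}" "j \<in> {..n - i}"
    then have "n - j = i + (n - i - j)" by auto
    then have "?V ^ (n - j) = ?V ^ i * ?V ^ (n - i - j)" by (simp only: power_add)
    then show "Polynomial.smult ((- 1) ^ i / fact i) (?V ^ i) *
        Polynomial.smult ((- 1) ^ j / (fact (n - i - j) * fact j * fact b) * mellin_const (b + j)) (?V ^ (n - i - j))
        = Polynomial.smult (?f i j) (?V ^ (n - j))"
      by (simp only: mult_smult_left mult_smult_right smult_smult mult.commute)
  qed
  also have "\<dots> = (\<Sum>j\<le>n. \<Sum>i\<le>n - j. Polynomial.smult (?f i j) (?V ^ (n - j)))"
    unfolding sum.Sigma[OF finite_atMost ballI[OF finite_atMost]]
    by (rule sum.reindex_bij_witness[of _ prod.swap prod.swap]) auto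
  also have "\<dots> = (\<Sum>j\<le>n. if j = n then [:(- 1) ^ n * mellin_const (b + n) / (fact n * fact b):] else 0)"
  proof (intro sum.cong refl)
    fix j assume j: "j \<in> {..n}"
    have "(\<Sum>i\<le>n - j. Polynomial.smult (?f i j) (?V ^ (n - j))) = Polynomial.smult (\<Sum>i\<le>n - j. ?f i j) (?V ^ (n - j))"
      by (simp only: smult_sum)
    also have "(\<Sum>i\<le>n - j. ?f i j) = (- 1) ^ j * mellin_const (b + j) / (fact j * fact b)
        * (\<Sum>i\<le>n - j. (- 1) ^ i / (fact (n - j - i) * fact i))"
      unfolding sum_distrib_left by (intro sum.cong refl) (simp add: add.commute mult_ac)
    also have "(\<Sum>i\<le>n - j. (- 1) ^ i / (fact (n - j - i) * fact i) :: real) = (if j = n then 1 else 0)"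
      using j alternating_sum_inverse_fact[of "n - j", where ?'a = real] by auto
    finally show "(\<Sum>i\<le>n - j. Polynomial.smult (?f i j) (?V ^ (n - j)))
        = (if j = n then [:(- 1) ^ n * mellin_const (b + n) / (fact n * fact b):] else 0)"
      by auto
  qed
  also have "\<dots> = [:(- 1) ^ n * mellin_const (b + n) / (fact n * fact b):]" by simp
  finally show ?thesis .
qed

section \<open>Symmetric multiple T-values\<close>

lemma T_sym_eqI: "T_sym_poly s = [:c:] \<Longrightarrow> T_sym s = c"
  by (simp add: T_sym_def)

lemma minus_one_power_poly: "(- 1 :: real poly) ^ i = [:(- 1) ^ i:]"
  by (simp only: minus_one_power_iff) (simp add: one_pCons)

text \<open>
  The deconcatenations that cut before the entry 2 and those that cut after it are each a sum of
  the shape just evaluated; in the second family the reversal exchanges the roles of the two blocks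
  of ones.
\<close>

lemma T_sym_poly_depth:
  assumes "odd (l + m)"
  shows "T_sym_poly (replicate l 1 @ [2] @ replicate m 1)
     = [:(- 1) ^ l * mellin_const (Suc (l + m)) * (1 / (fact l * fact (Suc m)) + 1 / (fact m * fact (Suc l))):]"
proof -
  let ?s = "replicate l 1 @ [2] @ replicate m 1 :: nat list"
  let ?V = "[:ln 2, 1:] :: real poly"
  let ?g = "\<lambda>i. (\<Prod>j<i. (- 1) ^ (?s ! j)) * T_sh (rev (take i ?s)) * T_sh (drop i ?s)"
  have "T_sym_poly ?s = (\<Sum>i\<le>Suc (l + m). ?g i)"
    using assms by (simp add: T_sym_poly_def)
  \<comment> \<open>Cuts at most at \<open>l\<close> leave the entry 2 in the right factor, later cuts in the left one.\<close>
  also have "{..Suc (l + m)} = {..l} \<union> (\<lambda>j. Suc (l + j)) ` {..m}"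
  proof -
    have "i \<in> (\<lambda>j. Suc (l + j)) ` {..m}" if "l < i" "i \<le> Suc (l + m)" for i
      using that by (intro image_eqI[of _ _ "i - Suc l"]) auto
    then show ?thesis by (auto simp: not_le[symmetric])
  qed
  also have "(\<Sum>i\<in>{..l} \<union> (\<lambda>j. Suc (l + j)) ` {..m}. ?g i) = (\<Sum>i\<le>l. ?g i) + (\<Sum>j\<le>m. ?g (Suc (l + j)))"
    by (subst sum.union_disjoint) (auto simp: sum.reindex inj_on_def)
  also have "(\<Sum>i\<le>l. ?g i) = (\<Sum>i\<le>l. Polynomial.smult ((- 1) ^ i / fact i) (?V ^ i) * reg_T (l - i) (Suc m))"
  proof (intro sum.cong refl)
    fix i assume i: "i \<in> {..l}"
    have "(\<Prod>j<i. (- 1) ^ (?s ! j)) = (\<Prod>j<i. - 1 :: real poly)"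
      using i by (intro prod.cong) (auto simp: nth_append)
    moreover have "(- 1 :: real poly) ^ i = [:(- 1) ^ i:]"
      by (rule minus_one_power_poly)
    moreover have "rev (take i ?s) = replicate i 1" "drop i ?s = replicate (l - i) 1 @ [2] @ replicate m 1"
      using i by simp_all
    ultimately show "?g i = Polynomial.smult ((- 1) ^ i / fact i) (?V ^ i) * reg_T (l - i) (Suc m)"
      by (simp only: T_sh_replicate T_sh_depth prod_constant card_lessThan) simp
  qed
  also have "\<dots> = [:(- 1) ^ l * mellin_const (Suc m + l) / (fact l * fact (Suc m)):]"
    by (rule sum_shuffle_replicate_reg_T)
  also have "(\<Sum>j\<le>m. ?g (Suc (l + j))) = (\<Sum>i\<le>m. ?g (Suc (l + (m - i))))"
    by (rule sum.reindex_bij_witness[of _ "\<lambda>i. m - i" "\<lambda>i. m - i"]) auto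
  also have "\<dots> = (\<Sum>i\<le>m. [:(- 1) ^ (l + m):] * (Polynomial.smult ((- 1) ^ i / fact i) (?V ^ i) * reg_T (m - i) (Suc l)))"
  proof (intro sum.cong refl)
    fix i assume i: "i \<in> {..m}"
    have "(\<Prod>j<Suc (l + (m - i)). (- 1) ^ (?s ! j)) = (\<Prod>j\<in>{..<Suc (l + (m - i))} - {l}. (- 1 :: real poly) ^ (?s ! j))"
      by (rule prod.mono_neutral_right) (auto simp: nth_append)
    also have "\<dots> = (\<Prod>j\<in>{..<Suc (l + (m - i))} - {l}. - 1 :: real poly)"
      using i by (intro prod.cong) (auto simp: nth_append nth_Cons split: nat.splits)
    also have "\<dots> = (- 1) ^ (l + (m - i))" by simp
    also have "\<dots> = (- 1) ^ (l + m) * (- 1) ^ i"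
      using i by (simp add: minus_one_power_iff)
    finally have "(\<Prod>j<Suc (l + (m - i)). (- 1) ^ (?s ! j)) = (- 1 :: real poly) ^ (l + m) * (- 1) ^ i" .
    moreover have "(- 1 :: real poly) ^ i = [:(- 1) ^ i:]" for i
      by (rule minus_one_power_poly)
    moreover have "rev (take (Suc (l + (m - i))) ?s) = replicate (m - i) 1 @ [2] @ replicate l 1"
      "drop (Suc (l + (m - i))) ?s = replicate i 1"
      using i by (simp_all add: Suc_diff_le)
    ultimately show "?g (Suc (l + (m - i))) = [:(- 1) ^ (l + m):] * (Polynomial.smult ((- 1) ^ i / fact i) (?V ^ i) * reg_T (m - i) (Suc l))"
      by (simp only: T_sh_replicate T_sh_depth) (simp add: mult_ac)
  qed
  also have "\<dots> = [:(- 1) ^ (l + m):] * [:(- 1) ^ m * mellin_const (Suc l + m) / (fact m * fact (Suc l)):]"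
    by (simp only: sum_distrib_left[symmetric] sum_shuffle_replicate_reg_T)
  also have "[:(- 1) ^ l * mellin_const (Suc m + l) / (fact l * fact (Suc m)):] +
       [:(- 1) ^ (l + m):] * [:(- 1) ^ m * mellin_const (Suc l + m) / (fact m * fact (Suc l)):]
     = [:(- 1) ^ l * mellin_const (Suc (l + m)) * (1 / (fact l * fact (Suc m)) + 1 / (fact m * fact (Suc l))):]"
    by (simp add: power_add add.commute ring_distribs del: fact_Suc)
  finally show ?thesis .
qed

lemma T_sym_replicate_2:
  assumes "odd k" "l \<le> k"
  shows "T_sym (replicate l 1 @ [2] @ replicate (k - l) 1) = (- 1) ^ l * real ((k + 2) choose (l + 1)) * chi (k + 2) 1"
proof -
  have "T_sym (replicate l 1 @ [2] @ replicate (k - l) 1)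
      = (- 1) ^ l * mellin_const (Suc k) * (1 / (fact l * fact (Suc (k - l))) + 1 / (fact (k - l) * fact (Suc l)))"
    using T_sym_poly_depth[of l "k - l"] assms by (intro T_sym_eqI) simp
  also have "mellin_const (Suc k) = fact (Suc k) * chi (k + 2) 1" by (simp add: mellin_const_def)
  also have "(- 1) ^ l * (fact (Suc k) * chi (k + 2) 1) * (1 / (fact l * fact (Suc (k - l))) + 1 / (fact (k - l) * fact (Suc l)))
     = (- 1) ^ l * (fact (Suc k) / (fact l * fact (Suc k - l)) + fact (Suc k) / (fact (Suc l) * fact (Suc k - Suc l))) * chi (k + 2) 1"
    using assms by (simp add: Suc_diff_le algebra_simps del: fact_Suc)
  also have "fact (Suc k) / (fact l * fact (Suc k - l)) + fact (Suc k) / (fact (Suc l) * fact (Suc k - Suc l))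
      = real (Suc k choose l) + real (Suc k choose Suc l)"
    using assms by (simp only: binomial_fact Suc_le_mono le_SucI)
  also have "\<dots> = real ((k + 2) choose (l + 1))" by simp
  finally show ?thesis .
qed

lemma T_sym_singleton:
  assumes "odd k"
  shows "T_sym [k + 2] = chi (k + 2) 1 - lam (k + 2) 1"
proof (rule T_sym_eqI)
  have "T_sh [k + 2] = [:chi (k + 2) 1:]" "S_sh [k + 2] = [:lam (k + 2) 1:]"
    using reg_poly_convergent[OF iterated_primitive_polylog(1)[of "k + 1"], of "chi (k + 2) 1"]
      reg_poly_convergent[OF iterated_primitive_polylog(2)[of "k + 1"], of "lam (k + 2) 1"]
      polylog_tendsto_at_1[of odd_coeff "k + 2"] polylog_tendsto_at_1[of even_coeff "k + 2"] coeff_bounds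
    by (auto simp: T_sh_def S_sh_def word_T_def word_S_def simp del: replicate_Suc)
  moreover have "T_sh [] = 1" "S_sh [] = 1" by (auto simp: T_sh_def S_sh_def)
  ultimately show "T_sym_poly [k + 2] = [:chi (k + 2) 1 - lam (k + 2) 1:]"
    using assms by (simp add: T_sym_poly_def)
qed

lemma T_sym_comparison:
  assumes "odd k" and "l \<le> k"
  shows
    "T_sym (replicate l 1 @ [2] @ replicate (k - l) 1)
       = (- 1) ^ l / real (l + 1) * real ((k + 1) choose l) * T_sym (2 # replicate k 1)"
    "(- 1) ^ l / real (l + 1) * real ((k + 1) choose l) * T_sym (2 # replicate k 1)
       = (- 1) ^ l * real ((k + 2) choose (l + 1)) * ((2 ^ (k + 2) - 1) / (2 * (2 ^ (k + 1) - 1)))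
           * T_sym [k + 2]"
proof -
  have T2: "T_sym (2 # replicate k 1) = real (k + 2) * chi (k + 2) 1"
    using T_sym_replicate_2[OF assms(1), of 0] by simp
  have "real (Suc l) * real (Suc (k + 1) choose Suc l) = real (Suc (k + 1)) * real ((k + 1) choose l)"
    by (simp only: of_nat_mult[symmetric] Suc_times_binomial_eq mult.commute)
  then have "real ((k + 2) choose (l + 1)) = real (k + 2) * real ((k + 1) choose l) / real (l + 1)"
    by (simp add: field_simps del: binomial_Suc_Suc)
  then have "(- 1) ^ l / real (l + 1) * real ((k + 1) choose l) * (real (k + 2) * chi (k + 2) 1)
      = (- 1) ^ l * real ((k + 2) choose (l + 1)) * chi (k + 2) 1"
    by (simp only: times_divide_eq_left times_divide_eq_right mult_ac)
  then have *: "(- 1) ^ l / real (l + 1) * real ((k + 1) choose l) * T_sym (2 # replicate k 1)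
      = (- 1) ^ l * real ((k + 2) choose (l + 1)) * chi (k + 2) 1"
    by (simp only: T2)
  then show "T_sym (replicate l 1 @ [2] @ replicate (k - l) 1)
       = (- 1) ^ l / real (l + 1) * real ((k + 1) choose l) * T_sym (2 # replicate k 1)"
    by (simp only: T_sym_replicate_2[OF assms])
  define q :: real where "q = 2 ^ (k + 1)"
  have "2 \<le> q" using power_increasing[of 1 "k + 1" "2::real"] by (simp add: q_def)
  moreover have q2: "2 ^ (k + 2) = 2 * q" by (simp add: q_def)
  moreover have "chi (k + 2) 1 = (2 * q - 1) * lam (k + 2) 1" using chi_eq_lam[of "k + 2"] q2 by simp
  moreover from this have "T_sym [k + 2] = 2 * (q - 1) * lam (k + 2) 1"
    using T_sym_singleton[OF assms(1)] by (simp add: algebra_simps)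
  ultimately have "((2 ^ (k + 2) - 1) / (2 * (2 ^ (k + 1) - 1))) * T_sym [k + 2] = chi (k + 2) 1"
    unfolding q_def[symmetric] q2 by simp
  with * show "(- 1) ^ l / real (l + 1) * real ((k + 1) choose l) * T_sym (2 # replicate k 1)
       = (- 1) ^ l * real ((k + 2) choose (l + 1)) * ((2 ^ (k + 2) - 1) / (2 * (2 ^ (k + 1) - 1)))
           * T_sym [k + 2]"
    by (simp only: mult.assoc)
qed

section \<open>Rational numbers integral at a prime\<close>

definition p_integral :: "nat \<Rightarrow> rat \<Rightarrow> bool" where
  "p_integral p q \<longleftrightarrow> (\<exists>c d. q = of_int c / of_int d \<and> \<not> int p dvd d)"

text \<open>
  The difference is \<open>p\<close> times a rational number integral at \<open>p\<close>; on the local ring of those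
  numbers this is congruence modulo \<open>p\<close>.
\<close>

definition p_cong :: "nat \<Rightarrow> rat \<Rightarrow> rat \<Rightarrow> bool" where
  "p_cong p q r \<longleftrightarrow> p_integral p ((q - r) / of_nat p)"

lemma p_integralI: "q = of_int c / of_int d \<Longrightarrow> \<not> int p dvd d \<Longrightarrow> p_integral p q"
  unfolding p_integral_def by blast

context
  fixes p :: nat
  assumes p: "prime p"
begin

lemma prime_int_p: "prime (int p)" using p by simp

lemma p_integral_of_int [simp]: "p_integral p (of_int a)"
  using prime_int_p by (intro p_integralI[of _ a 1]) (auto simp: not_prime_unit)

lemma p_integral_of_nat [simp]: "p_integral p (of_nat n)"
  using p_integral_of_int[of "int n"] by simp

lemma p_integral_0_1_numeral [simp]: "p_integral p 0" "p_integral p 1" "p_integral p (numeral n)"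
  using p_integral_of_int[of 0] p_integral_of_int[of 1] p_integral_of_int[of "numeral n"] by simp_all

lemma p_integral_add [intro]:
  assumes "p_integral p q" "p_integral p r" shows "p_integral p (q + r)"
proof -
  obtain a b c d where *: "q = of_int a / of_int b" "\<not> int p dvd b" "r = of_int c / of_int d" "\<not> int p dvd d"
    using assms unfolding p_integral_def by blast
  then have "b \<noteq> 0" "d \<noteq> 0" by auto
  with * show ?thesis
    by (intro p_integralI[of _ "a * d + c * b" "b * d"])
      (auto simp: field_simps prime_dvd_mult_iff[OF prime_int_p])
qed

lemma p_integral_mult [intro]:
  assumes "p_integral p q" "p_integral p r" shows "p_integral p (q * r)"
proof -
  obtain a b c d where *: "q = of_int a / of_int b" "\<not> int p dvd b" "r = of_int c / of_int d" "\<not> int p dvd d"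
    using assms unfolding p_integral_def by blast
  then show ?thesis
    by (intro p_integralI[of _ "a * c" "b * d"]) (auto simp: prime_dvd_mult_iff[OF prime_int_p])
qed

lemma p_integral_minus [intro]: "p_integral p q \<Longrightarrow> p_integral p (- q)"
  using p_integral_mult[of "of_int (- 1)" q] p_integral_of_int[of "- 1"] by simp

lemma p_integral_diff [intro]: "p_integral p q \<Longrightarrow> p_integral p r \<Longrightarrow> p_integral p (q - r)"
  using p_integral_add[of q "- r"] by auto

lemma p_integral_sum [intro]: "(\<And>x. x \<in> A \<Longrightarrow> p_integral p (f x)) \<Longrightarrow> p_integral p (sum f A)"
  by (induction A rule: infinite_finite_induct) auto

lemma p_integral_power [intro]: "p_integral p q \<Longrightarrow> p_integral p (q ^ n)"
  by (induction n) auto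

lemma p_integral_inverse_int: "\<not> int p dvd d \<Longrightarrow> p_integral p (1 / of_int d)"
  by (rule p_integralI[of _ 1 d]) auto

lemma p_integral_divide_int: "p_integral p q \<Longrightarrow> \<not> int p dvd d \<Longrightarrow> p_integral p (q / of_int d)"
  using p_integral_mult[OF _ p_integral_inverse_int] by force

lemma p_integral_divide_nat: "p_integral p q \<Longrightarrow> \<not> p dvd d \<Longrightarrow> p_integral p (q / of_nat d)"
  using p_integral_divide_int[of q "int d"] by simp

lemma p_integral_divide_less: "p_integral p q \<Longrightarrow> 0 < d \<Longrightarrow> d < p \<Longrightarrow> p_integral p (q / of_nat d)"
  by (rule p_integral_divide_nat) (auto dest: dvd_imp_le)

lemma p_integral_divide_fact: "p_integral p q \<Longrightarrow> n < p \<Longrightarrow> p_integral p (q / fact n)"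
  using p_integral_divide_nat[of q "fact n"] prime_dvd_fact_iff[OF p, of n] by simp

lemma p_cong_refl [simp]: "p_cong p q q"
  by (simp add: p_cong_def)

lemma p_cong_sym: "p_cong p q r \<Longrightarrow> p_cong p r q"
  unfolding p_cong_def using p_integral_minus[of "(q - r) / of_nat p"] by (simp add: minus_divide_left)

lemma p_cong_trans: "p_cong p q r \<Longrightarrow> p_cong p r s \<Longrightarrow> p_cong p q s"
  unfolding p_cong_def using p_integral_add[of "(q - r) / of_nat p" "(r - s) / of_nat p"]
  by (simp add: add_divide_distrib[symmetric])

lemma p_cong_add: "p_cong p q r \<Longrightarrow> p_cong p q' r' \<Longrightarrow> p_cong p (q + q') (r + r')"
  unfolding p_cong_def using p_integral_add[of "(q - r) / of_nat p" "(q' - r') / of_nat p"]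
  by (simp add: add_divide_distrib[symmetric] add_diff_add)

lemma p_cong_sum: "(\<And>x. x \<in> A \<Longrightarrow> p_cong p (f x) (g x)) \<Longrightarrow> p_cong p (sum f A) (sum g A)"
  by (induction A rule: infinite_finite_induct) (auto intro!: p_cong_add)

lemma p_cong_mult_left: "p_integral p s \<Longrightarrow> p_cong p q r \<Longrightarrow> p_cong p (s * q) (s * r)"
  unfolding p_cong_def using p_integral_mult[of s "(q - r) / of_nat p"] by (simp add: right_diff_distrib)

lemma p_cong_of_int: "[a = b] (mod int p) \<Longrightarrow> p_cong p (of_int a) (of_int b)"
proof -
  assume "[a = b] (mod int p)"
  then obtain e where "a = b + int p * e" by (metis cong_iff_lin mult.commute cong_sym)
  then have "(of_int a - of_int b) / of_nat p = (of_int e :: rat)" using prime_gt_0_nat[OF p] by simp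
  then show ?thesis by (simp add: p_cong_def)
qed

lemma p_cong_0_mult_p: "p_integral p q \<Longrightarrow> p_cong p (of_nat p * q) 0"
  using prime_gt_0_nat[OF p] by (simp add: p_cong_def)

lemma p_cong_cancel:
  assumes "p_cong p (of_int a * q) (of_int a * r)" "\<not> int p dvd a"
  shows "p_cong p q r"
proof -
  have "a \<noteq> 0" using assms(2) by auto
  then show ?thesis
    using assms p_integral_divide_int[of "(of_int a * q - of_int a * r) / of_nat p" a] unfolding p_cong_def
    by (simp add: right_diff_distrib[symmetric])
qed

lemma rat_mod_mult_denominator:
  assumes "q = of_int c / of_int d" "\<not> int p dvd d"
  shows "[rat_mod p q * d = c] (mod int p)"
proof -
  obtain a b where ab: "quotient_of q = (a, b)" by fastforce
  then have b: "b > 0" "coprime a b" "q = of_int a / of_int b"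
    using quotient_of_denom_pos quotient_of_coprime quotient_of_div by auto
  have "d \<noteq> 0" using assms(2) by auto
  then have "of_int a * of_int d = (of_int c * of_int b :: rat)"
    using b assms(1) by (simp add: field_simps)
  then have "a * d = c * b" by (metis of_int_eq_iff of_int_mult)
  then have "b dvd d" using b(2) by (metis coprime_commute coprime_dvd_mult_right_iff dvd_triv_right)
  then have "\<not> int p dvd b" using assms(2) dvd_trans by blast
  then show ?thesis using rat_mod_cong[OF p ab _ assms] by blast
qed

lemma rat_mod_mult_cong:
  assumes "p_integral p f" "p_integral p g" "p_integral p q" "p_cong p f (q * g)"
  shows "[rat_mod p f = rat_mod p q * rat_mod p g] (mod int p)"
proof -
  obtain a b c d a' b' e h where
    f: "f = of_int c / of_int d" "\<not> int p dvd d" and g: "g = of_int a' / of_int b'" "\<not> int p dvd b'"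
    and q: "q = of_int a / of_int b" "\<not> int p dvd b"
    and eh: "(f - q * g) / of_nat p = of_int e / of_int h" "\<not> int p dvd h"
    using assms unfolding p_cong_def p_integral_def by blast
  have nz: "d \<noteq> 0" "b \<noteq> 0" "b' \<noteq> 0" "h \<noteq> 0" "p \<noteq> 0" using f g q eh p by auto
  have "(of_int c / of_int d - of_int a / of_int b * (of_int a' / of_int b')) * of_int h = (of_nat p * of_int e :: rat)"
    using eh(1) nz unfolding f(1) g(1) q(1) by (simp add: divide_eq_eq eq_divide_eq mult_ac)
  then have "of_int ((c * (b * b') - a * a' * d) * h) = (of_int (int p * e * (d * (b * b'))) :: rat)"
    using nz by (simp add: field_simps)
  then have "(c * (b * b') - a * a' * d) * h = int p * (e * (d * (b * b')))"
    unfolding of_int_eq_iff by (simp only: mult.assoc)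
  then have "int p dvd (c * (b * b') - a * a' * d) * h" by simp
  then have c1: "[c * (b * b') = a * a' * d] (mod int p)"
    using eh(2) by (simp add: prime_dvd_mult_iff[OF prime_int_p] cong_iff_dvd_diff)
  have "[rat_mod p f * d * (b * b') = c * (b * b')] (mod int p)"
    by (intro cong_mult cong_refl rat_mod_mult_denominator f)
  also note c1
  also have "[a * a' * d = (rat_mod p q * b) * (rat_mod p g * b') * d] (mod int p)"
    by (intro cong_mult cong_refl cong_sym[OF rat_mod_mult_denominator] q g)
  finally have "[rat_mod p f * (d * b * b') = rat_mod p q * rat_mod p g * (d * b * b')] (mod int p)"
    by (simp add: mult_ac)
  moreover have "coprime (d * b * b') (int p)"
    using f(2) g(2) q(2) p by (auto intro!: coprime_int_prime simp: prime_dvd_mult_iff[OF prime_int_p])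
  ultimately show ?thesis by (simp add: cong_mult_rcancel)
qed

end

text \<open>
  How congruences between rational representatives, valid for all large primes, become equations
  in the quotient ring.
\<close>

lemma class_A_eq_rat_A_mult:
  assumes "\<And>p. prime p \<Longrightarrow> N < p \<Longrightarrow> p_integral p (f p)" "\<And>p. prime p \<Longrightarrow> N < p \<Longrightarrow> p_integral p (g p)"
    and "\<And>p. prime p \<Longrightarrow> N < p \<Longrightarrow> p_integral p q" "\<And>p. prime p \<Longrightarrow> N < p \<Longrightarrow> p_cong p (f p) (q * g p)"
  shows "class_A (\<lambda>p. rat_mod p (f p)) = rat_A q * class_A (\<lambda>p. rat_mod p (g p))"
proof -
  have "A_eq (\<lambda>p. rat_mod p (f p)) (\<lambda>p. rat_mod p q * rat_mod p (g p))"
    unfolding A_eq_def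
  proof (rule finite_subset[of _ "{..N}"])
    show "{p. prime p \<and> \<not> [rat_mod p (f p) = rat_mod p q * rat_mod p (g p)] (mod int p)} \<subseteq> {..N}"
    proof safe
      fix p assume *: "prime p" "\<not> [rat_mod p (f p) = rat_mod p q * rat_mod p (g p)] (mod int p)"
      show "p \<le> N"
      proof (rule ccontr)
        assume "\<not> p \<le> N"
        then have "N < p" by simp
        then show False using rat_mod_mult_cong[OF *(1)] assms[OF *(1)] *(2) by blast
      qed
    qed
  qed simp
  then show ?thesis
    by (simp add: rat_A_def times_ring_A.abs_eq ring_A.abs_eq_iff)
qed

section \<open>Power sums modulo a prime and its square\<close>

text \<open>
  Multiplication by a primitive root \<open>g\<close> permutes the residues, so the sum is congruent to
  \<open>g^e\<close> times itself, and \<open>g^e\<close> is not congruent to 1.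
\<close>

lemma prime_dvd_power_sum:
  assumes p: "prime p" and e: "\<not> (p - 1) dvd e"
  shows "int p dvd (\<Sum>r=1..<p. int r ^ e)"
proof -
  obtain g where g: "residue_primroot p g"
    using prime_primitive_root_exists[of p] p prime_gt_1_nat by blast
  then have cop: "coprime p g" and ord: "ord p g = p - 1"
    by (auto simp: residue_primroot_def totient_prime[OF p])
  let ?f = "\<lambda>r. g * r mod p"
  have inj: "inj_on ?f {1..<p}"
  proof (rule inj_onI)
    fix x y assume *: "x \<in> {1..<p}" "y \<in> {1..<p}" "?f x = ?f y"
    then have "[x = y] (mod p)" using cop by (metis cong_def cong_mult_lcancel_nat coprime_commute)
    with * show "x = y" by (simp add: cong_def)
  qed
  have "?f ` {1..<p} \<subseteq> {1..<p}"
  proof safe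
    fix r assume r: "r \<in> {1..<p}"
    have "\<not> p dvd g * r"
      using r cop p by (auto simp: prime_dvd_mult_iff coprime_absorb_left dest: dvd_imp_le)
    then show "?f r \<in> {1..<p}" using prime_gt_0_nat[OF p] by (auto simp: dvd_eq_mod_eq_0 intro: Suc_leI)
  qed
  then have "?f ` {1..<p} = {1..<p}" using inj by (intro endo_inj_surj) auto
  then have "(\<Sum>r=1..<p. int r ^ e) = (\<Sum>r\<in>?f ` {1..<p}. int r ^ e)" by simp
  also have "\<dots> = (\<Sum>r=1..<p. int (?f r) ^ e)"
    using sum.reindex[OF inj, of "\<lambda>r. int r ^ e"] by (simp only: o_def)
  also have "[\<dots> = (\<Sum>r=1..<p. int (g * r) ^ e)] (mod int p)"
    by (intro cong_sum cong_pow) (simp add: zmod_int cong_def)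
  also have "(\<Sum>r=1..<p. int (g * r) ^ e) = int (g ^ e) * (\<Sum>r=1..<p. int r ^ e)"
    by (simp add: power_mult_distrib sum_distrib_left)
  finally have "int p dvd (int (g ^ e) - 1) * (\<Sum>r=1..<p. int r ^ e)"
    by (simp add: cong_iff_dvd_diff left_diff_distrib dvd_diff_commute)
  moreover have "\<not> int p dvd int (g ^ e) - 1"
  proof
    assume "int p dvd int (g ^ e) - 1"
    then have "[int (g ^ e) = int 1] (mod int p)" by (simp add: cong_iff_dvd_diff)
    then have "[g ^ e = 1] (mod p)" by (simp only: cong_int_iff)
    then show False using e ord ord_divides[of g e p] by simp
  qed
  ultimately show ?thesis using p by (simp add: prime_dvd_mult_iff)
qed

lemma power_sum_p_minus_1:
  assumes "prime p"
  shows "[(\<Sum>r=1..<p. int r ^ (p - 1)) = - 1] (mod int p)"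
proof -
  have "[(\<Sum>r=1..<p. int r ^ (p - 1)) = (\<Sum>r=1..<p. 1)] (mod int p)"
  proof (intro cong_sum)
    fix r assume "r \<in> {1..<p}"
    then have "[r ^ (p - 1) = 1] (mod p)" using assms by (intro fermat_theorem) (auto dest: dvd_imp_le)
    then have "[int (r ^ (p - 1)) = int 1] (mod int p)" by (simp only: cong_int_iff)
    then show "[int r ^ (p - 1) = 1] (mod int p)" by simp
  qed
  also have "(\<Sum>r=1..<p. 1) = int p - 1" using prime_gt_0_nat[OF assms] by (simp add: of_nat_diff)
  also have "[int p - 1 = - 1] (mod int p)" by (simp add: cong_iff_dvd_diff)
  finally show ?thesis .
qed

lemma power_diff_cong_square:
  fixes x q :: int
  shows "[(x - q) ^ Suc n = x ^ Suc n - int (Suc n) * q * x ^ n] (mod q\<^sup>2)"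
proof (induction n)
  case (Suc n)
  have "[(x - q) * (x - q) ^ Suc n = (x - q) * (x ^ Suc n - int (Suc n) * q * x ^ n)] (mod q\<^sup>2)"
    by (intro cong_mult cong_refl Suc.IH)
  also have "(x - q) * (x ^ Suc n - int (Suc n) * q * x ^ n)
     = x ^ Suc (Suc n) - int (Suc (Suc n)) * q * x ^ Suc n + q\<^sup>2 * (int (Suc n) * x ^ n)"
    by (simp add: algebra_simps power2_eq_square)
  also have "[\<dots> = x ^ Suc (Suc n) - int (Suc (Suc n)) * q * x ^ Suc n] (mod q\<^sup>2)"
    by (simp add: cong_iff_dvd_diff)
  finally show ?case by simp
qed simp

lemma fermat_int:
  assumes "prime p" "\<not> int p dvd x"
  shows "[x ^ (p - 1) = 1] (mod int p)"
proof -
  define r where "r = nat (x mod int p)"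
  have r: "[int r = x] (mod int p)" using prime_gt_0_nat[OF assms(1)] by (simp add: r_def cong_def)
  then have "\<not> int p dvd int r" using assms(2) cong_dvd_iff by blast
  then have "\<not> p dvd r" by simp
  then have "[r ^ (p - 1) = 1] (mod p)" using assms by (intro fermat_theorem)
  then have "[int (r ^ (p - 1)) = int 1] (mod int p)" by (simp only: cong_int_iff)
  then have "[int r ^ (p - 1) = 1] (mod int p)" by simp
  then show ?thesis using cong_pow[OF r, of "p - 1"] by (metis cong_sym cong_trans)
qed

text \<open>
  Put \<open>g x = x^(p-1+i) - x^i\<close>, which is divisible by \<open>p\<close> at integers. Every residue is \<open>2 r\<close>
  or \<open>2 r - p\<close> for exactly one \<open>r < p\<close>. The shift by \<open>p\<close> changes \<open>g\<close> by \<open>p x^(i-1)\<close> modulo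
  \<open>p\<^sup>2\<close>, and summing over the odd residues \<open>2 r - p\<close> produces the right-hand side. On the other
  hand \<open>g (2 r)\<close> is \<open>2^i g r\<close> up to \<open>(2^(p-1) - 1) 2^i r^(p-1+i)\<close>, which sums to 0 modulo \<open>p\<^sup>2\<close>.
\<close>

lemma fermat_quotient_sum_doubling:
  assumes p: "prime p" "odd p" and i: "0 < i" "i < p - 1"
  shows "[(\<Sum>r=1..<p. int r ^ (p - 1 + i) - int r ^ i) * (1 - 2 ^ i)
     = int p * (\<Sum>n | n < p \<and> odd n. int n ^ (i - 1))] (mod (int p)\<^sup>2)"
proof -
  define g where "g x = x ^ (p - 1 + i) - x ^ i" for x :: int
  define h where "h = (p - 1) div 2"
  have p2: "2 < p" using p prime_ge_2_nat[OF p(1)] by (cases "p = 2") auto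
  have ph: "p = 2 * h + 1" using p(2) by (auto simp: h_def elim!: oddE)
  have pi: "prime (int p)" using p by simp
  have shift: "[g (int n) = g (int n + int p) + int p * int n ^ (i - 1)] (mod (int p)\<^sup>2)" if n: "0 < n" "n < p" for n
  proof -
    define x where "x = int n + int p"
    have nd: "\<not> int p dvd int n" using n by (auto dest: dvd_imp_le)
    have xn: "[x = int n] (mod int p)" by (simp add: x_def cong_def)
    have e1: "p - 1 + i = Suc (p - 2 + i)" "i = Suc (i - 1)" using p2 i by simp_all
    have "[g (x - int p) = (x ^ (p - 1 + i) - int (p - 1 + i) * int p * x ^ (p - 2 + i))
        - (x ^ i - int i * int p * x ^ (i - 1))] (mod (int p)\<^sup>2)"
      unfolding g_def using power_diff_cong_square[of x "int p" "p - 2 + i"] power_diff_cong_square[of x "int p" "i - 1"]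
      unfolding e1[symmetric] by (intro cong_diff)
    also have "(x ^ (p - 1 + i) - int (p - 1 + i) * int p * x ^ (p - 2 + i)) - (x ^ i - int i * int p * x ^ (i - 1))
        = g x + int p * (int i * x ^ (i - 1) - int (p - 1 + i) * x ^ (p - 2 + i))"
      by (simp add: g_def algebra_simps)
    also have "[\<dots> = g x + int p * int n ^ (i - 1)] (mod (int p)\<^sup>2)"
    proof -
      have "[x ^ (p - 1) = 1] (mod int p)"
        using nd xn p(1) cong_dvd_iff by (intro fermat_int) blast+
      then have "[int (p - 1 + i) * (x ^ (i - 1) * x ^ (p - 1)) = (int i - 1) * (x ^ (i - 1) * 1)] (mod int p)"
        using p2 by (intro cong_mult cong_refl) (auto simp: cong_iff_dvd_diff of_nat_diff)
      moreover have "p - 2 + i = (i - 1) + (p - 1)" using p2 i by linarith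
      then have "x ^ (p - 2 + i) = x ^ (i - 1) * x ^ (p - 1)" by (simp only: power_add)
      ultimately have "[int i * x ^ (i - 1) - int (p - 1 + i) * x ^ (p - 2 + i)
          = int i * x ^ (i - 1) - (int i - 1) * (x ^ (i - 1) * 1)] (mod int p)"
        by (intro cong_diff cong_refl) simp
      also have "int i * x ^ (i - 1) - (int i - 1) * (x ^ (i - 1) * 1) = x ^ (i - 1)"
        by (simp add: algebra_simps)
      also have "[x ^ (i - 1) = int n ^ (i - 1)] (mod int p)" by (intro cong_pow xn)
      finally have "[int p * (int i * x ^ (i - 1) - int (p - 1 + i) * x ^ (p - 2 + i)) = int p * int n ^ (i - 1)] (mod (int p * int p))"
        by (simp add: cong_iff_dvd_diff right_diff_distrib[symmetric] mult_dvd_mono)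
      then show ?thesis by (intro cong_add cong_refl) (simp add: power2_eq_square)
    qed
    finally show ?thesis by (simp add: x_def)
  qed
  have split: "(\<Sum>r=1..<p. F r) = (\<Sum>r=1..h. F (2 * r)) + (\<Sum>n | n < p \<and> odd n. F n)" for F :: "nat \<Rightarrow> int"
  proof -
    have "{1..<p} = (\<lambda>r. 2 * r) ` {1..h} \<union> {n. n < p \<and> odd n}"
      by (auto simp: ph Suc_le_eq elim!: evenE intro: odd_pos)
    then have "(\<Sum>r=1..<p. F r) = sum F ((\<lambda>r. 2 * r) ` {1..h}) + (\<Sum>n | n < p \<and> odd n. F n)"
      by (simp only:) (rule sum.union_disjoint, auto)
    then show ?thesis by (simp add: sum.reindex inj_on_def)
  qed
  have odd_shift: "(\<Sum>n | n < p \<and> odd n. F (n + p)) = (\<Sum>r=h+1..<p. F (2 * r))" for F :: "nat \<Rightarrow> int"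
    by (rule sum.reindex_bij_witness[of _ "\<lambda>r. 2 * r - p" "\<lambda>n. (n + p) div 2"]) (auto simp: ph add.commute elim!: oddE)
  let ?Z = "\<Sum>r=1..<p. g (int r)" and ?O = "\<Sum>n | n < p \<and> odd n. int n ^ (i - 1)"
  have "[(\<Sum>n | n < p \<and> odd n. g (int n)) = (\<Sum>n | n < p \<and> odd n. g (int (n + p)) + int p * int n ^ (i - 1))] (mod (int p)\<^sup>2)"
    using shift by (intro cong_sum) (auto simp: odd_pos)
  then have "[?Z = (\<Sum>r=1..h. g (int (2 * r))) + (\<Sum>n | n < p \<and> odd n. g (int (n + p)) + int p * int n ^ (i - 1))] (mod (int p)\<^sup>2)"
    unfolding split[of "\<lambda>r. g (int r)"] by (intro cong_add cong_refl)
  also have "(\<Sum>r=1..h. g (int (2 * r))) + (\<Sum>n | n < p \<and> odd n. g (int (n + p)) + int p * int n ^ (i - 1))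
      = ((\<Sum>r=1..h. g (int (2 * r))) + (\<Sum>r=h+1..<p. g (int (2 * r)))) + int p * ?O"
    by (simp only: sum.distrib odd_shift[of "\<lambda>n. g (int n)"] sum_distrib_left add.assoc)
  also have "(\<Sum>r=1..h. g (int (2 * r))) + (\<Sum>r=h+1..<p. g (int (2 * r))) = (\<Sum>r=1..<p. g (int (2 * r)))"
  proof -
    have "{1..<p} = {1..h} \<union> {h+1..<p}" using p2 by (auto simp: h_def)
    then show ?thesis by (simp only:) (rule sum.union_disjoint[symmetric], auto)
  qed
  also have "(\<Sum>r=1..<p. g (int (2 * r))) = 2 ^ i * ?Z + (2 ^ (p - 1) - 1) * 2 ^ i * (\<Sum>r=1..<p. int r ^ (p - 1 + i))"
    unfolding sum_distrib_left sum.distrib[symmetric]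
    by (intro sum.cong refl) (unfold g_def power_add of_nat_mult power_mult_distrib, simp add: algebra_simps)
  finally have "[?Z = 2 ^ i * ?Z + (2 ^ (p - 1) - 1) * 2 ^ i * (\<Sum>r=1..<p. int r ^ (p - 1 + i)) + int p * ?O] (mod (int p)\<^sup>2)" .
  moreover have "(int p)\<^sup>2 dvd (2 ^ (p - 1) - 1) * 2 ^ i * (\<Sum>r=1..<p. int r ^ (p - 1 + i))"
  proof -
    have "\<not> (p - 1) dvd i" using i by (auto dest: dvd_imp_le)
    then have "\<not> (p - 1) dvd p - 1 + i" by (simp only: dvd_add_right_iff[OF dvd_refl] not_False_eq_True)
    then have "int p dvd (\<Sum>r=1..<p. int r ^ (p - 1 + i))" by (rule prime_dvd_power_sum[OF p(1)])
    moreover have "\<not> int p dvd 2" using p2 by (auto dest: zdvd_imp_le)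
    then have "int p dvd 2 ^ (p - 1) - 1" using fermat_int[OF p(1)] by (simp add: cong_iff_dvd_diff)
    ultimately show ?thesis by (simp add: power2_eq_square mult_dvd_mono mult.assoc dvd_mult)
  qed
  ultimately have "(int p)\<^sup>2 dvd (?Z - (2 ^ i * ?Z + (2 ^ (p - 1) - 1) * 2 ^ i * (\<Sum>r=1..<p. int r ^ (p - 1 + i)) + int p * ?O))
       + (2 ^ (p - 1) - 1) * 2 ^ i * (\<Sum>r=1..<p. int r ^ (p - 1 + i))"
    unfolding cong_iff_dvd_diff by (rule dvd_add)
  also have "\<dots> = ?Z * (1 - 2 ^ i) - int p * ?O" by (simp add: algebra_simps)
  finally show ?thesis unfolding g_def cong_iff_dvd_diff .
qed

section \<open>Truncated multiple T-sums as power series\<close>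

lemma T_tuples_Suc:
  "T_tuples (Suc d) N = (\<lambda>(n, ms). n # ms) ` (SIGMA n:{n. 0 < n \<and> n < N \<and> [n = Suc d] (mod 2)}. T_tuples d n)"
proof (rule Set.set_eqI)
  fix ns
  show "ns \<in> T_tuples (Suc d) N \<longleftrightarrow>
      ns \<in> (\<lambda>(n, ms). n # ms) ` (SIGMA n:{n. 0 < n \<and> n < N \<and> [n = Suc d] (mod 2)}. T_tuples d n)"
  proof (cases ns)
    case Nil
    then show ?thesis by (auto simp: T_tuples_def)
  next
    case (Cons n ms)
    have "(\<forall>j<Suc d. [(n # ms) ! j = Suc d - j] (mod 2))
        \<longleftrightarrow> [n = Suc d] (mod 2) \<and> (\<forall>j<d. [ms ! j = d - j] (mod 2))"
      by (simp only: All_less_Suc2 nth_Cons_0 nth_Cons_Suc diff_zero diff_Suc_Suc)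
    moreover have "sorted_wrt (>) (n # ms) \<and> set (n # ms) \<subseteq> {0<..<N}
        \<longleftrightarrow> 0 < n \<and> n < N \<and> sorted_wrt (>) ms \<and> set ms \<subseteq> {0<..<n}"
      by (auto simp: subset_iff)
    ultimately show ?thesis by (simp add: T_tuples_def Cons image_iff conj_ac) blast
  qed
qed

lemma finite_T_tuples: "finite (T_tuples d N)"
  by (rule finite_subset[OF _ finite_lists_length_eq[of "{0<..<N}" d]]) (auto simp: T_tuples_def)

lemma T_sum_Nil: "T_sum [] N = 1"
proof -
  have "T_tuples 0 N = {[]}" by (auto simp: T_tuples_def)
  then show ?thesis by (simp add: T_sum_def)
qed

lemma T_sum_Cons:
  "T_sum (a # s) N = (\<Sum>n | 0 < n \<and> n < N \<and> [n = Suc (length s)] (mod 2). 2 / of_nat n ^ a * T_sum s n)"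
proof -
  let ?A = "{n. 0 < n \<and> n < N \<and> [n = Suc (length s)] (mod 2)}"
  let ?w = "\<lambda>s ns. 2 ^ length s / (\<Prod>j<length s. of_nat (ns ! j) ^ (s ! j)) :: rat"
  have inj: "inj_on (\<lambda>(n, ms). n # ms) X" for X :: "(nat \<times> nat list) set" by (auto simp: inj_on_def)
  have "finite ?A" by (rule finite_subset[of _ "{..<N}"]) auto
  have "T_sum (a # s) N = (\<Sum>ns\<in>(\<lambda>(n, ms). n # ms) ` (SIGMA n:?A. T_tuples (length s) n). ?w (a # s) ns)"
    by (simp only: T_sum_def T_tuples_Suc list.size add.right_neutral add_Suc_right)
  also have "\<dots> = (\<Sum>(n, ms)\<in>(SIGMA n:?A. T_tuples (length s) n). ?w (a # s) (n # ms))"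
    unfolding sum.reindex[OF inj] by (simp only: case_prod_unfold o_def)
  also have "\<dots> = (\<Sum>n\<in>?A. \<Sum>ms\<in>T_tuples (length s) n. ?w (a # s) (n # ms))"
    by (rule sum.Sigma[symmetric]) (use \<open>finite ?A\<close> finite_T_tuples in auto)
  also have "\<dots> = (\<Sum>n\<in>?A. \<Sum>ms\<in>T_tuples (length s) n. 2 / of_nat n ^ a * ?w s ms)"
    by (intro sum.cong refl) (simp add: prod.lessThan_Suc_shift del: prod.lessThan_Suc)
  finally show ?thesis by (simp only: sum_distrib_left[symmetric] T_sum_def)
qed

text \<open>
  The truncated sums graded by the largest summation index, which is the Taylor series of the
  iterated integral of the word of \<open>s\<close>. For \<open>N > 0\<close>, \<open>T_sum s N\<close> is the sum of its coefficients
  below \<open>N\<close>.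
\<close>

definition top_series :: "nat list \<Rightarrow> rat fps" where
  "top_series s = Abs_fps (\<lambda>n. case s of [] \<Rightarrow> if n = 0 then 1 else 0
     | a # s' \<Rightarrow> if 0 < n \<and> [n = length s] (mod 2) then 2 / of_nat n ^ a * T_sum s' n else 0)"

lemma top_series_Nil: "top_series [] = 1"
  by (rule fps_ext) (simp add: top_series_def)

lemma top_series_Cons_nth:
  "fps_nth (top_series (a # s)) n = (if 0 < n \<and> [n = Suc (length s)] (mod 2) then 2 / of_nat n ^ a * T_sum s n else 0)"
  by (simp add: top_series_def)

lemma T_sum_eq_sum_top_series:
  assumes "0 < N"
  shows "T_sum s N = (\<Sum>n<N. fps_nth (top_series s) n)"
proof (cases s)
  case Nil
  then show ?thesis using assms by (simp add: T_sum_Nil top_series_Nil)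
next
  case (Cons a s')
  have "(\<Sum>n<N. fps_nth (top_series s) n) = (\<Sum>n | 0 < n \<and> n < N \<and> [n = Suc (length s')] (mod 2). fps_nth (top_series s) n)"
    by (rule sum.mono_neutral_right) (auto simp: Cons top_series_Cons_nth)
  also have "\<dots> = T_sum s N"
    unfolding Cons T_sum_Cons by (intro sum.cong refl) (auto simp: top_series_Cons_nth)
  finally show ?thesis ..
qed

lemma top_series_parity: "\<not> [n = length s] (mod 2) \<Longrightarrow> fps_nth (top_series s) n = 0"
  by (cases s; cases "n = 0") (auto simp: top_series_Nil top_series_Cons_nth)

text \<open>
  The Taylor series of \<open>ln ((1 + x) / (1 - x))\<close>.
\<close>

definition artanh2_fps :: "rat fps" where
  "artanh2_fps = Abs_fps (\<lambda>n. if odd n then 2 / of_nat n else 0)"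

lemma artanh2_fps_nth: "fps_nth artanh2_fps n = (if odd n then 2 / of_nat n else 0)"
  by (simp add: artanh2_fps_def)

lemma artanh2_fps_deriv_nth: "fps_nth (fps_deriv artanh2_fps) n = (if even n then 2 else 0)"
  by (simp add: artanh2_fps_nth del: of_nat_Suc)

lemma artanh2_fps_deriv: "fps_deriv artanh2_fps * (1 - fps_X\<^sup>2) = 2"
proof (rule fps_ext)
  fix n
  show "fps_nth (fps_deriv artanh2_fps * (1 - fps_X\<^sup>2)) n = fps_nth 2 n"
    using artanh2_fps_deriv_nth[of n] artanh2_fps_deriv_nth[of "n - 2"]
    by (cases "n = 0"; cases "n = 1")
      (auto simp: right_diff_distrib fps_X_power_mult_right_nth numeral_fps_const simp del: fps_deriv_nth)
qed

lemma cong_2_iff_even: "[a = b] (mod 2) \<longleftrightarrow> (even a \<longleftrightarrow> even (b :: nat))"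
  by (auto simp: cong_def mod2_eq_if)

text \<open>
  The coefficient of the product at \<open>n\<close> adds up the coefficients of \<open>top_series s\<close> at the indices of
  the parity of \<open>n\<close>, and the parity condition makes these either all or none of the nonzero ones.
\<close>

lemma top_series_1_deriv: "fps_deriv (top_series (1 # s)) = fps_deriv artanh2_fps * top_series s"
proof (rule fps_ext)
  fix n
  have "fps_nth (top_series s * fps_deriv artanh2_fps) n
      = (\<Sum>i\<le>n. fps_nth (top_series s) i * fps_nth (fps_deriv artanh2_fps) (n - i))"
    by (simp add: fps_mult_nth atLeast0AtMost del: fps_deriv_nth)
  also have "\<dots> = (\<Sum>i\<le>n. (if [Suc n = Suc (length s)] (mod 2) then 2 else 0) * fps_nth (top_series s) i)"
  proof (intro sum.cong refl)
    fix i assume i: "i \<in> {..n}"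
    show "fps_nth (top_series s) i * fps_nth (fps_deriv artanh2_fps) (n - i)
       = (if [Suc n = Suc (length s)] (mod 2) then 2 else 0) * fps_nth (top_series s) i"
    proof (cases "[i = length s] (mod 2)")
      case True
      then have "even (n - i) \<longleftrightarrow> [Suc n = Suc (length s)] (mod 2)"
        using i by (simp add: cong_2_iff_even)
      then show ?thesis by (simp add: artanh2_fps_deriv_nth del: fps_deriv_nth)
    qed (simp add: top_series_parity)
  qed
  also have "\<dots> = (if [Suc n = Suc (length s)] (mod 2) then 2 else 0) * T_sum s (Suc n)"
    by (simp only: sum_distrib_left[symmetric] T_sum_eq_sum_top_series[OF zero_less_Suc] lessThan_Suc_atMost)
  also have "\<dots> = fps_nth (fps_deriv (top_series (1 # s))) n"
    by (simp add: top_series_Cons_nth del: of_nat_Suc)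
  finally show "fps_nth (fps_deriv (top_series (1 # s))) n = fps_nth (fps_deriv artanh2_fps * top_series s) n"
    by (simp only: mult.commute)
qed

lemma top_series_2_nth: "of_nat n * fps_nth (top_series (2 # s)) n = fps_nth (top_series (1 # s)) n"
  by (simp add: top_series_Cons_nth power2_eq_square)

lemma fps_eq_of_deriv:
  fixes f g :: "rat fps"
  assumes "fps_deriv f = fps_deriv g" "fps_nth f 0 = fps_nth g 0"
  shows "f = g"
  using assms by (simp add: fps_deriv_eq_iff)

lemma top_series_replicate: "top_series (replicate b 1) = fps_const (1 / fact b) * artanh2_fps ^ b"
proof (induction b)
  case 0
  show ?case by (simp add: top_series_Nil)
next
  case (Suc b)
  have "fps_deriv (top_series (replicate (Suc b) 1)) = fps_deriv artanh2_fps * (fps_const (1 / fact b) * artanh2_fps ^ b)"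
    by (simp only: replicate_Suc top_series_1_deriv Suc)
  also have "fps_const (1 / fact b :: rat) = fps_const (1 / fact (Suc b)) * fps_const (of_nat (Suc b))"
    by (simp del: of_nat_Suc)
  also have "fps_deriv artanh2_fps * (fps_const (1 / fact (Suc b)) * fps_const (of_nat (Suc b)) * artanh2_fps ^ b)
      = fps_const (1 / fact (Suc b)) * (fps_const (of_nat (Suc b)) * fps_deriv artanh2_fps * artanh2_fps ^ b)"
    by (simp only: mult_ac)
  also have "fps_const (of_nat (Suc b)) * fps_deriv artanh2_fps * artanh2_fps ^ b = fps_deriv (artanh2_fps ^ Suc b)"
    unfolding fps_deriv_power by simp
  also have "fps_const (1 / fact (Suc b)) * \<dots> = fps_deriv (fps_const (1 / fact (Suc b)) * artanh2_fps ^ Suc b)"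
    by (simp only: fps_deriv_mult_const_left)
  finally show ?case
    by (rule fps_eq_of_deriv) (simp add: top_series_Cons_nth artanh2_fps_nth)
qed

text \<open>
  The formal integral of \<open>u^m dx/x\<close>.
\<close>

definition power_over_X :: "nat \<Rightarrow> rat fps" where
  "power_over_X m = Abs_fps (\<lambda>n. fps_nth (artanh2_fps ^ m) n / of_nat n)"

lemma fps_X_mult_deriv_nth: "fps_nth (fps_X * fps_deriv f) n = of_nat n * fps_nth f n"
  by (cases n) simp_all

lemma power_over_X_deriv: "0 < m \<Longrightarrow> fps_X * fps_deriv (power_over_X m) = artanh2_fps ^ m"
proof (rule fps_ext)
  fix n assume "0 < m"
  then show "fps_nth (fps_X * fps_deriv (power_over_X m)) n = fps_nth (artanh2_fps ^ m) n"
    unfolding fps_X_mult_deriv_nth by (cases "n = 0") (simp_all add: power_over_X_def artanh2_fps_nth fps_power_zeroth)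
qed

lemma fps_const_sum: "fps_const (sum f A) = (\<Sum>x\<in>A. fps_const (f x))"
  by (induction A rule: infinite_finite_induct) (simp_all flip: fps_const_add)

text \<open>
  The formal counterpart of \<open>iterated_primitive_depth_primitive\<close>, with the same cancellation.
\<close>

lemma top_series_depth:
  assumes b: "0 < b"
  shows "top_series (replicate a 1 @ 2 # replicate (b - 1) 1)
    = (\<Sum>j\<le>a. fps_const ((- 1) ^ j / (fact (a - j) * fact j * fact b)) * (artanh2_fps ^ (a - j) * power_over_X (b + j)))"
proof (induction a)
  case 0
  have "top_series (2 # replicate (b - 1) 1) = fps_const (1 / fact b) * power_over_X b"
  proof (rule fps_ext)
    fix n
    show "fps_nth (top_series (2 # replicate (b - 1) 1)) n = fps_nth (fps_const (1 / fact b) * power_over_X b) n"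
    proof (cases "n = 0")
      case False
      have "of_nat n * fps_nth (top_series (2 # replicate (b - 1) 1)) n = fps_nth (top_series (replicate b 1)) n"
        using b by (simp only: top_series_2_nth replicate_Suc[symmetric] Suc_diff_1)
      then have "of_nat n * fps_nth (top_series (2 # replicate (b - 1) 1)) n = fps_nth (artanh2_fps ^ b) n / fact b"
        by (simp only: top_series_replicate fps_mult_left_const_nth) simp
      then show ?thesis using False by (simp add: power_over_X_def field_simps)
    qed (simp add: top_series_Cons_nth power_over_X_def)
  qed
  then show ?case by simp
next
  case (Suc a)
  let ?u = "artanh2_fps" and ?c = "power_over_X"
  let ?k = "\<lambda>a j. (- 1) ^ j / (fact (a - j) * fact j * fact b) :: rat"
  let ?R = "\<lambda>a. \<Sum>j\<le>a. fps_const (?k a j) * (?u ^ (a - j) * ?c (b + j))"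
  have vanish: "(\<Sum>j\<le>Suc a. fps_const (?k (Suc a) j) * (?u ^ (Suc a - j) * fps_deriv (?c (b + j)))) = 0"
  proof -
    have "fps_X * (\<Sum>j\<le>Suc a. fps_const (?k (Suc a) j) * (?u ^ (Suc a - j) * fps_deriv (?c (b + j))))
        = (\<Sum>j\<le>Suc a. fps_const (?k (Suc a) j) * ?u ^ (Suc a + b))"
      unfolding sum_distrib_left
    proof (intro sum.cong refl)
      fix j assume "j \<in> {..Suc a}"
      then have "Suc a + b = (Suc a - j) + (b + j)" by simp
      then have "?u ^ (Suc a + b) = ?u ^ (Suc a - j) * ?u ^ (b + j)" by (simp only: power_add)
      then show "fps_X * (fps_const (?k (Suc a) j) * (?u ^ (Suc a - j) * fps_deriv (?c (b + j))))
          = fps_const (?k (Suc a) j) * ?u ^ (Suc a + b)"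
        using power_over_X_deriv[of "b + j"] b by (simp add: mult.left_commute)
    qed
    also have "\<dots> = (\<Sum>j\<le>Suc a. fps_const (?k (Suc a) j)) * ?u ^ (Suc a + b)"
      by (simp only: sum_distrib_right)
    also have "(\<Sum>j\<le>Suc a. fps_const (?k (Suc a) j))
        = fps_const (1 / fact b * (\<Sum>j\<le>Suc a. (- 1) ^ j / (fact (Suc a - j) * fact j)))"
      unfolding sum_distrib_left fps_const_sum
      by (intro sum.cong refl arg_cong[of _ _ fps_const]) simp
    also have "\<dots> = 0"
      using alternating_sum_inverse_fact[of "Suc a", where ?'a = rat] by (simp del: sum.atMost_Suc fact_Suc)
    finally show ?thesis by simp
  qed
  have "fps_deriv (?R (Suc a)) = (\<Sum>j\<le>Suc a. fps_const (?k (Suc a) j) *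
      (of_nat (Suc a - j) * ?u ^ (Suc a - j - 1) * fps_deriv ?u * ?c (b + j) + ?u ^ (Suc a - j) * fps_deriv (?c (b + j))))"
    unfolding fps_deriv_sum
    by (intro sum.cong refl) (simp add: fps_deriv_power' fps_of_nat mult_ac ring_distribs)
  also have "\<dots> = (\<Sum>j\<le>Suc a. fps_const (?k (Suc a) j) * (of_nat (Suc a - j) * ?u ^ (Suc a - j - 1) * fps_deriv ?u * ?c (b + j)))"
    using vanish by (simp only: ring_distribs sum.distrib add_0_right)
  also have "\<dots> = (\<Sum>j\<le>a. fps_const (?k (Suc a) j) * (of_nat (Suc a - j) * ?u ^ (Suc a - j - 1) * fps_deriv ?u * ?c (b + j)))"
    by simp
  also have "\<dots> = fps_deriv ?u * ?R a"
    unfolding sum_distrib_left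
  proof (intro sum.cong refl)
    fix j assume "j \<in> {..a}"
    then have eq: "Suc a - j = Suc (a - j)" by auto
    have "(fact (Suc a - j) :: rat) = of_nat (Suc a - j) * fact (a - j)"
      by (simp only: eq fact_Suc)
    then have "?k (Suc a) j * of_nat (Suc a - j) = ?k a j" using eq by (simp del: of_nat_Suc)
    then have "fps_const (?k (Suc a) j) * of_nat (Suc a - j) = fps_const (?k a j)"
      by (simp only: fps_of_nat[symmetric] fps_const_mult)
    then have "fps_const (?k (Suc a) j) * of_nat (Suc a - j) * (?u ^ (a - j) * fps_deriv ?u * ?c (b + j))
        = fps_const (?k a j) * (?u ^ (a - j) * fps_deriv ?u * ?c (b + j))" by (simp only:)
    then show "fps_const (?k (Suc a) j) * (of_nat (Suc a - j) * ?u ^ (Suc a - j - 1) * fps_deriv ?u * ?c (b + j))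
        = fps_deriv ?u * (fps_const (?k a j) * (?u ^ (a - j) * ?c (b + j)))"
      using eq by (simp only: diff_Suc_1 mult_ac)
  qed
  finally have "fps_deriv (?R (Suc a)) = fps_deriv (top_series (1 # (replicate a 1 @ 2 # replicate (b - 1) 1)))"
    by (simp only: top_series_1_deriv Suc)
  then have "top_series (1 # (replicate a 1 @ 2 # replicate (b - 1) 1)) = ?R (Suc a)"
  proof (rule fps_eq_of_deriv[OF sym])
    have "fps_nth (?c m) 0 = 0" for m by (simp add: power_over_X_def)
    then have "fps_nth (?R (Suc a)) 0 = 0"
      by (simp only: fps_sum_nth fps_mult_nth_0 mult_zero_right sum.neutral_const)
    then show "fps_nth (top_series (1 # (replicate a 1 @ 2 # replicate (b - 1) 1))) 0 = fps_nth (?R (Suc a)) 0"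
      by (simp only: top_series_Cons_nth less_irrefl False_implies_equals if_False simp_thms)
  qed
  then show ?case by (simp only: replicate_Suc append_Cons)
qed

lemma p_integral_artanh2_power:
  assumes p: "prime p" and "n < p"
  shows "p_integral p (fps_nth (artanh2_fps ^ m) n)"
  using assms(2)
proof (induction m arbitrary: n)
  case 0
  then show ?case using p by simp
next
  case (Suc m)
  have "p_integral p (fps_nth artanh2_fps i)" if "i \<le> n" for i
    using that Suc.prems p by (auto simp: artanh2_fps_nth odd_pos intro!: p_integral_divide_less)
  then show ?case using Suc
    by (auto simp: fps_mult_nth intro!: p_integral_sum[OF p] p_integral_mult[OF p])
qed

text \<open>
  The coefficient \<open>c\<^sub>m\<close> of \<open>w^m\<close> in the polynomial \<open>[x^p] ((1 + x) / (1 - x))^w\<close>.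
\<close>

definition artanh2_coeff :: "nat \<Rightarrow> nat \<Rightarrow> rat" where
  "artanh2_coeff p m = fps_nth (artanh2_fps ^ m) p / fact m"

text \<open>
  The parity of the depth makes the sum a multiple of a single coefficient, the one at \<open>p\<close>, of the
  series with a further entry 1 in front. There the coefficient of a product of \<open>u^i\<close>, \<open>i > 0\<close>, with
  \<open>\<integral> u^n dx/x\<close> involves only coefficients of \<open>x, ..., x^(p-1)\<close> of the two factors, which are
  integral at \<open>p\<close>.
\<close>

lemma T_sum_depth_p_cong:
  assumes p: "prime p" "odd p" and b: "0 < b" and ab: "even (a + b)" "Suc a + b < p"
  shows "p_cong p (2 * T_sum (replicate a 1 @ 2 # replicate (b - 1) 1) p)
    ((- 1) ^ Suc a * of_nat ((Suc a + b) choose b) * artanh2_coeff p (Suc a + b))"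
proof -
  let ?s = "replicate a 1 @ 2 # replicate (b - 1) 1 :: nat list"
  let ?u = "artanh2_fps" and ?c = "power_over_X"
  let ?k = "\<lambda>j. (- 1) ^ j / (fact (Suc a - j) * fact j * fact b) :: rat"
  let ?h = "\<lambda>j. fps_nth (?u ^ (Suc a - j) * ?c (b + j)) p"
  have p0: "of_nat p \<noteq> (0 :: rat)" using p by auto
  have "length ?s = a + b" using b by simp
  then have "[p = Suc (length ?s)] (mod 2)"
    using p(2) ab(1) unfolding cong_2_iff_even even_Suc by simp
  then have "fps_nth (top_series (1 # ?s)) p = 2 / of_nat p * T_sum ?s p"
    using p prime_gt_0_nat by (simp add: top_series_Cons_nth)
  then have "2 * T_sum ?s p = of_nat p * fps_nth (top_series (replicate (Suc a) 1 @ 2 # replicate (b - 1) 1)) p"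
    using p0 by simp
  also have "\<dots> = of_nat p * (\<Sum>j\<le>Suc a. ?k j * ?h j)"
    by (simp only: top_series_depth[OF b] fps_sum_nth fps_mult_left_const_nth)
  also have "\<dots> = of_nat p * (\<Sum>j\<le>a. ?k j * ?h j) + of_nat p * (?k (Suc a) * ?h (Suc a))"
    by (simp only: sum.atMost_Suc distrib_left)
  finally have eq: "2 * T_sum ?s p = of_nat p * (\<Sum>j\<le>a. ?k j * ?h j) + of_nat p * (?k (Suc a) * ?h (Suc a))" .
  have "p_integral p (?k j * ?h j)" if "j \<le> a" for j
  proof (rule p_integral_mult[OF p(1)])
    have "p_integral p ((- 1) ^ j / fact (Suc a - j) / fact j / fact b)"
      using ab b \<open>j \<le> a\<close> by (intro p_integral_divide_fact p(1) p_integral_power p_integral_minus p_integral_0_1_numeral) auto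
    then show "p_integral p (?k j)" by (simp del: fact_Suc)
    have "p_integral p (fps_nth (?u ^ (Suc a - j)) i * fps_nth (?c (b + j)) (p - i))" if i: "i \<le> p" for i
    proof (cases "i = 0 \<or> i = p")
      case True
      then show ?thesis
        using \<open>j \<le> a\<close> p(1) by (auto simp: fps_power_zeroth artanh2_fps_nth power_over_X_def power_0_left)
    next
      case False
      then show ?thesis using i unfolding power_over_X_def fps_nth_Abs_fps
        by (intro p_integral_mult p_integral_divide_less p_integral_artanh2_power p(1)) auto
    qed
    then show "p_integral p (?h j)"
      by (auto simp: fps_mult_nth intro!: p_integral_sum p(1))
  qed
  then have int: "p_integral p (\<Sum>j\<le>a. ?k j * ?h j)"
    by (intro p_integral_sum p(1)) auto
  have "of_nat p * (?k (Suc a) * ?h (Suc a))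
     = (- 1) ^ Suc a * (fact (Suc a + b) / (fact b * fact (Suc a))) * artanh2_coeff p (Suc a + b)"
    using p0 by (simp add: power_over_X_def artanh2_coeff_def add.commute del: fact_Suc power_Suc)
  also have "fact (Suc a + b) / (fact b * fact (Suc a)) = (of_nat ((Suc a + b) choose b) :: rat)"
    using binomial_fact[of b "Suc a + b", where ?'a = rat] by simp
  finally have "2 * T_sum ?s p = of_nat p * (\<Sum>j\<le>a. ?k j * ?h j)
      + (- 1) ^ Suc a * of_nat ((Suc a + b) choose b) * artanh2_coeff p (Suc a + b)"
    using eq by simp
  note eq2 = this
  have "p_cong p (of_nat p * (\<Sum>j\<le>a. ?k j * ?h j) + (- 1) ^ Suc a * of_nat ((Suc a + b) choose b) * artanh2_coeff p (Suc a + b))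
      (0 + (- 1) ^ Suc a * of_nat ((Suc a + b) choose b) * artanh2_coeff p (Suc a + b))"
    by (intro p_cong_add p_cong_0_mult_p p_cong_refl p(1) int)
  then show ?thesis by (simp only: eq2 add_0_left)
qed

section \<open>The exponential generating function modulo a prime\<close>

text \<open>
  The composition \<open>exp (u(x))\<close>, that is \<open>(1 + x) / (1 - x)\<close>.
\<close>

definition exp_artanh2 :: "rat fps" where
  "exp_artanh2 = fps_exp 1 oo artanh2_fps"

text \<open>
  The product satisfies the differential equation \<open>(1 + x) D' = D\<close>, \<open>D(0) = 1\<close>, which has the
  solution \<open>1 + x\<close> only.
\<close>

lemma exp_artanh2_mult: "exp_artanh2 * (1 - fps_X) = 1 + fps_X"
proof -
  define D where "D = exp_artanh2 * (1 - fps_X)"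
  have u0: "fps_nth artanh2_fps 0 = 0" by (simp add: artanh2_fps_nth)
  have "fps_deriv exp_artanh2 = exp_artanh2 * fps_deriv artanh2_fps"
    unfolding exp_artanh2_def by (simp add: fps_compose_deriv[OF u0])
  then have "(1 + fps_X) * fps_deriv D = exp_artanh2 * (fps_deriv artanh2_fps * (1 - fps_X\<^sup>2)) - exp_artanh2 * (1 + fps_X)"
    by (simp add: D_def algebra_simps power2_eq_square)
  also have "\<dots> = D"
    unfolding artanh2_fps_deriv by (simp add: D_def algebra_simps)
  finally have rec: "(1 + fps_X) * fps_deriv D = D" .
  have D: "of_nat (Suc n) * fps_nth D (Suc n) = (1 - of_nat n) * fps_nth D n" for n
  proof -
    have "fps_nth (fps_deriv D) n + fps_nth (fps_X * fps_deriv D) n = fps_nth D n"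
      using arg_cong[OF rec, of "\<lambda>f. fps_nth f n"] by (simp only: distrib_right mult_1_left fps_add_nth)
    then show ?thesis by (simp only: fps_X_mult_deriv_nth fps_deriv_nth) (simp add: algebra_simps)
  qed
  have D0: "fps_nth D 0 = 1"
    by (simp add: D_def exp_artanh2_def fps_mult_nth_0)
  have D1: "fps_nth D 1 = 1" using D[of 0] D0 by simp
  have "fps_nth D n = 0" if "2 \<le> n" for n
    using that
  proof (induction n rule: dec_induct)
    case base
    show ?case using D[of 1] by (simp add: numeral_2_eq_2)
  next
    case (step n)
    then show ?case using D[of n] by (simp del: of_nat_Suc)
  qed
  then have "fps_nth D n = fps_nth (1 + fps_X) n" for n
    using D0 D1 by (cases "n = 0"; cases "n = 1") auto
  then show ?thesis unfolding D_def[symmetric] by (intro fps_ext)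
qed

lemma exp_artanh2_power_nth:
  "fps_nth (exp_artanh2 ^ r) p = (\<Sum>m\<le>p. artanh2_coeff p m * of_nat r ^ m)"
proof -
  have "exp_artanh2 ^ r = fps_exp (of_nat r) oo artanh2_fps"
    unfolding exp_artanh2_def by (simp add: fps_compose_power artanh2_fps_nth fps_exp_power_mult)
  then show ?thesis
    by (simp add: fps_compose_nth artanh2_coeff_def atLeast0AtMost mult_ac)
qed

lemma exp_artanh2_power_int: "fps_nth (exp_artanh2 ^ r) n \<in> \<int>"
proof -
  define f :: "rat fps" where "f = Abs_fps (\<lambda>n. if n = 0 then 1 else 2)"
  have "f * (1 - fps_X) = 1 + fps_X"
  proof (rule fps_ext)
    fix n show "fps_nth (f * (1 - fps_X)) n = fps_nth (1 + fps_X) n"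
      by (cases "n = 0"; cases "n = 1") (auto simp: right_diff_distrib f_def)
  qed
  then have "exp_artanh2 * (1 - fps_X) = f * (1 - fps_X)" by (simp add: exp_artanh2_mult)
  moreover have "fps_nth (1 - fps_X :: rat fps) 0 \<noteq> fps_nth 0 0" by simp
  then have "(1 - fps_X :: rat fps) \<noteq> 0" by metis
  ultimately have "exp_artanh2 = f" by simp
  then have "fps_nth exp_artanh2 i \<in> \<int>" for i
    unfolding \<open>exp_artanh2 = f\<close> by (simp add: f_def)
  then show ?thesis
  proof (induction r arbitrary: n)
    case (Suc r)
    then show ?case by (auto simp: fps_mult_nth intro!: Ints_sum Ints_mult)
  qed simp
qed

text \<open>
  In \<open>((1 + x) / (1 - x))^r (1 - x)^p = (1 + x)^r (1 - x)^(p-r)\<close> the right-hand side is a polynomial of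
  degree \<open>p\<close> with leading coefficient \<open>(-1)^(p-r)\<close>. On the left \<open>(1 - x)^p\<close> may be replaced by
  \<open>1 - x^p\<close> modulo \<open>p\<close>, so its coefficient at \<open>p\<close> is the wanted one minus 1.
\<close>

lemma exp_artanh2_power_p_cong:
  assumes p: "prime p" "odd p" and r: "r \<le> p"
  shows "p_cong p (fps_nth (exp_artanh2 ^ r) p) (1 - (- 1) ^ r)"
proof -
  let ?E = "exp_artanh2"
  have p0: "0 < p" using p(1) prime_gt_0_nat by blast
  have "?E ^ r * (1 - fps_X) ^ p = (?E * (1 - fps_X)) ^ r * (1 - fps_X) ^ (p - r)"
    using r by (simp add: power_mult_distrib mult.assoc flip: power_add)
  also have "\<dots> = fps_of_poly ([:1, 1:] ^ r * [:1, - 1:] ^ (p - r))"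
    by (simp add: exp_artanh2_mult fps_of_poly_mult fps_of_poly_power fps_of_poly_pCons)
  finally have "fps_nth (?E ^ r * (1 - fps_X) ^ p) p = Polynomial.coeff ([:1, 1:] ^ r * [:1, - 1:] ^ (p - r)) p"
    by simp
  also have "\<dots> = Polynomial.coeff ([:1, 1:] ^ r * [:1, - 1:] ^ (p - r) :: rat poly)
      (degree ([:1, 1 :: rat:] ^ r) + degree ([:1, - 1 :: rat:] ^ (p - r)))"
    using r by (simp add: degree_power_eq)
  also have "\<dots> = (- 1) ^ (p - r)"
    unfolding coeff_mult_degree_sum by (simp add: lead_coeff_power)
  also have "(- 1) ^ (p - r) = - ((- 1) ^ r :: rat)"
    using p(2) r by (auto simp: minus_one_power_iff)
  finally have top: "fps_nth (?E ^ r * (1 - fps_X) ^ p) p = - ((- 1) ^ r)" .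
  have binom: "fps_nth ((1 - fps_X) ^ p) i = (if i \<le> p then of_nat (p choose i) * (- 1) ^ i else 0 :: rat)" for i
  proof -
    have "(1 - fps_X :: rat fps) ^ p = (\<Sum>k\<le>p. of_nat (p choose k) * (- fps_X) ^ k * 1 ^ (p - k))"
      using binomial_ring[of "- fps_X :: rat fps" 1 p] by simp
    also have "\<dots> = (\<Sum>k\<le>p. fps_const (of_nat (p choose k) * (- 1) ^ k) * fps_X ^ k)"
      by (intro sum.cong refl)
        (simp add: fps_of_nat[symmetric] power_minus[of fps_X] fps_const_neg[symmetric] fps_const_power[symmetric]
          fps_const_mult[symmetric] del: fps_const_mult fps_const_neg fps_const_power)
    finally show ?thesis
      by (simp add: fps_sum_nth if_distrib cong: if_cong)
  qed
  have "p_cong p (\<Sum>i\<le>p. fps_nth (?E ^ r) i * fps_nth ((1 - fps_X) ^ p) (p - i))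
     (\<Sum>i\<le>p. if i = p then fps_nth (?E ^ r) p else if i = 0 then - 1 else 0)"
  proof (intro p_cong_sum p(1))
    fix i assume i: "i \<in> {..p}"
    show "p_cong p (fps_nth (?E ^ r) i * fps_nth ((1 - fps_X) ^ p) (p - i))
      (if i = p then fps_nth (?E ^ r) p else if i = 0 then - 1 else 0)"
    proof (cases "i = 0 \<or> i = p")
      case True
      have "fps_nth ?E 0 = 1" by (simp add: exp_artanh2_def)
      then show ?thesis using True p p0 binom[of p] binom[of 0] by (auto simp: fps_power_zeroth)
    next
      case False
      obtain z where z: "fps_nth (?E ^ r) i = of_int z" using exp_artanh2_power_int by (metis Ints_cases)
      have "p dvd p choose (p - i)" using False i p by (intro dvd_choose_prime) auto
      then obtain q where "p choose (p - i) = p * q" ..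
      then have "fps_nth (?E ^ r) i * fps_nth ((1 - fps_X) ^ p) (p - i) = of_nat p * (of_int z * (of_nat q * (- 1) ^ (p - i)))"
        by (simp add: z binom mult_ac)
      moreover have "p_integral p (of_int z * (of_nat q * (- 1) ^ (p - i)))"
        using p(1) by (intro p_integral_mult p_integral_power p_integral_minus p_integral_of_int p_integral_of_nat p_integral_0_1_numeral)
      ultimately show ?thesis using False p_cong_0_mult_p[OF p(1)] by simp
    qed
  qed
  also have "(\<Sum>i\<le>p. fps_nth (?E ^ r) i * fps_nth ((1 - fps_X) ^ p) (p - i)) = - ((- 1) ^ r)"
    using top by (simp add: fps_mult_nth atLeast0AtMost)
  also have "(\<Sum>i\<le>p. if i = p then fps_nth (?E ^ r) p else if i = 0 then - 1 else 0) = fps_nth (?E ^ r) p - 1"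
  proof -
    have "{..p} = insert 0 (insert p {0<..<p})" using p0 by auto
    then show ?thesis using p0 by (simp add: sum.neutral)
  qed
  finally have "p_cong p (- ((- 1) ^ r)) (fps_nth (?E ^ r) p - 1)" .
  from p_cong_add[OF p(1) this p_cong_refl[OF p(1), of 1]] show ?thesis
    using p_cong_sym[OF p(1)] by simp
qed

section \<open>Coefficients of a polynomial from its values modulo a prime\<close>

text \<open>
  Lagrange interpolation at \<open>0, ..., p-1\<close>, whose denominators are products of differences
  of distinct residues.
\<close>

lemma p_integral_coeff_of_values:
  fixes f :: "rat poly"
  assumes p: "prime p" and deg: "degree f < p" and val: "\<And>r. r < p \<Longrightarrow> p_integral p (poly f (of_nat r))"
  shows "p_integral p (Polynomial.coeff f n)"
proof -
  let ?I = "\<lambda>g :: rat poly. \<forall>n. p_integral p (Polynomial.coeff g n)"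
  let ?L = "\<lambda>r. \<Prod>s\<in>{..<p} - {r}. [:- of_nat s, 1:] :: rat poly"
  let ?D = "\<lambda>r. \<Prod>s\<in>{..<p} - {r}. of_int (int r - int s) :: rat"
  have I_mult: "?I (g * h)" if "?I g" "?I h" for g h
    using that p by (auto simp: coeff_mult intro!: p_integral_sum p_integral_mult)
  have I_prod: "?I (\<Prod>s\<in>A. [:- of_nat s, 1:])" if "finite A" for A
    using that
  proof (induction A rule: finite_induct)
    case empty
    show ?case using p by simp
  next
    case (insert s A)
    have "?I [:- of_nat s, 1:]" using p by (auto simp: coeff_pCons split: nat.splits intro!: p_integral_minus)
    from I_mult[OF this insert.IH] show ?case unfolding prod.insert[OF insert.hyps] .
  qed
  have L: "poly (?L r) (of_nat t) = (if t = r then ?D r else 0)" if "r < p" "t < p" for r t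
  proof (cases "t = r")
    case False
    then have "poly (?L r) (of_nat t) = 0" using that by (auto simp: poly_prod intro!: prod_zero)
    then show ?thesis using False by simp
  qed (simp add: poly_prod)
  have D0: "?D r \<noteq> 0" for r by (auto simp: prod_zero_iff)
  have "f = (\<Sum>r<p. Polynomial.smult (poly f (of_nat r) / ?D r) (?L r))" (is "_ = ?g")
  proof (rule poly_eqI_degree[of "of_nat ` {..<p}"])
    fix x :: rat assume "x \<in> of_nat ` {..<p}"
    then obtain t where t: "t < p" "x = of_nat t" by auto
    have "poly ?g x = (\<Sum>r<p. if r = t then poly f (of_nat t) else 0)"
      unfolding poly_sum using t L D0 by (intro sum.cong refl) (auto simp del: of_int_diff)
    then show "poly f x = poly ?g x" using t by simp
  next
    show "degree f < card ((of_nat :: nat \<Rightarrow> rat) ` {..<p})" using deg by (simp add: card_image)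
    have "degree (?L r) \<le> p - 1" if "r < p" for r
      using that by (intro order_trans[OF degree_prod_sum_le]) auto
    then have "degree ?g \<le> p - 1"
      by (intro degree_sum_le) (auto intro: order_trans[OF degree_smult_le])
    then show "degree ?g < card ((of_nat :: nat \<Rightarrow> rat) ` {..<p})"
      using prime_gt_0_nat[OF p] by (simp add: card_image)
  qed
  moreover have "p_integral p (poly f (of_nat r) / ?D r * Polynomial.coeff (?L r) n)" if r: "r < p" for r
  proof -
    have "\<not> int p dvd (\<Prod>s\<in>{..<p} - {r}. int r - int s)"
    proof
      assume "int p dvd (\<Prod>s\<in>{..<p} - {r}. int r - int s)"
      then obtain s where "s < p" "s \<noteq> r" "int p dvd int r - int s"
        using p by (auto simp: prime_dvd_prod_iff)
      then show False using r dvd_imp_le_int[of "int r - int s" "int p"] by simp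
    qed
    then have "p_integral p (poly f (of_nat r) / of_int (\<Prod>s\<in>{..<p} - {r}. int r - int s))"
      using p val r by (intro p_integral_divide_int)
    then show ?thesis using I_prod p by (intro p_integral_mult) (auto simp only: of_int_prod finite_Diff finite_lessThan)
  qed
  ultimately show ?thesis
    using p by (metis (no_types, lifting) p_integral_sum coeff_sum coeff_smult lessThan_iff)
qed

text \<open>
  Among the power sums of exponents \<open>n + (p - 1 - m)\<close>, \<open>n < p\<close>, only the one for \<open>n = m\<close> has an
  exponent divisible by \<open>p - 1\<close>.
\<close>

lemma coeff_p_cong_power_sum_of_values:
  fixes f :: "rat poly"
  assumes p: "prime p" and deg: "degree f < p" and int: "\<And>n. p_integral p (Polynomial.coeff f n)"
    and m: "0 < m" "m < p - 1"
  shows "p_cong p (\<Sum>r=1..<p. poly f (of_nat r) * of_nat r ^ (p - 1 - m)) (- Polynomial.coeff f m)"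
proof -
  let ?j = "p - 1 - m"
  have p0: "0 < p" using p prime_gt_0_nat by blast
  have "(\<Sum>r=1..<p. poly f (of_nat r) * of_nat r ^ ?j) = (\<Sum>r=1..<p. \<Sum>n<p. Polynomial.coeff f n * of_nat r ^ (n + ?j))"
  proof (intro sum.cong refl)
    fix r
    have "poly f (of_nat r) = (\<Sum>n<p. Polynomial.coeff f n * of_nat r ^ n)"
      unfolding poly_altdef using deg by (intro sum.mono_neutral_left) (auto simp: coeff_eq_0)
    then show "poly f (of_nat r) * of_nat r ^ ?j = (\<Sum>n<p. Polynomial.coeff f n * of_nat r ^ (n + ?j))"
      by (simp add: sum_distrib_right power_add mult.assoc)
  qed
  also have "\<dots> = (\<Sum>n<p. Polynomial.coeff f n * of_int (\<Sum>r=1..<p. int r ^ (n + ?j)))"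
    by (subst sum.swap) (simp add: sum_distrib_left)
  also have "p_cong p \<dots> (\<Sum>n<p. if n = m then - Polynomial.coeff f m else 0)"
  proof (intro p_cong_sum p)
    fix n assume n: "n \<in> {..<p}"
    show "p_cong p (Polynomial.coeff f n * of_int (\<Sum>r=1..<p. int r ^ (n + ?j))) (if n = m then - Polynomial.coeff f m else 0)"
    proof (cases "n = m")
      case True
      then have "n + ?j = p - 1" using m by simp
      then have "p_cong p (of_int (\<Sum>r=1..<p. int r ^ (n + ?j))) (of_int (- 1))"
        using power_sum_p_minus_1[OF p] by (intro p_cong_of_int p) simp
      from p_cong_mult_left[OF p int this, of n] show ?thesis using True by simp
    next
      case False
      have "\<not> (p - 1) dvd n + ?j"
      proof
        assume "(p - 1) dvd n + ?j"
        then obtain q where q: "n + ?j = (p - 1) * q" ..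
        have "0 < n + ?j" "n + ?j < (p - 1) * 2" using m n by auto
        then have "0 < q" "q < 2"
          unfolding q by (simp_all only: mult_less_cancel1 nat_0_less_mult_iff)
        then have "q = 1" by simp
        then show False using q False m by auto
      qed
      then have "[(\<Sum>r=1..<p. int r ^ (n + ?j)) = 0] (mod int p)"
        using prime_dvd_power_sum[OF p] by (simp add: cong_0_iff)
      from p_cong_mult_left[OF p int p_cong_of_int[OF p this], of n] show ?thesis using False by simp
    qed
  qed
  also have "(\<Sum>n<p. if n = m then - Polynomial.coeff f m else 0) = - Polynomial.coeff f m"
    using m by simp
  finally show ?thesis .
qed

text \<open>
  The generating polynomial \<open>M\<close> has a denominator \<open>p\<close> in its coefficients \<open>c\<^sub>1\<close> and \<open>c\<^sub>p\<close>. Subtracting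
  \<open>c\<^sub>p (w^p - w)\<close> removes both denominators without touching the coefficient of \<open>w^m\<close>, at the cost of
  Fermat quotients in the values, since \<open>p c\<^sub>p\<close> is congruent to \<open>-2\<close> by the theorems of Fermat and
  Wilson.
\<close>

lemma artanh2_coeff_p_cong:
  assumes p: "prime p" "odd p" and m: "2 \<le> m" "m < p - 1"
  shows "p_cong p ((2 ^ (m - 1) - 1) * artanh2_coeff p m) (- (2 ^ m - 1) * T_sum [m] p)"
proof -
  note [simp] = p_integral_of_int[OF p(1)] p_integral_of_nat[OF p(1)] p_integral_0_1_numeral[OF p(1)]
  note p_cong_trans[OF p(1), trans]
  let ?c = "artanh2_coeff p"
  let ?j = "p - 1 - m"
  define i where "i = p - m"
  \<comment> \<open>Modulo \<open>p\<close> the power \<open>n ^ ?j\<close> stands for \<open>1 / n ^ m\<close>, so \<open>2 * P\<close> is \<open>T_sum [m] p\<close>; and \<open>Z\<close>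
    is \<open>p\<close> times the sum of Fermat quotients.\<close>
  define P where "P = (\<Sum>n | n < p \<and> odd n. int n ^ ?j)"
  define Z where "Z = (\<Sum>r=1..<p. int r ^ (p + ?j) - int r ^ Suc ?j)"
  define f where "f = (\<Sum>n\<le>p. Polynomial.monom (?c n) n) - Polynomial.smult (?c p) (Polynomial.monom 1 p - Polynomial.monom 1 1)"
  have p0: "0 < p" "1 < p" using p(1) prime_gt_0_nat prime_gt_1_nat by blast+
  have i: "0 < i" "i < p - 1" "i - 1 = ?j" "p - 1 + i = p + ?j" "i = Suc ?j" using m by (auto simp: i_def)
  have coeff_f: "Polynomial.coeff f n = (if n \<le> p then ?c n else 0) - ?c p * ((if n = p then 1 else 0) - (if n = 1 then 1 else 0))" for n
    unfolding f_def by (simp add: coeff_sum)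
  have deg: "degree f < p"
    using p0 by (intro degree_lessI) (auto simp: coeff_f)
  have poly_f: "poly f (of_nat r) = fps_nth (exp_artanh2 ^ r) p - ?c p * of_int (int r ^ p - int r)" for r
    by (simp add: f_def poly_sum poly_monom exp_artanh2_power_nth)
  have cp: "?c p = 2 ^ p / fact p"
    using startsby_zero_power_nth_same[of artanh2_fps p] by (simp add: artanh2_coeff_def artanh2_fps_nth)
  have "fact p = (of_nat p * fact (p - 1) :: rat)" using p0 by (simp add: fact_reduce)
  then have cp': "?c p = (2 ^ p / fact (p - 1)) / of_nat p" by (simp add: cp)
  have cp_int: "p_integral p (2 ^ p / fact (p - 1))"
    using p(1) p0 by (intro p_integral_divide_fact p_integral_power) auto
  have "\<not> int p dvd 2"
    using zdvd_imp_le[of "int p" 2] p(2) p0 by (cases "p = 2") auto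
  then have fermat2: "[2 ^ (p - 1) = 1] (mod int p)" by (rule fermat_int[OF p(1)])
  have cp_cong: "p_cong p (2 ^ p / fact (p - 1)) (- 2)"
  proof (rule p_cong_cancel[OF p(1)])
    show "\<not> int p dvd fact (p - 1)"
    proof
      assume "int p dvd fact (p - 1)"
      then have "int p dvd int (fact (p - 1))" by simp
      then have "p dvd fact (p - 1)" by (simp only: int_dvd_int_iff)
      then show False using prime_dvd_fact_iff[OF p(1), of "p - 1"] p0 by simp
    qed
    have "[2 ^ (p - 1) * 2 = 1 * (2 :: int)] (mod int p)"
      by (intro cong_mult cong_refl fermat2)
    also have "1 * 2 = (- 1) * (- 2 :: int)" by simp
    also have "[(- 1) * (- 2 :: int) = fact (p - 1) * (- 2)] (mod int p)"
      by (intro cong_mult cong_refl cong_sym[OF wilson_theorem] p)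
    also have "2 ^ (p - 1) * 2 = (2 ^ p :: int)" using p0 by (intro power_minus_mult) auto
    finally have "[2 ^ p = fact (p - 1) * (- 2 :: int)] (mod int p)" .
    then have "p_cong p (of_int (2 ^ p)) (of_int (fact (p - 1) * - 2))"
      by (rule p_cong_of_int[OF p(1)])
    then show "p_cong p (of_int (fact (p - 1)) * (2 ^ p / fact (p - 1))) (of_int (fact (p - 1)) * - 2)" by simp
  qed
  have fermat_quot: "\<exists>t. int r ^ p - int r = int p * t" for r
  proof -
    have "[int r ^ p = int r] (mod int p)"
    proof (cases "int p dvd int r")
      case True
      then have "int p dvd int r ^ p" by (rule dvd_trans[OF _ dvd_power]) (use p0 in auto)
      then show ?thesis unfolding cong_iff_dvd_diff by (rule dvd_diff[OF _ True])
    next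
      case False
      from cong_mult[OF fermat_int[OF p(1) this] cong_refl[of "int r"]] show ?thesis
        using power_minus_mult[of p "int r"] p0 by simp
    qed
    then show ?thesis by (auto simp: cong_iff_dvd_diff elim!: dvdE)
  qed
  have vals: "p_integral p (poly f (of_nat r))" 
    "p_cong p (poly f (of_nat r)) (1 - (- 1) ^ r + 2 * of_int (int r ^ p - int r) / of_nat p)" if r: "r < p" for r
  proof -
    obtain t where t: "int r ^ p - int r = int p * t" using fermat_quot by blast
    have v: "poly f (of_nat r) = fps_nth (exp_artanh2 ^ r) p + - of_int t * (2 ^ p / fact (p - 1))"
      unfolding poly_f t cp' using p0 by simp
    obtain z where z: "fps_nth (exp_artanh2 ^ r) p = of_int z" using exp_artanh2_power_int by (metis Ints_cases)
    show "p_integral p (poly f (of_nat r))"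
      unfolding v z by (intro p_integral_add p_integral_mult p_integral_minus p cp_int) auto
    have "p_cong p (poly f (of_nat r)) (1 - (- 1) ^ r + - of_int t * (- 2))"
      unfolding v using r
      by (intro p_cong_add exp_artanh2_power_p_cong p p_cong_mult_left cp_cong p_integral_minus) auto
    then show "p_cong p (poly f (of_nat r)) (1 - (- 1) ^ r + 2 * of_int (int r ^ p - int r) / of_nat p)"
      unfolding t using p0 by (simp add: mult.commute)
  qed
  have coeff_int: "p_integral p (Polynomial.coeff f n)" for n
    by (rule p_integral_coeff_of_values[OF p(1) deg vals(1)])
  have "Polynomial.coeff f m = ?c m" using m by (auto simp: coeff_f)
  then have c_int: "p_integral p (?c m)" and
    c_sum: "p_cong p (- ?c m) (\<Sum>r=1..<p. poly f (of_nat r) * of_nat r ^ ?j)"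
    using coeff_int[of m] p_cong_sym[OF p(1) coeff_p_cong_power_sum_of_values[OF p(1) deg coeff_int _ m(2)]] m by auto
  note c_sum
  also have "p_cong p (\<Sum>r=1..<p. poly f (of_nat r) * of_nat r ^ ?j)
      (\<Sum>r=1..<p. (1 - (- 1) ^ r + 2 * of_int (int r ^ p - int r) / of_nat p) * of_nat r ^ ?j)"
  proof (intro p_cong_sum p(1))
    fix r assume "r \<in> {1..<p}"
    then have "p_cong p (of_nat r ^ ?j * poly f (of_nat r)) (of_nat r ^ ?j * (1 - (- 1) ^ r + 2 * of_int (int r ^ p - int r) / of_nat p))"
      by (intro p_cong_mult_left p(1) p_integral_power vals) auto
    then show "p_cong p (poly f (of_nat r) * of_nat r ^ ?j) ((1 - (- 1) ^ r + 2 * of_int (int r ^ p - int r) / of_nat p) * of_nat r ^ ?j)"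
      by (simp only: mult.commute)
  qed
  also have "(\<Sum>r=1..<p. (1 - (- 1) ^ r + 2 * of_int (int r ^ p - int r) / of_nat p) * of_nat r ^ ?j)
      = 2 * of_int P + 2 * of_int Z / (of_nat p :: rat)"
  proof -
    have "(\<Sum>r=1..<p. (1 - (- 1) ^ r) * of_nat r ^ ?j) = (\<Sum>n | n < p \<and> odd n. 2 * of_nat n ^ ?j :: rat)"
      by (rule sum.mono_neutral_cong_right) (auto simp: Suc_le_eq intro: odd_pos)
    also have "\<dots> = 2 * of_int P" by (simp add: P_def sum_distrib_left)
    finally have 1: "(\<Sum>r=1..<p. (1 - (- 1) ^ r) * of_nat r ^ ?j) = (2 * of_int P :: rat)" .
    have "(\<Sum>r=1..<p. 2 * of_int (int r ^ p - int r) / of_nat p * of_nat r ^ ?j) = (2 * of_int Z / of_nat p :: rat)"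
      unfolding Z_def of_int_sum sum_distrib_left sum_divide_distrib
      by (intro sum.cong refl) (simp add: power_add algebra_simps)
    with 1 show ?thesis by (simp only: distrib_right sum.distrib)
  qed
  finally have c1: "p_cong p (- ?c m) (2 * of_int P + 2 * of_int Z / of_nat p)" .
  have "[Z * (1 - 2 ^ i) = int p * P] (mod (int p)\<^sup>2)"
    using fermat_quotient_sum_doubling[OF p i(1,2)] by (simp only: Z_def P_def i(3,4) flip: i(5))
  then obtain t where "Z * (1 - 2 ^ i) - int p * P = (int p)\<^sup>2 * t" by (auto simp: cong_iff_dvd_diff elim!: dvdE)
  then have "of_int (Z * (1 - 2 ^ i) - int p * P) = (of_int ((int p)\<^sup>2 * t) :: rat)" by (simp only:)
  then have Z: "of_int Z / of_nat p * (1 - 2 ^ i) = of_int P + (of_nat p * of_int t :: rat)"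
    using p0 by (simp add: field_simps power2_eq_square)
  have "p_cong p ((1 - 2 ^ i) * - ?c m) ((1 - 2 ^ i) * (2 * of_int P + 2 * of_int Z / of_nat p))"
    by (intro p_cong_mult_left p(1) c1 p_integral_diff p_integral_power) auto
  also have "(1 - 2 ^ i) * (2 * of_int P + 2 * of_int Z / of_nat p)
      = 2 * of_int P * (1 - 2 ^ i) + 2 * (of_int Z / of_nat p * (1 - 2 ^ i) :: rat)"
    by (simp only: distrib_left times_divide_eq_left times_divide_eq_right mult_ac)
  also have "\<dots> = of_nat p * (2 * of_int t) + 2 * of_int P * (2 - 2 ^ i)"
    unfolding Z by (simp add: algebra_simps)
  also have "p_cong p \<dots> (0 + 2 * of_int P * (2 - 2 ^ i))"
    by (intro p_cong_add p(1) p_cong_0_mult_p p_cong_refl p_integral_mult) auto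
  finally have "p_cong p (2 ^ (m - 1) * ((1 - 2 ^ i) * - ?c m)) (2 ^ (m - 1) * (0 + 2 * of_int P * (2 - 2 ^ i)))"
    by (intro p_cong_mult_left p(1) p_integral_power) auto
  moreover have "m = Suc (m - 1)" using m by simp
  then have "(2 :: rat) ^ m = 2 * 2 ^ (m - 1)" by (metis power_Suc)
  moreover have "p - 1 = (m - 1) + i" using m by (simp add: i_def)
  then have "(2 :: rat) ^ (p - 1) = 2 ^ (m - 1) * 2 ^ i" by (simp only: power_add)
  ultimately have c2: "p_cong p (?c m * (2 ^ (p - 1) - 2 ^ (m - 1))) (2 * of_int P * (2 ^ m - 2 ^ (p - 1)))"
    by (simp add: algebra_simps)

  have "p_cong p (of_int (1 - 2 ^ (m - 1))) (of_int (2 ^ (p - 1) - 2 ^ (m - 1)))"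
    by (intro p_cong_of_int p(1) cong_diff cong_refl cong_sym[OF fermat2])
  then have c2l: "p_cong p (?c m * (1 - 2 ^ (m - 1))) (?c m * (2 ^ (p - 1) - 2 ^ (m - 1)))"
    by (intro p_cong_mult_left p(1) c_int) simp
  have "p_cong p (of_int (2 ^ m - 2 ^ (p - 1))) (of_int (2 ^ m - 1))"
    by (intro p_cong_of_int p(1) cong_diff cong_refl fermat2)
  then have c2r: "p_cong p (2 * of_int P * (2 ^ m - 2 ^ (p - 1))) (2 * of_int P * (2 ^ m - 1))"
    by (intro p_cong_mult_left p(1) p_integral_mult) simp_all
  from c2 c2l c2r have c3: "p_cong p (?c m * (1 - 2 ^ (m - 1))) (2 * of_int P * (2 ^ m - 1))"
    using p_cong_trans[OF p(1)] by blast
  have T: "p_cong p (2 * of_int P) (T_sum [m] p)"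
  proof -
    have "T_sum [m] p = (\<Sum>n | n < p \<and> odd n. 2 * (1 / of_nat n ^ m))"
      unfolding T_sum_Cons T_sum_Nil
      by (rule sum.cong) (auto simp: cong_2_iff_even odd_pos)
    moreover have "(2 * of_int P :: rat) = (\<Sum>n | n < p \<and> odd n. 2 * of_nat n ^ ?j)"
      by (simp add: P_def sum_distrib_left)
    moreover have "p_cong p (\<Sum>n | n < p \<and> odd n. 2 * of_nat n ^ ?j) (\<Sum>n | n < p \<and> odd n. 2 * (1 / of_nat n ^ m))"
    proof (intro p_cong_sum p_cong_mult_left p(1))
      fix n assume n: "n \<in> {n. n < p \<and> odd n}"
      then have n0: "0 < n" by (auto intro: odd_pos)
      then have nd: "\<not> int p dvd int n" using n by (auto dest: dvd_imp_le)
      have "int n ^ (p - 1) = int n ^ m * int n ^ ?j" using m by (simp flip: power_add)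
      then have "p_cong p (of_int (int n ^ m * int n ^ ?j)) (of_int 1)"
        using fermat_int[OF p(1) nd] by (intro p_cong_of_int p(1)) simp
      then have "p_cong p (of_int (int n ^ m) * of_nat n ^ ?j) (of_int (int n ^ m) * (1 / of_nat n ^ m))"
        using n0 by simp
      moreover have "\<not> int p dvd int n ^ m" using nd prime_dvd_power[OF prime_int_p[OF p(1)]] by blast
      ultimately show "p_cong p (of_nat n ^ ?j) (1 / of_nat n ^ m)" by (rule p_cong_cancel[OF p(1)])
    qed simp
    ultimately show ?thesis by simp
  qed
  have "(2 ^ (m - 1) - 1) * ?c m = of_int (- 1) * (?c m * (1 - 2 ^ (m - 1)))"
    by (simp add: algebra_simps)
  also have "p_cong p \<dots> (of_int (- 1) * (2 * of_int P * (2 ^ m - 1)))"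
    by (intro p_cong_mult_left p(1) p_integral_of_int c3)
  also have "of_int (- 1) * (2 * of_int P * (2 ^ m - 1)) = of_int (1 - 2 ^ m) * (2 * of_int P :: rat)"
    by (simp add: algebra_simps)
  also have "p_cong p \<dots> (of_int (1 - 2 ^ m) * T_sum [m] p)"
    by (intro p_cong_mult_left p(1) p_integral_of_int T)
  also have "of_int (1 - 2 ^ m) * T_sum [m] p = - (2 ^ m - 1) * T_sum [m] p"
    by simp
  finally show ?thesis .
qed

section \<open>Finite multiple T-values\<close>

lemma p_integral_T_sum:
  assumes p: "prime p"
  shows "N \<le> p \<Longrightarrow> p_integral p (T_sum s N)"
proof (induction s arbitrary: N)
  case Nil
  then show ?case using p by (simp add: T_sum_Nil)
next
  case (Cons a s)
  have "p_integral p (2 / of_nat n ^ a)" if "0 < n" "n < p" for n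
  proof -
    have "\<not> p dvd n ^ a" using that nat_dvd_not_less prime_dvd_power[OF p] by blast
    from p_integral_divide_nat[OF p _ this, of 2] show ?thesis using p by simp
  qed
  moreover have "p_integral p (T_sum s n)" if "n < N" for n
    using that Cons by simp
  ultimately show ?case unfolding T_sum_Cons using Cons.prems
    by (intro p_integral_sum p_integral_mult p) (auto simp del: times_divide_eq_left)
qed

text \<open>
  Clearing the denominator \<open>D = 2 (2^(k+1) - 1)\<close> turns the claim into a combination of the two
  congruences above; primes above \<open>D\<close> do not divide it.
\<close>

lemma T_A_depth:
  assumes k: "odd k" and l: "l \<le> k"
  shows "T_A (replicate l 1 @ [2] @ replicate (k - l) 1)
    = rat_A ((- 1) ^ l * of_nat ((k + 2) choose (l + 1)) * ((2 ^ (k + 2) - 1) / (2 * (2 ^ (k + 1) - 1)))) * T_A [k + 2]"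
proof -
  let ?q = "(- 1) ^ l * of_nat ((k + 2) choose (l + 1)) * ((2 ^ (k + 2) - 1) / (2 * (2 ^ (k + 1) - 1))) :: rat"
  let ?s = "replicate l 1 @ [2] @ replicate (k - l) 1"
  let ?C = "(- 1) ^ l * int ((k + 2) choose (l + 1))"
  define D where "D = 2 * (2 ^ (k + 1) - 1 :: int)"
  \<comment> \<open>Above \<open>k + 4\<close> the congruences for the weight \<open>k + 2\<close> apply, since \<open>k + 2 < p - 1\<close>.\<close>
  define N where "N = k + 4 + nat D"
  have "1 < (2::int) ^ (k + 1)" by (rule one_less_power) auto
  then have D0: "0 < D" unfolding D_def by (intro mult_pos_pos) (simp_all only: diff_gt_0_iff_gt zero_less_numeral)
  have D: "\<not> int p dvd D" if "N < p" for p
  proof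
    assume "int p dvd D"
    then have "int p \<le> D" using D0 by (rule zdvd_imp_le)
    then show False using that D0 by (simp add: N_def)
  qed
  have q: "?q = of_int (?C * (2 ^ (k + 2) - 1)) / of_int D" by (simp add: D_def)
  have "class_A (\<lambda>p. rat_mod p (T_sum ?s p)) = rat_A ?q * class_A (\<lambda>p. rat_mod p (T_sum [k + 2] p))"
  proof (rule class_A_eq_rat_A_mult[where N = N])
    fix p assume p: "prime p" "N < p"
    note int = p_integral_of_int[OF p(1)]
    note p_cong_trans[OF p(1), trans]
    show "p_integral p (T_sum ?s p)" "p_integral p (T_sum [k + 2] p)"
      using p_integral_T_sum[OF p(1)] by simp_all
    show "p_integral p ?q"
      unfolding q using D[OF p(2)] by (intro p_integral_divide_int p(1) int)
    have odd: "odd p" using p prime_odd_nat[of p] by (simp add: N_def)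
    show "p_cong p (T_sum ?s p) (?q * T_sum [k + 2] p)"
    proof (rule p_cong_cancel[OF p(1) _ D[OF p(2)]])
      let ?c = "artanh2_coeff p (k + 2)"
      have "p_cong p (2 * T_sum ?s p) ((- 1) ^ Suc l * of_nat ((k + 2) choose (l + 1)) * ?c)"
        using T_sum_depth_p_cong[OF p(1) odd, where a = l and b = "k - l + 1"] k l p(2)
          binomial_symmetric[of "l + 1" "k + 2"]
        by (simp add: N_def Suc_diff_le del: binomial_Suc_Suc)
      then have "p_cong p (of_int (2 ^ (k + 1) - 1) * (2 * T_sum ?s p))
          (of_int (2 ^ (k + 1) - 1) * ((- 1) ^ Suc l * of_nat ((k + 2) choose (l + 1)) * ?c))"
        by (intro p_cong_mult_left p(1) int)
      also have "of_int (2 ^ (k + 1) - 1) * ((- 1) ^ Suc l * of_nat ((k + 2) choose (l + 1)) * ?c)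
          = of_int (- ?C) * ((2 ^ (k + 2 - 1) - 1) * ?c)" by (simp add: mult_ac)
      also have "p_cong p \<dots> (of_int (- ?C) * (- (2 ^ (k + 2) - 1) * T_sum [k + 2] p))"
        using p(2) by (intro p_cong_mult_left p(1) int artanh2_coeff_p_cong odd) (auto simp: N_def)
      also have "of_int (- ?C) * (- (2 ^ (k + 2) - 1) * T_sum [k + 2] p)
          = of_int (?C * (2 ^ (k + 2) - 1)) * T_sum [k + 2] p"
        by (simp add: algebra_simps del: binomial_Suc_Suc)
      also have "\<dots> = of_int D * (?q * T_sum [k + 2] p)"
        unfolding q using D0 by simp
      also have "of_int (2 ^ (k + 1) - 1) * (2 * T_sum ?s p) = of_int D * T_sum ?s p"
        by (simp add: D_def)
      finally show "p_cong p (of_int D * T_sum ?s p) (of_int D * (?q * T_sum [k + 2] p))" using p(1) by simp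
    qed
  qed
  then show ?thesis by (simp only: T_A_def)
qed

lemma T_A_comparison:
  assumes "odd k" and "l \<le> k"
  shows "T_A (replicate l 1 @ [2] @ replicate (k - l) 1)
       = rat_A ((- 1) ^ l / of_nat (l + 1) * of_nat ((k + 1) choose l)) * T_A (2 # replicate k 1)"
    "rat_A ((- 1) ^ l / of_nat (l + 1) * of_nat ((k + 1) choose l)) * T_A (2 # replicate k 1)
       = rat_A ((- 1) ^ l * of_nat ((k + 2) choose (l + 1))
           * ((2 ^ (k + 2) - 1) / (2 * (2 ^ (k + 1) - 1)))) * T_A [k + 2]"
proof -
  let ?e = "(2 ^ (k + 2) - 1) / (2 * (2 ^ (k + 1) - 1)) :: rat"
  have T2: "T_A (2 # replicate k 1) = rat_A (of_nat (k + 2) * ?e) * T_A [k + 2]"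
    using T_A_depth[OF assms(1), of 0] by simp
  have "of_nat (Suc l) * of_nat (Suc (k + 1) choose Suc l) = (of_nat (Suc (k + 1)) * of_nat ((k + 1) choose l) :: rat)"
    by (simp only: of_nat_mult[symmetric] Suc_times_binomial_eq mult.commute)
  then have "of_nat ((k + 2) choose (l + 1)) = (of_nat (k + 2) * of_nat ((k + 1) choose l) / of_nat (l + 1) :: rat)"
    by (simp add: field_simps del: binomial_Suc_Suc)
  then have "(- 1) ^ l / of_nat (l + 1) * of_nat ((k + 1) choose l) * (of_nat (k + 2) * ?e)
      = (- 1) ^ l * of_nat ((k + 2) choose (l + 1)) * ?e"
    by (simp only: times_divide_eq_left times_divide_eq_right mult_ac)
  then show *: "rat_A ((- 1) ^ l / of_nat (l + 1) * of_nat ((k + 1) choose l)) * T_A (2 # replicate k 1)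
       = rat_A ((- 1) ^ l * of_nat ((k + 2) choose (l + 1)) * ?e) * T_A [k + 2]"
    unfolding T2 by (simp only: mult.assoc[symmetric] rat_A_hom(3)[symmetric])
  show "T_A (replicate l 1 @ [2] @ replicate (k - l) 1)
       = rat_A ((- 1) ^ l / of_nat (l + 1) * of_nat ((k + 1) choose l)) * T_A (2 # replicate k 1)"
    unfolding * by (rule T_A_depth[OF assms])
qed

section \<open>One entry 2 among ones\<close>

theorem theorem1p3:
  fixes k l :: nat
  assumes "odd k" and "l \<le> k"
  shows
    "T_sym (replicate l 1 @ [2] @ replicate (k - l) 1)
       = (- 1) ^ l / real (l + 1) * real ((k + 1) choose l) * T_sym (2 # replicate k 1)
     \<and> (- 1) ^ l / real (l + 1) * real ((k + 1) choose l) * T_sym (2 # replicate k 1)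
       = (- 1) ^ l * real ((k + 2) choose (l + 1)) * ((2 ^ (k + 2) - 1) / (2 * (2 ^ (k + 1) - 1)))
           * T_sym [k + 2]
     \<and> T_A (replicate l 1 @ [2] @ replicate (k - l) 1)
       = rat_A ((- 1) ^ l / of_nat (l + 1) * of_nat ((k + 1) choose l)) * T_A (2 # replicate k 1)
     \<and> rat_A ((- 1) ^ l / of_nat (l + 1) * of_nat ((k + 1) choose l)) * T_A (2 # replicate k 1)
       = rat_A ((- 1) ^ l * of_nat ((k + 2) choose (l + 1))
           * ((2 ^ (k + 2) - 1) / (2 * (2 ^ (k + 1) - 1)))) * T_A [k + 2]"
  using T_sym_comparison[OF assms] T_A_comparison[OF assms] by (intro conjI)

end
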